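(* Let $f(t)=\sum_{i\ge 1}f_i\frac{t^i}{i!}\in\mathbb{R}[[t]]$ with $f_1\ne 0$, and let $g(t)=(1+f(t))^{\gamma}\exp(\lambda f(t))$, where $\gamma,\lambda$ (and $q$) are indeterminates unless specialized. If $1/[(1+t)\bar f'(t)]$ is a PF function, then: (i) both $(S_n(f,g;q))_{n\ge 0}$ and $(S_n^*(f,g;q))_{n\ge 0}$ are $(\gamma,\lambda,q)$-SM and $3$-$(\gamma,\lambda,q)$-log-convex; (ii) $(S_n(f,(1+f)^{\gamma};q))_{n\ge 0}$ is $(\gamma,q)$-SM and $3$-$(\gamma,q)$-log-convex; (iii) $(f_{n+1})_{n\ge 0}$ is SM and $3$-log-convex; (iv) $[S_{n,k}(f,g)]_{n,k}$ is $(\gamma,\lambda)$-TP; (v) $[(-1)^{n-k}S_{n,k}(\bar f,1/g(\bar f))]_{n,k}$ is TP for real $\gamma\ge 0$ and $\lambda\ge 0$; (vi) the convolution $z_n=\sum_{k=0}^nS_{n,k}(f,g)x_ky_{n-k}$ preserves the SM property for real $\gamma\ge 0$ and $\lambda\ge 0$.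
   Context: Total positivity. A real matrix is TP if all its minors are nonnegative. For a set $\mathbf{x}$ of indeterminates, a matrix with entries in $\mathbb{R}[\mathbf{x}]$ is $\mathbf{x}$-TP if all its minors are polynomials with nonnegative coefficients in $\mathbf{x}$. A series $\sum_{n\ge 0}a_nt^n\in\mathbb{R}[[t]]$ is a PF function if $[a_{i-j}]_{i,j\ge 0}$ (with $a_m=0$ for $m<0$) is TP. Stieltjes moment (SM). A real sequence $(a_k)_{k\ge 0}$ is SM if $a_k=\int_0^{+\infty}x^k\,d\mu(x)$ for a nonnegative measure $\mu$ on $[0,+\infty)$; equivalently $[a_{i+j}]_{i,j\ge 0}$ is TP. A sequence $(\alpha_n)_{n\ge 0}$ in $\mathbb{R}[\mathbf{x}]$ is $\mathbf{x}$-SM if $[\alpha_{i+j}]_{i,j\ge 0}$ is $\mathbf{x}$-TP. $k$-log-convexity. Let $\mathcal{L}[\alpha_i]=\alpha_{i-1}\alpha_{i+1}-\alpha_i^2$ for $i\ge 1$ and $\mathcal{L}^m=\mathcal{L}(\mathcal{L}^{m-1})$ (so $\mathcal{L}^m[\alpha_i]$ is defined for $i\ge m$). The sequence $(\alpha_i)_{i\ge 0}$ in $\mathbb{R}[\mathbf{x}]$ is $k$-$\mathbf{x}$-log-convex if for all $1\le m\le k$ all the $\mathcal{L}^m[\alpha_i]$ are polynomials with nonnegative coefficients; for real sequences ($k$-log-convex) this means they are nonnegative. $\bar f$ is the compositional inverse of $f$ and $\bar f'$ its derivative; $(1+f)^\gamma=\sum_{j\ge 0}\binom{\gamma}{j}f^j$.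 For power series $h,u$ with $h(0)=0$, $h'(0)u(0)\ne 0$, define $S_n(h,u;q)=\sum_{k=0}^nS_{n,k}(h,u)q^k$ by $\sum_{n\ge 0}S_n(h,u;q)\frac{t^n}{n!}=u(t)\exp(qh(t))$, and $S_n^*(h,u;q)=q^nS_n(h,u;1/q)$. Matrices are indexed by $n,k\ge 0$. A convolution $z_n=\sum_{k=0}^na_{n,k}x_ky_{n-k}$ ($n\ge 0$) preserves the SM property if $(z_n)_{n\ge 0}$ is SM whenever the real sequences $(x_n)_{n\ge 0}$ and $(y_n)_{n\ge 0}$ are both SM. *)

theory Defs
  imports
    "HOL-Analysis.Set_Integral"
    "HOL-Computational_Algebra.Computational_Algebra"
    "Jordan_Normal_Form.Determinant"
begin

text \<open>
  Polynomial rings over the reals are iterated univariate ones: \<open>real poly poly\<close> stands for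
  $R[\gamma,\lambda]$ (inner variable $\gamma$, outer variable $\lambda$), \<open>real poly\<close> for
  $R[\gamma]$; the polynomials $S_n(h,u;q)$ over a ring \<open>'a\<close> of this kind live in \<open>'a poly\<close>
  with outermost variable $q$.  All of them are real algebras.
\<close>

instantiation poly :: ("{comm_ring_1, real_algebra_1}") real_algebra_1
begin

definition scaleR_poly :: "real \<Rightarrow> 'a poly \<Rightarrow> 'a poly" where
  "scaleR_poly r p = map_poly (scaleR r) p"

instance
proof
  have coeff: "coeff (r *\<^sub>R p) i = r *\<^sub>R coeff p i" for r :: real and p :: "'a poly" and i
    by (simp add: scaleR_poly_def coeff_map_poly)
  show "a *\<^sub>R (x + y) = a *\<^sub>R x + a *\<^sub>R y" for a :: real and x y :: "'a poly"
    by (rule poly_eqI) (simp add: coeff scaleR_add_right)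
  show "(a + b) *\<^sub>R x = a *\<^sub>R x + b *\<^sub>R x" for a b :: real and x :: "'a poly"
    by (rule poly_eqI) (simp add: coeff scaleR_add_left)
  show "a *\<^sub>R b *\<^sub>R x = (a * b) *\<^sub>R x" for a b :: real and x :: "'a poly"
    by (rule poly_eqI) (simp add: coeff)
  show "1 *\<^sub>R x = x" for x :: "'a poly"
    by (rule poly_eqI) (simp add: coeff)
  show "a *\<^sub>R x * y = a *\<^sub>R (x * y)" for a :: real and x y :: "'a poly"
    by (rule poly_eqI) (simp add: coeff coeff_mult scaleR_sum_right)
  show "x * a *\<^sub>R y = a *\<^sub>R (x * y)" for a :: real and x y :: "'a poly"
    by (rule poly_eqI) (simp add: coeff coeff_mult scaleR_sum_right)
qed

end

text \<open>
  Coefficientwise nonnegativity; a real number is a polynomial in no variables.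
\<close>

class nonneg_ring = comm_ring_1 +
  fixes nonneg_coeffs :: "'a \<Rightarrow> bool"

instantiation real :: nonneg_ring
begin
definition nonneg_coeffs_real :: "real \<Rightarrow> bool" where
  "nonneg_coeffs_real x \<longleftrightarrow> 0 \<le> x"
instance ..
end

instantiation poly :: (nonneg_ring) nonneg_ring
begin
definition nonneg_coeffs_poly :: "'a poly \<Rightarrow> bool" where
  "nonneg_coeffs_poly p \<longleftrightarrow> (\<forall>i. nonneg_coeffs (coeff p i))"
instance ..
end

text \<open>
  Infinite matrices are functions \<open>nat \<Rightarrow> nat \<Rightarrow> 'a\<close>.  At type \<open>real\<close> the following is ordinary
  total positivity, at a polynomial type it is total positivity in the variables of that type.
\<close>

definition totally_positive :: "(nat \<Rightarrow> nat \<Rightarrow> 'a::nonneg_ring) \<Rightarrow> bool" where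
  "totally_positive A \<longleftrightarrow>
     (\<forall>r rows cols. strict_mono_on {..<r} rows \<longrightarrow> strict_mono_on {..<r} cols \<longrightarrow>
        nonneg_coeffs (Determinant.det (Matrix.mat r r (\<lambda>(i, j). A (rows i) (cols j)))))"

definition PF_function :: "real fps \<Rightarrow> bool" where
  "PF_function a \<longleftrightarrow>
     totally_positive (\<lambda>i j. if j \<le> i then fps_nth a (i - j) else 0)"

definition Stieltjes_moment :: "(nat \<Rightarrow> real) \<Rightarrow> bool" where
  "Stieltjes_moment a \<longleftrightarrow>
     (\<exists>M :: real measure. sets M = sets (restrict_space borel {0..}) \<and>
        (\<forall>k. integrable M (\<lambda>x. x ^ k) \<and> a k = (LINT x|M. x ^ k)))"

text \<open>The coefficientwise (polynomial) version of the Stieltjes moment property.\<close>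

definition coeffwise_SM :: "(nat \<Rightarrow> 'a::nonneg_ring) \<Rightarrow> bool" where
  "coeffwise_SM \<alpha> \<longleftrightarrow> totally_positive (\<lambda>i j. \<alpha> (i + j))"

text \<open>
  \<open>(log_op ^^ m) \<alpha> i\<close> is only meaningful for \<open>i \<ge> m\<close>, because of the truncated \<open>i - 1\<close>.
\<close>

definition log_op :: "(nat \<Rightarrow> 'a::comm_ring_1) \<Rightarrow> nat \<Rightarrow> 'a" where
  "log_op \<alpha> i = \<alpha> (i - 1) * \<alpha> (i + 1) - (\<alpha> i)\<^sup>2"

definition log_convex :: "nat \<Rightarrow> (nat \<Rightarrow> 'a::nonneg_ring) \<Rightarrow> bool" where
  "log_convex k \<alpha> \<longleftrightarrow> (\<forall>m\<in>{1..k}. \<forall>i\<ge>m. nonneg_coeffs ((log_op ^^ m) \<alpha> i))"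

definition preserves_SM :: "(nat \<Rightarrow> nat \<Rightarrow> real) \<Rightarrow> bool" where
  "preserves_SM a \<longleftrightarrow>
     (\<forall>x y. Stieltjes_moment x \<longrightarrow> Stieltjes_moment y \<longrightarrow>
        Stieltjes_moment (\<lambda>n. \<Sum>k\<le>n. a n k * x k * y (n - k)))"

definition fps_map :: "('a::zero \<Rightarrow> 'b::zero) \<Rightarrow> 'a fps \<Rightarrow> 'b fps" where
  "fps_map \<phi> F = Abs_fps (\<lambda>n. \<phi> (fps_nth F n))"

text \<open>The constant \<open>fps_exp\<close> is confined to fields, so its real coefficients are embedded into \<open>'a\<close>.\<close>

definition fps_exp_of :: "'a::{comm_ring_1, real_algebra_1} fps \<Rightarrow> 'a fps" where
  "fps_exp_of F = fps_compose (fps_map of_real (fps_exp (1::real))) F"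

text \<open>
  The constant \<open>(gchoose)\<close> is confined to fields as well; for an indeterminate \<open>\<gamma>\<close> the binomial
  coefficient is a polynomial in \<open>\<gamma>\<close>.
\<close>

definition binom_of :: "'a::{comm_ring_1, real_algebra_1} \<Rightarrow> nat \<Rightarrow> 'a" where
  "binom_of \<gamma> j = (1 / fact j) *\<^sub>R (\<Prod>i<j. \<gamma> - of_nat i)"

lemma binom_of_real: "binom_of \<gamma> j = \<gamma> gchoose j" for \<gamma> :: real
  by (simp add: binom_of_def gbinomial_prod_rev atLeast0LessThan)

definition one_plus_power ::
    "'a::{comm_ring_1, real_algebra_1} fps \<Rightarrow> 'a \<Rightarrow> 'a fps" where
  "one_plus_power F \<gamma> = fps_compose (Abs_fps (\<lambda>j. binom_of \<gamma> j)) F"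

definition g_series ::
    "'a::{comm_ring_1, real_algebra_1} fps \<Rightarrow> 'a \<Rightarrow> 'a \<Rightarrow> 'a fps" where
  "g_series F \<gamma> lam = one_plus_power F \<gamma> * fps_exp_of (fps_const lam * F)"

text \<open>
  \<open>S_poly h u n\<close> is $S_n(h,u;q)$, defined by
  $\sum_n S_n(h,u;q)\, t^n/n! = u(t) \exp(q\,h(t))$ in $A[q][[t]]$ with $q$ the polynomial \<open>[:0, 1:]\<close>.
\<close>

definition S_poly ::
    "'a::{comm_ring_1, real_algebra_1} fps \<Rightarrow> 'a fps \<Rightarrow> nat \<Rightarrow> 'a poly" where
  "S_poly h u n =
     fact n * fps_nth (fps_map (\<lambda>c. [:c:]) u *
                       fps_exp_of (fps_const [:0, 1:] * fps_map (\<lambda>c. [:c:]) h)) n"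

definition S_coeff ::
    "'a::{comm_ring_1, real_algebra_1} fps \<Rightarrow> 'a fps \<Rightarrow> nat \<Rightarrow> nat \<Rightarrow> 'a" where
  "S_coeff h u n k = coeff (S_poly h u n) k"

text \<open>$S_n^*(h,u;q) = q^n S_n(h,u;1/q)$.\<close>

definition S_star ::
    "'a::{comm_ring_1, real_algebra_1} fps \<Rightarrow> 'a fps \<Rightarrow> nat \<Rightarrow> 'a poly" where
  "S_star h u n = (\<Sum>k\<le>n. monom (S_coeff h u n k) (n - k))"

end

theory Submission
  imports
    Defs
    "HOL-Probability.Helly_Selection"
    "HOL-Probability.Probability_Mass_Function"
    "HOL-Real_Asymp.Real_Asymp"
begin

text \<open>
  Write \<open>P\<close> for the Polya frequency series \<open>1 / ((1 + t) \<phi>'(t))\<close>, where \<open>\<phi>\<close> is the compositional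
  inverse of \<open>f\<close>.  Differentiating \<open>\<phi>(f(t)) = t\<close> turns its definition into the differential equation
  \<open>f' = (1 + f) P(f)\<close>, and then \<open>g = (1 + f)\<^sup>\<gamma> exp (\<lambda> f)\<close> satisfies
  \<open>g' = (\<gamma> + \<lambda> (1 + f)) P(f) g\<close>.  The array \<open>S\<^sub>n\<^sub>,\<^sub>k = n!/k! [t\<^sup>n] g f\<^sup>k\<close> therefore obeys
  \<open>S\<^sub>n\<^sub>+\<^sub>1\<^sub>,\<^sub>k = \<Sum>\<^sub>j S\<^sub>n\<^sub>,\<^sub>j \<Pi>\<^sub>j\<^sub>,\<^sub>k\<close> with a production matrix \<open>\<Pi>\<close> that belongs to the differential operator
  \<open>(\<gamma> + (\<lambda> + x)(1 + D)) P(D)\<close> on polynomials in \<open>x\<close>, \<open>D = d/dx\<close>.  This factorization of the operator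
  is the heart of the matter: \<open>\<Pi> = T B\<close>, where \<open>T\<close> is the matrix of \<open>P(D)\<close>, a Toeplitz matrix with
  entries weighted by factorials and hence totally positive by hypothesis, and \<open>B\<close> is the tridiagonal
  matrix of \<open>\<gamma> + (\<lambda> + x)(1 + D)\<close>, which is coefficientwise totally positive.

  Total positivity passes from \<open>T\<close> and \<open>B\<close> to \<open>\<Pi>\<close> by the Cauchy-Binet formula (theorem
  \<open>Cauchy_Binet\<close>), from \<open>\<Pi>\<close> to the whole array \<open>S\<close>, and to the Hankel matrix of the zeroth column of
  \<open>S\<close>, because that Hankel matrix is the product of the array generated by \<open>\<Pi>\<close> and the transpose of the
  array generated by the transpose of \<open>\<Pi>\<close> (lemma \<open>production_factorization_TP\<close>).  This gives (iv).

  For (i) and (ii) one needs the row polynomials instead of the zeroth column.  Their homogenized form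
  \<open>W\<^sub>n(x, y) = \<Sum>\<^sub>k S\<^sub>n\<^sub>,\<^sub>k x\<^sup>k y\<^sup>n\<^sup>-\<^sup>k\<close> has the exponential generating function \<open>g(y t) exp (x f(y t) / y)\<close>,
  and \<open>W\<^sub>n\<close> is the zeroth column of the array attached to the pair \<open>g(y t) exp (x f(y t) / y)\<close>,
  \<open>f(y t) / y\<close>.  That pair satisfies the same differential equations with \<open>\<gamma>\<close>, \<open>\<lambda>\<close>, \<open>D\<close> replaced by
  \<open>y \<gamma>\<close>, \<open>y \<lambda> + x\<close>, \<open>y D\<close>, so the argument above shows that \<open>(W\<^sub>n)\<close> has a totally positive Hankel matrix as soon as
  \<open>\<gamma>\<close>, \<open>\<lambda>\<close>, \<open>x\<close>, \<open>y\<close> have nonnegative coefficients (theorem \<open>homogenized_coeffwise_SM\<close>).  The values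
  \<open>(x, y) = (q, 1)\<close> and \<open>(1, q)\<close> are \<open>S\<^sub>n\<close> and \<open>S\<^sub>n\<^sup>*\<close>; the values \<open>\<gamma> = 1\<close>, \<open>\<lambda> = x = 0\<close>, \<open>y = 1\<close> give the
  sequence \<open>1, f\<^sub>1, f\<^sub>2, \<dots>\<close>, whose shift occurs in (iii).  The claims on 3-log-convexity follow from Dodgson condensation,
  which writes the iterates of the log-convexity operator as products of Hankel minors
  (theorem \<open>coeffwise_SM_imp_log_convex_3\<close>).

  The array in (v) without signs is the inverse of \<open>S\<close>, and Jacobi's identity expresses the minors of
  an inverse through complementary minors of the matrix; the signs cancel exactly
  (theorem \<open>totally_positive_signed_inverse\<close>).

  Statement (iii) and statement (vi) ask for a measure.  A totally positive Hankel matrix and its shift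
  are positive semidefinite, and the Stieltjes moment theorem (\<open>Stieltjes_moment_of_psd\<close>) produces the
  measure: Gauss quadrature gives finitely supported measures whose initial moments are correct up to a small error, and
  Helly's selection theorem a limit of them.  In (vi) the quadratic forms of the convolution are
  integrals over \<open>x, y \<ge> 0\<close> of those of \<open>W\<^sub>n(x, y)\<close>, hence nonnegative
  (theorem \<open>preserves_SM_exp_riordan\<close>).
\<close>

section \<open>Elements with nonnegative coefficients\<close>

text \<open>
  What the total positivity arguments need of a polynomial ring over the reals: the elements with
  nonnegative coefficients are closed under sums, products and nonnegative real multiples.  The
  class covers the reals and all iterated polynomial rings, so that each argument is carried out once
  for the real, the \<open>\<gamma>\<close>-, the \<open>(\<gamma>, \<lambda>)\<close>- and the \<open>(\<gamma>, \<lambda>, q)\<close>-version of a statement.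
\<close>

class nonneg_algebra = nonneg_ring + idom + real_algebra_1 +
  assumes nonneg_zero: "nonneg_coeffs 0"
    and nonneg_one: "nonneg_coeffs 1"
    and nonneg_add: "nonneg_coeffs x \<Longrightarrow> nonneg_coeffs y \<Longrightarrow> nonneg_coeffs (x + y)"
    and nonneg_mult: "nonneg_coeffs x \<Longrightarrow> nonneg_coeffs y \<Longrightarrow> nonneg_coeffs (x * y)"
    and nonneg_scaleR: "0 \<le> r \<Longrightarrow> nonneg_coeffs x \<Longrightarrow> nonneg_coeffs (r *\<^sub>R x)"
begin

lemma nonneg_sum: "(\<And>i. i \<in> I \<Longrightarrow> nonneg_coeffs (f i)) \<Longrightarrow> nonneg_coeffs (sum f I)"
  by (induction I rule: infinite_finite_induct) (auto simp: nonneg_zero nonneg_add)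

lemma nonneg_power: "nonneg_coeffs x \<Longrightarrow> nonneg_coeffs (x ^ n)"
  by (induction n) (auto simp: nonneg_one nonneg_mult)

lemma nonneg_of_nat: "nonneg_coeffs (of_nat n)"
  by (induction n) (auto simp: nonneg_zero nonneg_one nonneg_add)

end

lemma nonneg_of_real: "0 \<le> r \<Longrightarrow> nonneg_coeffs (of_real r :: 'a::nonneg_algebra)"
  by (simp add: of_real_def nonneg_scaleR nonneg_one)

instance real :: nonneg_algebra
  by standard (auto simp: nonneg_coeffs_real_def)

instance poly :: (nonneg_algebra) nonneg_algebra
proof
  fix x y :: "'a poly" and r :: real
  show "nonneg_coeffs (0 :: 'a poly)"
    by (simp add: nonneg_coeffs_poly_def nonneg_zero)
  show "nonneg_coeffs (1 :: 'a poly)"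
    by (simp add: nonneg_coeffs_poly_def coeff_1 nonneg_zero nonneg_one)
  show "nonneg_coeffs (x + y)" if "nonneg_coeffs x" "nonneg_coeffs y"
    using that by (simp add: nonneg_coeffs_poly_def nonneg_add)
  show "nonneg_coeffs (x * y)" if "nonneg_coeffs x" "nonneg_coeffs y"
    using that by (auto simp: nonneg_coeffs_poly_def coeff_mult intro!: nonneg_sum nonneg_mult)
  show "nonneg_coeffs (r *\<^sub>R x)" if "0 \<le> r" "nonneg_coeffs x"
    using that by (simp add: nonneg_coeffs_poly_def scaleR_poly_def coeff_map_poly nonneg_scaleR)
qed

lemma nonneg_const_poly: "nonneg_coeffs c \<Longrightarrow> nonneg_coeffs [:c:]" for c :: "'a::nonneg_algebra"
  by (auto simp: nonneg_coeffs_poly_def coeff_pCons nonneg_zero split: nat.splits)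

lemma nonneg_indeterminate: "nonneg_coeffs [:0, 1 :: 'a::nonneg_algebra:]"
  by (auto simp: nonneg_coeffs_poly_def coeff_pCons nonneg_zero nonneg_one split: nat.splits)

section \<open>Minors of infinite matrices\<close>

definition minor :: "nat \<Rightarrow> (nat \<Rightarrow> nat \<Rightarrow> 'a::comm_ring_1) \<Rightarrow> (nat \<Rightarrow> nat) \<Rightarrow> (nat \<Rightarrow> nat) \<Rightarrow> 'a" where
  "minor r A rs cs = Determinant.det (Matrix.mat r r (\<lambda>(i, j). A (rs i) (cs j)))"

lemma totally_positive_iff_minor:
  "totally_positive A \<longleftrightarrow>
     (\<forall>r rs cs. strict_mono_on {..<r} rs \<longrightarrow> strict_mono_on {..<r} cs \<longrightarrow>
        nonneg_coeffs (minor r A rs cs))"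
  by (simp add: totally_positive_def minor_def)

lemma totally_positiveI:
  assumes "\<And>r rs cs. strict_mono_on {..<r} rs \<Longrightarrow> strict_mono_on {..<r} cs \<Longrightarrow>
     nonneg_coeffs (minor r A rs cs)"
  shows "totally_positive A"
  using assms by (simp add: totally_positive_iff_minor)

lemma totally_positiveD:
  assumes "totally_positive A" "strict_mono_on {..<r} rs" "strict_mono_on {..<r} cs"
  shows "nonneg_coeffs (minor r A rs cs)"
  using assms by (simp add: totally_positive_iff_minor)

lemma minor_cong:
  assumes "\<And>i j. i < r \<Longrightarrow> j < r \<Longrightarrow> A (rs i) (cs j) = B (rs' i) (cs' j)"
  shows "minor r A rs cs = minor r B rs' cs'"
  unfolding minor_def by (rule arg_cong[where f = Determinant.det]) (auto simp: assms)

lemma minor_leibniz: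
  "minor r A rs cs =
     (\<Sum>p | p permutes {0..<r}. signof p * (\<Prod>i = 0..<r. A (rs i) (cs (p i))))"
proof -
  have "Matrix.mat r r (\<lambda>(i, j). A (rs i) (cs j)) $$ (i, p i) = A (rs i) (cs (p i))"
    if "p permutes {0..<r}" "i \<in> {0..<r}" for p i
    using that permutes_in_image[OF that(1), of i] by simp
  then show ?thesis
    unfolding minor_def by (subst det_def'[where n = r]) (auto intro!: sum.cong)
qed

lemma minor_0 [simp]: "minor 0 A rs cs = 1"
  by (simp add: minor_def)

lemma minor_1: "minor (Suc 0) A rs cs = A (rs 0) (cs 0)"
  unfolding minor_def by (subst det_single) auto

lemma minor_transpose: "minor r (\<lambda>i j. A j i) rs cs = minor r A cs rs"
proof -
  have "minor r (\<lambda>i j. A j i) rs cs =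
      Determinant.det (transpose_mat (Matrix.mat r r (\<lambda>(i, j). A (cs i) (rs j))))"
    unfolding minor_def by (rule arg_cong[where f = Determinant.det]) auto
  also have "\<dots> = minor r A cs rs"
    unfolding minor_def by (subst Determinant.det_transpose[where n = r]) auto
  finally show ?thesis .
qed

lemma minor_zero_row:
  assumes "m < r" "\<And>j. j < r \<Longrightarrow> A (rs m) (cs j) = 0"
  shows "minor r A rs cs = 0"
  unfolding minor_leibniz
proof (intro sum.neutral ballI)
  fix p assume "p \<in> {p. p permutes {0..<r}}"
  then have "p m < r" using assms(1) by (auto simp: permutes_in_image)
  then have "A (rs m) (cs (p m)) = 0" by (rule assms(2))
  with assms(1) have "(\<Prod>i = 0..<r. A (rs i) (cs (p i))) = 0"
    by (intro prod_zero) auto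
  then show "signof p * (\<Prod>i = 0..<r. A (rs i) (cs (p i))) = 0" by simp
qed

lemma minor_zero_col:
  assumes "m < r" "\<And>i. i < r \<Longrightarrow> A (rs i) (cs m) = 0"
  shows "minor r A rs cs = 0"
  using minor_zero_row[of m r "\<lambda>i j. A j i" cs rs] assms by (simp add: minor_transpose[of r A])

lemma minor_block_lower:
  fixes A :: "nat \<Rightarrow> nat \<Rightarrow> 'a::idom"
  assumes "m \<le> r" "\<And>i j. i < m \<Longrightarrow> m \<le> j \<Longrightarrow> j < r \<Longrightarrow> A (rs i) (cs j) = 0"
  shows "minor r A rs cs =
    minor m A rs cs * minor (r - m) A (\<lambda>i. rs (m + i)) (\<lambda>j. cs (m + j))"
proof -
  have "Matrix.mat r r (\<lambda>(i, j). A (rs i) (cs j)) =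
     four_block_mat (Matrix.mat m m (\<lambda>(i, j). A (rs i) (cs j))) (0\<^sub>m m (r - m))
       (Matrix.mat (r - m) m (\<lambda>(i, j). A (rs (m + i)) (cs j)))
       (Matrix.mat (r - m) (r - m) (\<lambda>(i, j). A (rs (m + i)) (cs (m + j))))"
    by (rule eq_matI) (use assms in \<open>auto simp: four_block_mat_def Let_def\<close>)
  then show ?thesis
    unfolding minor_def by (simp add: det_four_block_mat_upper_right_zero[where n = m and m = "r - m"])
qed

lemma minor_block_upper:
  fixes A :: "nat \<Rightarrow> nat \<Rightarrow> 'a::idom"
  assumes "m \<le> r" "\<And>i j. m \<le> i \<Longrightarrow> i < r \<Longrightarrow> j < m \<Longrightarrow> A (rs i) (cs j) = 0"
  shows "minor r A rs cs =
    minor m A rs cs * minor (r - m) A (\<lambda>i. rs (m + i)) (\<lambda>j. cs (m + j))"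
  using minor_block_lower[of m r "\<lambda>i j. A j i" cs rs] assms
  by (simp add: minor_transpose[of r A] minor_transpose[of m A]
      minor_transpose[of "r - m" A])

text \<open>
  Row factors and column factors leave a determinant; the weights \<open>n!\<close> and \<open>1/k!\<close> of exponential
  generating functions and the signs of a checkerboard pattern are handled by this.
\<close>

lemma minor_scale:
  "minor r (\<lambda>i j. u i * A i j * v j) rs cs =
     (\<Prod>i<r. u (rs i)) * (\<Prod>j<r. v (cs j)) * minor r A rs cs"
proof -
  have "(\<Prod>i = 0..<r. u (rs i) * A (rs i) (cs (p i)) * v (cs (p i))) =
      (\<Prod>i<r. u (rs i)) * (\<Prod>j<r. v (cs j)) * (\<Prod>i = 0..<r. A (rs i) (cs (p i)))"
    if "p permutes {0..<r}" for p
  proof -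
    have "(\<Prod>i = 0..<r. v (cs (p i))) = (\<Prod>j<r. v (cs j))"
      using prod.permute[OF that, of "\<lambda>j. v (cs j)"] by (simp add: atLeast0LessThan o_def)
    then show ?thesis by (simp add: prod.distrib atLeast0LessThan mult_ac)
  qed
  then show ?thesis
    by (auto simp: minor_leibniz sum_distrib_left mult_ac intro!: sum.cong)
qed

lemma minor_of_real:
  "minor r (\<lambda>i j. of_real (A i j)) rs cs = (of_real (minor r A rs cs) :: 'a::{comm_ring_1, real_algebra_1})"
proof -
  have "of_real (signof p) = (signof p :: 'a)" for p by (simp add: sign_def)
  then show ?thesis by (simp add: minor_leibniz)
qed

lemma strict_mono_on_lessThan_iff:
  "strict_mono_on {..<r::nat} f \<longleftrightarrow> (\<forall>i j. i < j \<longrightarrow> j < r \<longrightarrow> f i < (f j :: nat))"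
  by (auto simp: strict_mono_on_def)

lemma strict_mono_on_shift:
  assumes "strict_mono_on {..<r::nat} f" 
  shows "strict_mono_on {..<r - m} (\<lambda>i. f (m + i) :: nat)"
  using assms by (auto simp: strict_mono_on_lessThan_iff)

lemma strict_mono_on_initial:
  assumes "strict_mono_on {..<r::nat} f" "m \<le> r"
  shows "strict_mono_on {..<m} (f :: nat \<Rightarrow> nat)"
  using assms by (auto simp: strict_mono_on_lessThan_iff)

lemma totally_positive_transpose:
  assumes "totally_positive A"
  shows "totally_positive (\<lambda>i j. A j i)"
proof (rule totally_positiveI)
  fix r and rs cs :: "nat \<Rightarrow> nat"
  assume "strict_mono_on {..<r} rs" "strict_mono_on {..<r} cs"
  then show "nonneg_coeffs (minor r (\<lambda>i j. A j i) rs cs)"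
    unfolding minor_transpose[of r A rs cs] using assms by (intro totally_positiveD)
qed

lemma totally_positive_zero: "totally_positive (\<lambda>i j. 0 :: 'a::nonneg_algebra)"
proof (rule totally_positiveI)
  fix r and rs cs :: "nat \<Rightarrow> nat"
  show "nonneg_coeffs (minor r (\<lambda>i j. 0 :: 'a) rs cs)"
  proof (cases "r = 0")
    case False
    then have "minor r (\<lambda>i j. 0 :: 'a) rs cs = 0" by (intro minor_zero_row[of 0]) auto
    then show ?thesis by (simp add: nonneg_zero)
  qed (simp add: nonneg_one)
qed

lemma totally_positive_entry: "totally_positive A \<Longrightarrow> nonneg_coeffs (A i j)"
  using totally_positiveD[of A "Suc 0" "\<lambda>_. i" "\<lambda>_. j"]
  by (simp add: minor_1 strict_mono_on_lessThan_iff)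

lemma totally_positive_submatrix:
  assumes "totally_positive A" "strict_mono \<rho>" "strict_mono \<sigma>"
  shows "totally_positive (\<lambda>i j. A (\<rho> i) (\<sigma> j))"
proof (rule totally_positiveI)
  fix r and rs cs :: "nat \<Rightarrow> nat"
  assume "strict_mono_on {..<r} rs" "strict_mono_on {..<r} cs"
  then have "nonneg_coeffs (minor r A (\<lambda>i. \<rho> (rs i)) (\<lambda>j. \<sigma> (cs j)))"
    using assms by (intro totally_positiveD) (auto simp: strict_mono_on_lessThan_iff strict_mono_def)
  then show "nonneg_coeffs (minor r (\<lambda>i j. A (\<rho> i) (\<sigma> j)) rs cs)"
    by (simp add: minor_def)
qed

section \<open>The Cauchy-Binet formula\<close>

lemma minor_permute_rows:
  assumes "p permutes {0..<r}"
  shows "minor r A (\<lambda>i. rs (p i)) cs = signof p * minor r A rs cs"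
proof -
  have "minor r A (\<lambda>i. rs (p i)) cs = Determinant.det (Matrix.mat r r
          (\<lambda>(i, j). Matrix.mat r r (\<lambda>(i, j). A (rs i) (cs j)) $$ (p i, j)))"
    unfolding minor_def
    by (rule arg_cong[where f = Determinant.det], rule eq_matI)
       (use assms permutes_in_image[OF assms] in auto)
  also have "\<dots> = signof p * minor r A rs cs"
    unfolding minor_def by (rule Determinant.det_permute_rows[OF _ assms]) auto
  finally show ?thesis .
qed

lemma minor_not_inj_rows:
  assumes "\<not> inj_on rs {0..<r}"
  shows "minor r A rs cs = 0"
proof -
  obtain i j where ij: "i < r" "j < r" "i \<noteq> j" "rs i = rs j"
    using assms by (auto simp: inj_on_def)
  then show ?thesis
    unfolding minor_def by (intro Determinant.det_identical_rows[of _ r i j]) (auto intro!: eq_vecI)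
qed

text \<open>
  One fibre of the Cauchy-Binet sum.  The injective maps with image \<open>S\<close> are the enumeration \<open>e\<close> of
  \<open>S\<close> composed with the permutations, and the sum over the permutations is the Leibniz formula for the
  first factor.
\<close>

lemma sum_bijections_onto:
  assumes e: "bij_betw e {0..<r} S" and SN: "S \<subseteq> {..<N}"
  shows "(\<Sum>f | f \<in> PiE {0..<r} (\<lambda>_. {..<N}) \<and> f ` {0..<r} = S \<and> inj_on f {0..<r}.
            (\<Prod>i = 0..<r. A (rs i) (f i)) * minor r B f cs)
         = minor r A rs e * minor r B e (cs :: nat \<Rightarrow> nat)"
proof -
  let ?R = "{0..<r}"
  let ?Fs = "{f. f \<in> PiE ?R (\<lambda>_. {..<N}) \<and> f ` ?R = S \<and> inj_on f ?R}"
  let ?g = "\<lambda>f. (\<Prod>i = 0..<r. A (rs i) (f i)) * minor r B f cs"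
  have "(\<Sum>f\<in>?Fs. ?g f) = (\<Sum>p | p permutes ?R. ?g (\<lambda>i. e (p i)))"
  proof (rule sum.reindex_bij_witness[where
        i = "\<lambda>p. restrict (\<lambda>i. e (p i)) ?R" and
        j = "\<lambda>f i. if i < r then inv_into ?R e (f i) else i"])
    fix f assume f: "f \<in> ?Fs"
    then have fb: "bij_betw f ?R S" by (auto simp: bij_betw_def)
    have fS: "f i \<in> S" if "i < r" for i using f that by auto
    show "restrict (\<lambda>i. e (if i < r then inv_into ?R e (f i) else i)) ?R = f"
      using f fS by (auto simp: restrict_def fun_eq_iff PiE_iff extensional_def
          bij_betw_inv_into_right[OF e])
    have "bij_betw (inv_into ?R e \<circ> f) ?R ?R"
      by (rule bij_betw_trans[OF fb bij_betw_inv_into[OF e]])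
    then have "bij_betw (\<lambda>i. if i < r then inv_into ?R e (f i) else i) ?R ?R"
      by (rule bij_betw_cong[THEN iffD1, rotated]) auto
    then show "(\<lambda>i. if i < r then inv_into ?R e (f i) else i) \<in> {p. p permutes ?R}"
      by (auto intro!: bij_imp_permutes)
    show "?g (\<lambda>i. e (if i < r then inv_into ?R e (f i) else i)) = ?g f"
      using fS by (auto intro!: arg_cong2[where f = "(*)"] prod.cong minor_cong
          simp: bij_betw_inv_into_right[OF e])
  next
    fix p assume "p \<in> {p. p permutes ?R}"
    then have p: "p permutes ?R" by simp
    then have pr: "p i < r \<longleftrightarrow> i < r" for i using permutes_in_image[OF p, of i] by auto
    have pb: "bij_betw p ?R ?R" using p by (rule permutes_imp_bij)
    have "bij_betw (e \<circ> p) ?R S" by (rule bij_betw_trans[OF pb e])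
    then have "bij_betw (restrict (\<lambda>i. e (p i)) ?R) ?R S"
      by (rule bij_betw_cong[THEN iffD1, rotated]) auto
    then show "restrict (\<lambda>i. e (p i)) ?R \<in> ?Fs"
      using SN by (auto simp: bij_betw_def)
    show "(\<lambda>i. if i < r then inv_into ?R e (restrict (\<lambda>i. e (p i)) ?R i) else i) = p"
    proof
      fix i show "(if i < r then inv_into ?R e (restrict (\<lambda>i. e (p i)) ?R i) else i) = p i"
        using pr[of i] permutes_not_in[OF p, of i] by (auto simp: bij_betw_inv_into_left[OF e])
    qed
  qed
  also have "\<dots> = (\<Sum>p | p permutes ?R. signof p * (\<Prod>i = 0..<r. A (rs i) (e (p i)))) * minor r B e cs"
    unfolding sum_distrib_right by (rule sum.cong) (auto simp: minor_permute_rows)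
  finally show ?thesis by (simp add: minor_leibniz[of r A])
qed

text \<open>
  Expanding the entries of the product by multilinearity gives a sum over all maps \<open>f\<close> from row
  positions to summation indices.  A map that is not injective contributes a minor of \<open>B\<close> with two
  equal rows; the others are grouped by their image.
\<close>

theorem Cauchy_Binet:
  fixes A B :: "nat \<Rightarrow> nat \<Rightarrow> 'a::comm_ring_1"
  shows "minor r (\<lambda>i j. \<Sum>k<N. A i k * B k j) rs cs =
    (\<Sum>S | S \<subseteq> {..<N} \<and> card S = r. minor r A rs (enumerate S) * minor r B (enumerate S) cs)"
proof -
  let ?R = "{0..<r}"
  let ?F = "PiE ?R (\<lambda>_. {..<N})"
  let ?T = "{S. S \<subseteq> {..<N} \<and> card S = r}"
  let ?g = "\<lambda>f. (\<Prod>i = 0..<r. A (rs i) (f i)) * minor r B f cs"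
  have fin: "finite ?F" by (intro finite_PiE) auto
  have "minor r (\<lambda>i j. \<Sum>k<N. A i k * B k j) rs cs =
     (\<Sum>p | p permutes ?R. signof p * (\<Prod>i = 0..<r. \<Sum>k<N. A (rs i) k * B k (cs (p i))))"
    by (rule minor_leibniz)
  also have "\<dots> = (\<Sum>p | p permutes ?R. \<Sum>f\<in>?F. signof p *
      (\<Prod>i = 0..<r. A (rs i) (f i) * B (f i) (cs (p i))))"
    by (subst prod_sum_PiE) (auto simp: sum_distrib_left)
  also have "\<dots> = (\<Sum>f\<in>?F. ?g f)"
    by (subst sum.swap) (simp add: minor_leibniz[of r B] prod.distrib sum_distrib_left mult_ac)
  also have "\<dots> = (\<Sum>f | f \<in> ?F \<and> inj_on f ?R. ?g f)"
    using fin by (intro sum.mono_neutral_right) (auto simp: minor_not_inj_rows)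
  also have "\<dots> = (\<Sum>S\<in>?T. \<Sum>f | f \<in> {f. f \<in> ?F \<and> inj_on f ?R} \<and> f ` ?R = S. ?g f)"
  proof (rule sum.group[symmetric])
    show "finite {f. f \<in> ?F \<and> inj_on f ?R}" using fin by (rule finite_subset[rotated]) auto
    show "finite ?T" by (rule finite_subset[of _ "Pow {..<N}"]) auto
    show "(\<lambda>f. f ` ?R) ` {f. f \<in> ?F \<and> inj_on f ?R} \<subseteq> ?T"
      by (auto simp: card_image)
  qed
  also have "\<dots> = (\<Sum>S\<in>?T. minor r A rs (enumerate S) * minor r B (enumerate S) cs)"
  proof (rule sum.cong[OF refl])
    fix S assume S: "S \<in> ?T"
    then have "finite S" using finite_subset by auto
    then have "bij_betw (enumerate S) ?R S"
      using finite_bij_enumerate[of S] S by (simp add: atLeast0LessThan)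
    with S show "(\<Sum>f | f \<in> {f. f \<in> ?F \<and> inj_on f ?R} \<and> f ` ?R = S. ?g f) =
        minor r A rs (enumerate S) * minor r B (enumerate S) cs"
      using sum_bijections_onto[of "enumerate S" r S N A rs B cs] by (simp add: conj_ac)
  qed
  finally show ?thesis .
qed

lemma totally_positive_mult:
  fixes A B :: "nat \<Rightarrow> nat \<Rightarrow> 'a::nonneg_algebra"
  assumes "totally_positive A" "totally_positive B"
  shows "totally_positive (\<lambda>i j. \<Sum>k<N. A i k * B k j)"
proof (rule totally_positiveI)
  fix r and rs cs :: "nat \<Rightarrow> nat"
  assume mono: "strict_mono_on {..<r} rs" "strict_mono_on {..<r} cs"
  have "strict_mono_on {..<r} (enumerate S)" if "S \<subseteq> {..<N}" "card S = r" for S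
    using that finite_subset[of S "{..<N}"]
    by (auto simp: strict_mono_on_lessThan_iff intro!: finite_enumerate_mono)
  with mono assms show "nonneg_coeffs (minor r (\<lambda>i j. \<Sum>k<N. A i k * B k j) rs cs)"
    unfolding Cauchy_Binet by (intro nonneg_sum nonneg_mult totally_positiveD) auto
qed

section \<open>Tridiagonal matrices\<close>

text \<open>
  For a tridiagonal matrix the principal minors decide: at the first position \<open>m\<close> where the chosen
  row and column indices differ, the band forces a zero block, and the minor is a product of two
  smaller ones.
\<close>

lemma minor_nonneg_tridiagonal:
  fixes A :: "nat \<Rightarrow> nat \<Rightarrow> 'a::nonneg_algebra"
  assumes band: "\<And>i j. i + 1 < j \<or> j + 1 < i \<Longrightarrow> A i j = 0"
    and entry: "\<And>i j. nonneg_coeffs (A i j)"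
    and princ: "\<And>r ss. strict_mono_on {..<r} ss \<Longrightarrow> nonneg_coeffs (minor r A ss ss)"
  shows "strict_mono_on {..<r} rs \<Longrightarrow> strict_mono_on {..<r} cs \<Longrightarrow> nonneg_coeffs (minor r A rs cs)"
proof (induction r arbitrary: rs cs rule: less_induct)
  case (less r)
  show ?case
  proof (cases "\<exists>m<r. rs m \<noteq> cs m")
    case False
    then have "minor r A rs cs = minor r A rs rs" by (intro minor_cong) auto
    then show ?thesis using princ less.prems by simp
  next
    case True
    define m where "m = (LEAST m. m < r \<and> rs m \<noteq> cs m)"
    \<comment> \<open>For \<open>m = 0\<close> the zero block starts after the first entry, hence the maximum.\<close>
    define s where "s = max m 1"
    have m: "m < r" "rs m \<noteq> cs m" using LeastI_ex[OF True] by (auto simp: m_def)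
    have s: "0 < s" "s \<le> r" "m \<le> s" using m by (auto simp: s_def)
    have rsD: "rs i < rs j" and csD: "cs i < cs j" if "i < j" "j < r" for i j
      using less.prems that by (auto simp: strict_mono_on_lessThan_iff)
    have block: "minor r A rs cs = minor s A rs cs * minor (r - s) A (\<lambda>i. rs (s + i)) (\<lambda>j. cs (s + j))"
    proof (cases "rs m < cs m")
      case True
      show ?thesis
      proof (rule minor_block_lower[OF s(2)])
        fix i j assume ij: "i < s" "s \<le> j" "j < r"
        show "A (rs i) (cs j) = 0"
        proof (cases "m = 0")
          case m0: True
          then have "i = 0" "0 < j" using ij by (auto simp: s_def)
          then show ?thesis using csD[of 0 j] ij True m0 by (intro band) auto
        next
          case False
          then have "i < m" "m \<le> j" using ij by (auto simp: s_def)
          then have "rs i < rs m" "cs m \<le> cs j"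
            using rsD[of i m] csD[of m j] ij m by (auto simp: le_less)
          then show ?thesis using True by (intro band) auto
        qed
      qed
    next
      case False
      then have lt: "cs m < rs m" using m by simp
      show ?thesis
      proof (rule minor_block_upper[OF s(2)])
        fix i j assume ij: "s \<le> i" "i < r" "j < s"
        show "A (rs i) (cs j) = 0"
        proof (cases "m = 0")
          case m0: True
          then have "j = 0" "0 < i" using ij by (auto simp: s_def)
          then show ?thesis using rsD[of 0 i] ij lt m0 by (intro band) auto
        next
          case False
          then have "j < m" "m \<le> i" using ij by (auto simp: s_def)
          then have "cs j < cs m" "rs m \<le> rs i"
            using csD[of j m] rsD[of m i] ij m by (auto simp: le_less)
          then show ?thesis using lt by (intro band) auto
        qed
      qed
    qed
    have "nonneg_coeffs (minor s A rs cs)"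
    proof (cases "s < r")
      case True
      then show ?thesis using less.prems s by (intro less.IH) (auto intro: strict_mono_on_initial)
    next
      case False
      then have "s = Suc 0" using m s by (auto simp: s_def)
      then show ?thesis using entry by (simp add: minor_1)
    qed
    moreover have "nonneg_coeffs (minor (r - s) A (\<lambda>i. rs (s + i)) (\<lambda>j. cs (s + j)))"
      using s less.prems by (intro less.IH strict_mono_on_shift) auto
    ultimately show ?thesis unfolding block by (rule nonneg_mult)
  qed
qed

text \<open>
  The three-term recurrence of continuants, by expansion along the last row.  The last chosen index
  interacts with its predecessor only.
\<close>

lemma minor_continuant:
  fixes A :: "nat \<Rightarrow> nat \<Rightarrow> 'a::idom"
  assumes "\<And>i. i < r \<Longrightarrow> A (ss i) (ss (Suc r)) = 0 \<and> A (ss (Suc r)) (ss i) = 0"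
  shows "minor (Suc (Suc r)) A ss ss = A (ss (Suc r)) (ss (Suc r)) * minor (Suc r) A ss ss
    - A (ss (Suc r)) (ss r) * A (ss r) (ss (Suc r)) * minor r A ss ss"
proof -
  let ?n = "Suc (Suc r)"
  let ?M = "Matrix.mat ?n ?n (\<lambda>(i, j). A (ss i) (ss j))"
  have del: "Determinant.det (mat_delete ?M (Suc r) j) =
     minor (Suc r) A ss (\<lambda>k. ss (if k < j then k else Suc k))" if "j < ?n" for j
    unfolding minor_def mat_delete_def
    by (rule arg_cong[where f = Determinant.det], rule eq_matI) auto
  have "minor ?n A ss ss = (\<Sum>j<?n. ?M $$ (Suc r, j) * cofactor ?M (Suc r) j)"
    unfolding minor_def by (rule laplace_expansion_row) auto
  also have "\<dots> = (\<Sum>j\<in>{r, Suc r}. ?M $$ (Suc r, j) * cofactor ?M (Suc r) j)"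
    by (rule sum.mono_neutral_right) (use assms in \<open>auto simp: less_Suc_eq\<close>)
  also have "\<dots> = A (ss (Suc r)) (ss (Suc r)) * minor (Suc r) A ss (\<lambda>k. ss (if k < Suc r then k else Suc k))
    - A (ss (Suc r)) (ss r) * minor (Suc r) A ss (\<lambda>k. ss (if k < r then k else Suc k))"
    by (simp add: cofactor_def del flip: power_add)
  also have "minor (Suc r) A ss (\<lambda>k. ss (if k < Suc r then k else Suc k)) = minor (Suc r) A ss ss"
    by (rule minor_cong) auto
  also have "minor (Suc r) A ss (\<lambda>k. ss (if k < r then k else Suc k)) =
      minor r A ss (\<lambda>k. ss (if k < r then k else Suc k)) * A (ss r) (ss (Suc r))"
    by (subst minor_block_lower[of r]) (use assms in \<open>auto simp: minor_1 le_less_Suc_eq\<close>)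
  also have "minor r A ss (\<lambda>k. ss (if k < r then k else Suc k)) = minor r A ss ss"
    by (rule minor_cong) auto
  finally show ?thesis by (simp add: mult_ac)
qed

text \<open>
  The matrix of \<open>\<Gamma> + (\<Lambda> + x)(1 + c D)\<close>, \<open>D = d/dx\<close>: row \<open>i\<close> lists the coefficients of the image of
  \<open>x\<^sup>i\<close>, namely \<open>x\<^sup>i\<^sup>+\<^sup>1 + (\<Gamma> + \<Lambda> + i c) x\<^sup>i + i c \<Lambda> x\<^sup>i\<^sup>-\<^sup>1\<close>.
\<close>

definition tridiag :: "'a::comm_ring_1 \<Rightarrow> 'a \<Rightarrow> 'a \<Rightarrow> nat \<Rightarrow> nat \<Rightarrow> 'a" where
  "tridiag \<Gamma> \<Lambda> c i j =
     (if j = i then \<Gamma> + \<Lambda> + of_nat i * c else if j = Suc i then 1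
      else if i = Suc j then of_nat i * (c * \<Lambda>) else 0)"

text \<open>
  The recurrence for the principal minors \<open>d\<^sub>r\<close> contains a negative term, so nonnegativity alone does
  not propagate.  The differences \<open>d\<^sub>r\<^sub>+\<^sub>1 - \<Lambda> d\<^sub>r\<close> do: with \<open>s\<close> the last chosen index,
  \<open>d\<^sub>r\<^sub>+\<^sub>2 - \<Lambda> d\<^sub>r\<^sub>+\<^sub>1 = \<Gamma> d\<^sub>r\<^sub>+\<^sub>1 + s c (d\<^sub>r\<^sub>+\<^sub>1 - \<Lambda> d\<^sub>r)\<close> if the last two indices are neighbours, and the
  bracket is just \<open>d\<^sub>r\<^sub>+\<^sub>1\<close> otherwise.
\<close>

lemma tridiag_principal:
  fixes \<Gamma> \<Lambda> c :: "'a::nonneg_algebra"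
  assumes nn: "nonneg_coeffs \<Gamma>" "nonneg_coeffs \<Lambda>" "nonneg_coeffs c"
    and "strict_mono_on {..<Suc r} ss"
  shows "nonneg_coeffs (minor r (tridiag \<Gamma> \<Lambda> c) ss ss) \<and>
         nonneg_coeffs (minor (Suc r) (tridiag \<Gamma> \<Lambda> c) ss ss - \<Lambda> * minor r (tridiag \<Gamma> \<Lambda> c) ss ss)"
  using assms(4)
proof (induction r)
  case 0
  then show ?case using nn by (auto simp: minor_1 tridiag_def nonneg_one intro!: nonneg_add nonneg_mult nonneg_of_nat)
next
  case (Suc r)
  let ?A = "tridiag \<Gamma> \<Lambda> c"
  let ?d = "\<lambda>r. minor r ?A ss ss"
  let ?a = "ss r" and ?b = "ss (Suc r)"
  have mono: "i < j \<Longrightarrow> j \<le> Suc r \<Longrightarrow> ss i < ss j" for i j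
    using Suc.prems by (auto simp: strict_mono_on_lessThan_iff)
  have ab: "?a < ?b" by (rule mono) auto
  have IH: "nonneg_coeffs (?d r)" "nonneg_coeffs (?d (Suc r) - \<Lambda> * ?d r)"
    using Suc.IH strict_mono_on_initial[OF Suc.prems, of "Suc r"] by auto
  have d1: "nonneg_coeffs (?d (Suc r))"
    using nonneg_add[OF IH(2) nonneg_mult[OF nn(2) IH(1)]] by simp
  have "?d (Suc (Suc r)) = ?A ?b ?b * ?d (Suc r) - ?A ?b ?a * ?A ?a ?b * ?d r"
  proof (rule minor_continuant)
    fix i assume "i < r"
    then have "ss i < ?a" by (intro mono) auto
    with ab show "?A (ss i) ?b = 0 \<and> ?A ?b (ss i) = 0" by (auto simp: tridiag_def)
  qed
  then have "?d (Suc (Suc r)) - \<Lambda> * ?d (Suc r) = \<Gamma> * ?d (Suc r) +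
     (if ?b = Suc ?a then of_nat ?b * c * (?d (Suc r) - \<Lambda> * ?d r) else of_nat ?b * c * ?d (Suc r))"
    using ab by (auto simp: tridiag_def algebra_simps)
  also have "nonneg_coeffs \<dots>"
    using nn d1 IH by (auto intro!: nonneg_add nonneg_mult nonneg_of_nat nonneg_one)
  finally show ?case using d1 by simp
qed

lemma totally_positive_tridiag:
  fixes \<Gamma> \<Lambda> c :: "'a::nonneg_algebra"
  assumes "nonneg_coeffs \<Gamma>" "nonneg_coeffs \<Lambda>" "nonneg_coeffs c"
  shows "totally_positive (tridiag \<Gamma> \<Lambda> c)"
proof (rule totally_positiveI, rule minor_nonneg_tridiagonal)
  show "tridiag \<Gamma> \<Lambda> c i j = 0" if "i + 1 < j \<or> j + 1 < i" for i j
    using that by (auto simp: tridiag_def)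
  show "nonneg_coeffs (tridiag \<Gamma> \<Lambda> c i j)" for i j
    using assms by (auto simp: tridiag_def nonneg_zero nonneg_one
        intro!: nonneg_add nonneg_mult nonneg_of_nat)
  show "nonneg_coeffs (minor r (tridiag \<Gamma> \<Lambda> c) ss ss)" if "strict_mono_on {..<r} ss" for r ss
  proof (cases r)
    case (Suc k)
    have *: "nonneg_coeffs (minor k (tridiag \<Gamma> \<Lambda> c) ss ss)"
      "nonneg_coeffs (minor (Suc k) (tridiag \<Gamma> \<Lambda> c) ss ss - \<Lambda> * minor k (tridiag \<Gamma> \<Lambda> c) ss ss)"
      using tridiag_principal[of \<Gamma> \<Lambda> c k ss] assms that Suc by auto
    show ?thesis
      using nonneg_add[OF *(2) nonneg_mult[OF assms(2) *(1)]] by (simp add: Suc)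
  qed (simp add: nonneg_one)
qed

section \<open>Weighted Toeplitz matrices\<close>

text \<open>
  Every Leibniz term that does not vanish receives the same power of \<open>c\<close>.  If the row indices sum to
  less than the column indices, then all terms vanish, so the truncated difference does no harm.
\<close>

lemma minor_graded:
  fixes A :: "nat \<Rightarrow> nat \<Rightarrow> 'a::comm_ring_1"
  assumes lower: "\<And>i j. i < j \<Longrightarrow> A i j = 0"
  shows "minor r (\<lambda>i j. A i j * c ^ (i - j)) rs cs =
    minor r A rs cs * c ^ ((\<Sum>i<r. rs i) - (\<Sum>j<r. cs j))"
proof -
  let ?R = "{0..<r}"
  have "(\<Prod>i\<in>?R. A (rs i) (cs (p i)) * c ^ (rs i - cs (p i))) =
      (\<Prod>i\<in>?R. A (rs i) (cs (p i))) * c ^ ((\<Sum>i<r. rs i) - (\<Sum>j<r. cs j))"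
    if p: "p permutes ?R" for p
  proof (cases "\<exists>i\<in>?R. rs i < cs (p i)")
    case True
    then obtain i where i: "i \<in> ?R" "A (rs i) (cs (p i)) = 0" using lower by auto
    then have "(\<Prod>i\<in>?R. A (rs i) (cs (p i)) * c ^ (rs i - cs (p i))) = 0"
      "(\<Prod>i\<in>?R. A (rs i) (cs (p i))) = 0"
      by (intro prod_zero bexI[of _ i]; simp)+
    then show ?thesis by simp
  next
    case False
    then have "(\<Sum>i\<in>?R. rs i - cs (p i)) = (\<Sum>i\<in>?R. rs i) - (\<Sum>i\<in>?R. cs (p i))"
      by (intro sum_subtractf_nat) (auto simp: not_less)
    also have "(\<Sum>i\<in>?R. cs (p i)) = (\<Sum>i\<in>?R. cs i)"
      using sum.permute[OF p, of cs] by (simp add: o_def)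
    finally show ?thesis
      by (simp add: prod.distrib atLeast0LessThan flip: power_sum)
  qed
  then show ?thesis
    unfolding minor_leibniz sum_distrib_right by (intro sum.cong) (auto simp: mult_ac)
qed

text \<open>
  The matrix of \<open>P(c D)\<close>, \<open>D = d/dx\<close>, in the basis of monomials: row \<open>j\<close> belongs to \<open>x\<^sup>j\<close>.
\<close>

definition exp_toeplitz :: "real fps \<Rightarrow> 'a \<Rightarrow> nat \<Rightarrow> nat \<Rightarrow> 'a::{comm_ring_1, real_algebra_1}" where
  "exp_toeplitz P c j l =
     of_real (if l \<le> j then fact j / fact l * fps_nth P (j - l) else 0) * c ^ (j - l)"

lemma totally_positive_exp_toeplitz:
  fixes c :: "'a::nonneg_algebra"
  assumes PF: "PF_function P" and c: "nonneg_coeffs c"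
  shows "totally_positive (exp_toeplitz P c)"
proof (rule totally_positiveI)
  fix r and rs cs :: "nat \<Rightarrow> nat"
  assume mono: "strict_mono_on {..<r} rs" "strict_mono_on {..<r} cs"
  let ?P = "\<lambda>j l. if l \<le> j then fps_nth P (j - l) else 0"
  let ?A = "\<lambda>j l. fact j * ?P j l * (1 / fact l)"
  have eq: "exp_toeplitz P c = (\<lambda>j l. of_real (?A j l) * c ^ (j - l))"
    by (auto simp: fun_eq_iff exp_toeplitz_def)
  have "minor r (exp_toeplitz P c) rs cs =
      of_real (minor r ?A rs cs) * c ^ ((\<Sum>i<r. rs i) - (\<Sum>j<r. cs j))"
    unfolding eq by (subst minor_graded) (simp_all only: minor_of_real, auto)
  moreover have "0 \<le> minor r ?A rs cs"
  proof -
    have "0 \<le> minor r ?P rs cs"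
      using totally_positiveD[OF PF[unfolded PF_function_def] mono]
      by (simp add: nonneg_coeffs_real_def)
    then show ?thesis
      unfolding minor_scale by (intro mult_nonneg_nonneg prod_nonneg) auto
  qed
  ultimately show "nonneg_coeffs (minor r (exp_toeplitz P c) rs cs)"
    using c by (simp add: nonneg_mult nonneg_of_real nonneg_power)
qed

section \<open>Production matrices\<close>

definition add_unit_row :: "(nat \<Rightarrow> nat \<Rightarrow> 'a::comm_ring_1) \<Rightarrow> nat \<Rightarrow> nat \<Rightarrow> 'a" where
  "add_unit_row A i j = (case i of 0 \<Rightarrow> of_bool (j = 0) | Suc i' \<Rightarrow> A i' j)"

definition add_zero_column :: "(nat \<Rightarrow> nat \<Rightarrow> 'a::comm_ring_1) \<Rightarrow> nat \<Rightarrow> nat \<Rightarrow> 'a" where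
  "add_zero_column A i j = (case j of 0 \<Rightarrow> 0 | Suc j' \<Rightarrow> A i j')"

text \<open>
  If row \<open>0\<close> takes part in a minor, then its only entry \<open>1\<close> sits in column \<open>0\<close>: the minor either has a
  zero row or reduces to a minor of \<open>A\<close>.
\<close>

lemma totally_positive_add_unit_row:
  fixes A :: "nat \<Rightarrow> nat \<Rightarrow> 'a::nonneg_algebra"
  assumes A: "totally_positive A"
  shows "totally_positive (add_unit_row A)"
proof (rule totally_positiveI)
  fix r and rs cs :: "nat \<Rightarrow> nat"
  assume mono: "strict_mono_on {..<r} rs" "strict_mono_on {..<r} cs"
  have rsD: "rs i < rs j" and csD: "cs i < cs j" if "i < j" "j < r" for i j
    using mono that by (auto simp: strict_mono_on_lessThan_iff)
  consider "r = 0" | "0 < r" "0 < rs 0" | "0 < r" "rs 0 = 0" "0 < cs 0" | "0 < r" "rs 0 = 0" "cs 0 = 0"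
    by auto
  then show "nonneg_coeffs (minor r (add_unit_row A) rs cs)"
  proof cases
    case 1
    then show ?thesis by (simp add: nonneg_one)
  next
    case 2
    have pos: "0 < rs i" if "i < r" for i
      using rsD[of 0 i] that 2 by (cases "i = 0") auto
    then have "minor r (add_unit_row A) rs cs = minor r A (\<lambda>i. rs i - 1) cs"
      by (intro minor_cong) (auto simp: add_unit_row_def split: nat.splits dest: pos)
    also have "nonneg_coeffs \<dots>"
      using rsD pos mono(2) by (intro totally_positiveD[OF A])
        (auto simp: strict_mono_on_lessThan_iff Suc_le_eq intro!: diff_less_mono dest: less_trans)
    finally show ?thesis .
  next
    case 3
    then have "0 < cs j" if "j < r" for j
      using csD[of 0 j] that by (cases "j = 0") auto
    with 3 have "minor r (add_unit_row A) rs cs = 0"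
      by (intro minor_zero_row[of 0]) (auto simp: add_unit_row_def)
    then show ?thesis by (simp add: nonneg_zero)
  next
    case 4
    have pos: "0 < rs (Suc i)" "0 < cs (Suc i)" if "i < r - Suc 0" for i
      using rsD[of 0 "Suc i"] csD[of 0 "Suc i"] that 4 by auto
    have "minor r (add_unit_row A) rs cs =
        minor 1 (add_unit_row A) rs cs * minor (r - 1) (add_unit_row A) (\<lambda>i. rs (1 + i)) (\<lambda>j. cs (1 + j))"
    proof (rule minor_block_lower)
      fix i j :: nat assume "i < 1" "1 \<le> j" "j < r"
      then show "add_unit_row A (rs i) (cs j) = 0"
        using csD[of 0 j] 4 by (auto simp: add_unit_row_def)
    qed (use 4 in auto)
    also have "minor 1 (add_unit_row A) rs cs = 1"
      using 4 by (simp add: minor_1 add_unit_row_def)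
    also have "minor (r - 1) (add_unit_row A) (\<lambda>i. rs (1 + i)) (\<lambda>j. cs (1 + j)) =
        minor (r - 1) A (\<lambda>i. rs (Suc i) - 1) (\<lambda>j. cs (Suc j))"
      using pos by (intro minor_cong) (auto simp: add_unit_row_def split: nat.splits dest: pos)
    also have "nonneg_coeffs (1 * \<dots>)"
      unfolding mult_1 using rsD csD pos by (intro totally_positiveD[OF A])
        (auto simp: strict_mono_on_lessThan_iff Suc_le_eq intro!: diff_less_mono)
    finally show ?thesis .
  qed
qed

lemma totally_positive_add_zero_column:
  fixes A :: "nat \<Rightarrow> nat \<Rightarrow> 'a::nonneg_algebra"
  assumes A: "totally_positive A"
  shows "totally_positive (add_zero_column A)"
proof (rule totally_positiveI)
  fix r and rs cs :: "nat \<Rightarrow> nat"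
  assume mono: "strict_mono_on {..<r} rs" "strict_mono_on {..<r} cs"
  have csD: "cs i < cs j" if "i < j" "j < r" for i j
    using mono that by (auto simp: strict_mono_on_lessThan_iff)
  show "nonneg_coeffs (minor r (add_zero_column A) rs cs)"
  proof (cases "0 < r \<and> cs 0 = 0")
    case True
    then have "minor r (add_zero_column A) rs cs = 0"
      by (intro minor_zero_col[of 0]) (auto simp: add_zero_column_def)
    then show ?thesis by (simp add: nonneg_zero)
  next
    case False
    have pos: "0 < cs i" if "i < r" for i
      using csD[of 0 i] that False by (cases "i = 0") auto
    then have "minor r (add_zero_column A) rs cs = minor r A rs (\<lambda>j. cs j - 1)"
      by (intro minor_cong) (auto simp: add_zero_column_def split: nat.splits dest: pos)
    also have "nonneg_coeffs \<dots>"
      using csD pos mono(1) by (intro totally_positiveD[OF A])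
        (auto simp: strict_mono_on_lessThan_iff Suc_le_eq intro!: diff_less_mono dest: less_trans)
    finally show ?thesis .
  qed
qed

text \<open>
  Row \<open>n\<close> is \<open>e\<^sub>0 A\<^sup>n\<close>.  The summation is cut off at \<open>N\<close> so that the construction also applies to the
  transpose of \<open>A\<close>; for a lower Hessenberg matrix the rows \<open>n < N\<close> do not depend on \<open>N\<close>.
\<close>

primrec output_matrix :: "nat \<Rightarrow> (nat \<Rightarrow> nat \<Rightarrow> 'a::comm_ring_1) \<Rightarrow> nat \<Rightarrow> nat \<Rightarrow> 'a" where
  "output_matrix N A 0 k = of_bool (k = 0)"
| "output_matrix N A (Suc n) k = (\<Sum>j<N. output_matrix N A n j * A j k)"

text \<open>
  Let \<open>M\<^sub>m\<close> consist of the first \<open>m\<close> rows.  Then \<open>M\<^sub>m\<^sub>+\<^sub>1\<close> is the product of the block sum \<open>1 \<oplus> M\<^sub>m\<close> and the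
  matrix \<open>A\<close> with the row \<open>e\<^sub>0\<close> on top, and both factors inherit total positivity.
\<close>

lemma totally_positive_output_matrix:
  fixes A :: "nat \<Rightarrow> nat \<Rightarrow> 'a::nonneg_algebra"
  assumes A: "totally_positive A"
  shows "totally_positive (output_matrix N A)"
proof -
  define M where "M m i j = (if i < m then output_matrix N A i j else 0)" for m i j
  have "totally_positive (M m)" for m
  proof (induction m)
    case 0
    then show ?case using totally_positive_zero by (simp add: M_def)
  next
    case (Suc m)
    have "M (Suc m) = (\<lambda>i k. \<Sum>j<Suc N. add_unit_row (add_zero_column (M m)) i j * add_unit_row A j k)"
    proof (intro ext)
      fix i k
      show "M (Suc m) i k = (\<Sum>j<Suc N. add_unit_row (add_zero_column (M m)) i j * add_unit_row A j k)"
        by (cases i; simp only: sum.lessThan_Suc_shift)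
           (auto simp: M_def add_unit_row_def add_zero_column_def)
    qed
    then show ?case
      using A Suc.IH by (simp only:) (intro totally_positive_mult totally_positive_add_unit_row
          totally_positive_add_zero_column)
  qed
  then show ?thesis
  proof (intro totally_positiveI)
    fix r and rs cs :: "nat \<Rightarrow> nat"
    assume M: "\<And>m. totally_positive (M m)" and mono: "strict_mono_on {..<r} rs" "strict_mono_on {..<r} cs"
    have "rs i \<le> (\<Sum>i<r. rs i)" if "i < r" for i
      using that by (intro member_le_sum) auto
    then have "minor r (output_matrix N A) rs cs = minor r (M (Suc (\<Sum>i<r. rs i))) rs cs"
      by (intro minor_cong) (auto simp: M_def less_Suc_eq_le)
    then show "nonneg_coeffs (minor r (output_matrix N A) rs cs)"
      using totally_positiveD[OF M mono] by simp
  qed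
qed

text \<open>
  Both sides are the entry \<open>e\<^sub>0 A\<^sup>m A\<^sup>n e\<^sub>0\<close>.  This factorizes the Hankel matrix of the zeroth column.
\<close>

lemma output_matrix_bilinear:
  assumes "0 < N"
  shows "(\<Sum>k<N. output_matrix N A m k * output_matrix N (\<lambda>i j. A j i) n k) = output_matrix N A (m + n) 0"
proof (induction n arbitrary: m)
  case 0
  have "(\<Sum>k<N. output_matrix N A m k * of_bool (k = 0)) = (\<Sum>k\<in>{0}. output_matrix N A m k)"
    using assms by (intro sum.mono_neutral_cong_right) auto
  then show ?case by simp
next
  case (Suc n)
  have "(\<Sum>k<N. output_matrix N A m k * output_matrix N (\<lambda>i j. A j i) (Suc n) k) =
     (\<Sum>j<N. (\<Sum>k<N. output_matrix N A m k * A k j) * output_matrix N (\<lambda>i j. A j i) n j)"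
    by (simp add: sum_distrib_left sum_distrib_right mult_ac) (rule sum.swap)
  also have "\<dots> = output_matrix N A (m + Suc n) 0"
    using Suc.IH[of "Suc m"] by simp
  finally show ?case .
qed

text \<open>
  The passage from the production matrix \<open>T B\<close> to the array \<open>O'\<close> that it generates.  Since \<open>O'\<close> and \<open>T\<close>
  are lower triangular, row \<open>n\<close> of \<open>O'\<close> depends on the first \<open>n\<close> rows of \<open>T B\<close> only, and the cut-off
  matrices above agree with \<open>O'\<close> in all indices that occur in a given minor.
\<close>

lemma production_factorization_TP:
  fixes T B O' :: "nat \<Rightarrow> nat \<Rightarrow> 'a::nonneg_algebra"
  assumes T: "totally_positive T" and B: "totally_positive B"
    and lower: "\<And>i j. i < j \<Longrightarrow> T i j = 0" "\<And>i j. i < j \<Longrightarrow> O' i j = 0"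
    and init: "O' 0 0 = 1"
    and rec: "\<And>n k. O' (Suc n) k = (\<Sum>j\<le>n. O' n j * (\<Sum>l\<le>j. T j l * B l k))"
  shows "totally_positive O'" and "coeffwise_SM (\<lambda>n. O' n 0)"
proof -
  define Q where "Q N j k = (\<Sum>l<N. T j l * B l k)" for N j k
  have TP: "totally_positive (Q N)" for N
    unfolding Q_def by (rule totally_positive_mult[OF T B])
  have out: "output_matrix N (Q N) n k = O' n k" if "n < N" for N n k
    using that
  proof (induction n arbitrary: k)
    case 0
    then show ?case using init lower by auto
  next
    case (Suc n)
    have "output_matrix N (Q N) (Suc n) k = (\<Sum>j<N. O' n j * Q N j k)"
      using Suc by simp
    also have "\<dots> = (\<Sum>j\<le>n. O' n j * Q N j k)"
      using Suc.prems lower by (intro sum.mono_neutral_right) auto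
    also have "\<dots> = (\<Sum>j\<le>n. O' n j * (\<Sum>l\<le>j. T j l * B l k))"
      using Suc.prems lower unfolding Q_def
      by (intro sum.cong refl arg_cong2[where f = "(*)"] sum.mono_neutral_right) auto
    finally show ?case by (simp add: rec)
  qed
  show "totally_positive O'"
  proof (rule totally_positiveI)
    fix r and rs cs :: "nat \<Rightarrow> nat"
    assume mono: "strict_mono_on {..<r} rs" "strict_mono_on {..<r} cs"
    define N where "N = Suc (\<Sum>i<r. rs i)"
    have "rs i < N" if "i < r" for i
      unfolding N_def less_Suc_eq_le using that by (intro member_le_sum) auto
    then have "minor r O' rs cs = minor r (output_matrix N (Q N)) rs cs"
      by (intro minor_cong) (simp add: out)
    then show "nonneg_coeffs (minor r O' rs cs)"
      using totally_positiveD[OF totally_positive_output_matrix[OF TP] mono] by simp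
  qed
  show "coeffwise_SM (\<lambda>n. O' n 0)"
    unfolding coeffwise_SM_def
  proof (rule totally_positiveI)
    fix r and rs cs :: "nat \<Rightarrow> nat"
    assume mono: "strict_mono_on {..<r} rs" "strict_mono_on {..<r} cs"
    define N where "N = Suc ((\<Sum>i<r. rs i) + (\<Sum>i<r. cs i))"
    have "rs i + cs j < N" if "i < r" "j < r" for i j
      unfolding N_def less_Suc_eq_le using that by (intro add_mono member_le_sum) auto
    moreover have "0 < N" by (simp add: N_def)
    ultimately have "minor r (\<lambda>i j. O' (i + j) 0) rs cs =
      minor r (\<lambda>i j. \<Sum>k<N. output_matrix N (Q N) i k * output_matrix N (\<lambda>i j. Q N j i) j k) rs cs"
      by (intro minor_cong) (simp add: out output_matrix_bilinear)
    also have "nonneg_coeffs \<dots>"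
      using mono by (intro totally_positiveD totally_positive_mult totally_positive_output_matrix TP
          totally_positive_transpose[OF totally_positive_output_matrix[OF totally_positive_transpose[OF TP]]])
    finally show "nonneg_coeffs (minor r (\<lambda>i j. O' (i + j) 0) rs cs)" .
  qed
qed

section \<open>Log-convexity from Hankel minors\<close>

lemma minor_laplace_first_row:
  "minor (Suc r) A rs cs = (\<Sum>j<Suc r. (-1) ^ j * A (rs 0) (cs j) *
     minor r A (\<lambda>i. rs (Suc i)) (\<lambda>k. cs (if k < j then k else Suc k)))"
proof -
  let ?M = "Matrix.mat (Suc r) (Suc r) (\<lambda>(i, j). A (rs i) (cs j))"
  have "minor (Suc r) A rs cs = (\<Sum>j<Suc r. ?M $$ (0, j) * cofactor ?M 0 j)"
    unfolding minor_def by (rule laplace_expansion_row) auto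
  also have "\<dots> = (\<Sum>j<Suc r. (-1) ^ j * A (rs 0) (cs j) *
     minor r A (\<lambda>i. rs (Suc i)) (\<lambda>k. cs (if k < j then k else Suc k)))"
  proof (rule sum.cong[OF refl])
    fix j assume j: "j \<in> {..<Suc r}"
    have "Determinant.det (mat_delete ?M 0 j) =
        minor r A (\<lambda>i. rs (Suc i)) (\<lambda>k. cs (if k < j then k else Suc k))"
      unfolding minor_def mat_delete_def
      by (rule arg_cong[where f = Determinant.det], rule eq_matI) auto
    with j show "?M $$ (0, j) * cofactor ?M 0 j = (-1) ^ j * A (rs 0) (cs j) *
     minor r A (\<lambda>i. rs (Suc i)) (\<lambda>k. cs (if k < j then k else Suc k))"
      by (simp add: cofactor_def)
  qed
  finally show ?thesis .
qed

lemma minor_2: "minor 2 A rs cs = A (rs 0) (cs 0) * A (rs 1) (cs 1) - A (rs 0) (cs 1) * A (rs 1) (cs 0)"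
  by (simp add: numeral_2_eq_2 minor_laplace_first_row)

lemma minor_3: "minor 3 A rs cs =
   A (rs 0) (cs 0) * (A (rs 1) (cs 1) * A (rs 2) (cs 2) - A (rs 1) (cs 2) * A (rs 2) (cs 1))
 - A (rs 0) (cs 1) * (A (rs 1) (cs 0) * A (rs 2) (cs 2) - A (rs 1) (cs 2) * A (rs 2) (cs 0))
 + A (rs 0) (cs 2) * (A (rs 1) (cs 0) * A (rs 2) (cs 1) - A (rs 1) (cs 1) * A (rs 2) (cs 0))"
  unfolding numeral_3_eq_3
  by (subst minor_laplace_first_row) (simp add: minor_2[simplified numeral_2_eq_2] numeral_2_eq_2)

lemma minor_4: "minor 4 A rs cs =
   A (rs 0) (cs 0) * minor 3 A (\<lambda>i. rs (Suc i)) (\<lambda>k. cs (Suc k))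
 - A (rs 0) (cs 1) * minor 3 A (\<lambda>i. rs (Suc i)) (\<lambda>k. cs (if k < 1 then k else Suc k))
 + A (rs 0) (cs 2) * minor 3 A (\<lambda>i. rs (Suc i)) (\<lambda>k. cs (if k < 2 then k else Suc k))
 - A (rs 0) (cs 3) * minor 3 A (\<lambda>i. rs (Suc i)) (\<lambda>k. cs (if k < 3 then k else Suc k))"
proof -
  have "minor (Suc 3) A rs cs = (\<Sum>j<Suc 3. (-1) ^ j * A (rs 0) (cs j) *
     minor 3 A (\<lambda>i. rs (Suc i)) (\<lambda>k. cs (if k < j then k else Suc k)))"
    by (rule minor_laplace_first_row)
  also have "{..<Suc 3} = {0, 1, 2, 3::nat}" by auto
  finally show ?thesis by simp
qed

definition hankel :: "nat \<Rightarrow> (nat \<Rightarrow> 'a::comm_ring_1) \<Rightarrow> nat \<Rightarrow> 'a" where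
  "hankel r \<alpha> k = minor r (\<lambda>i j. \<alpha> (k + (i + j))) id id"

lemma hankel_3_eq: "hankel 3 \<alpha> k =
    \<alpha> k * (\<alpha> (k+2) * \<alpha> (k+4) - \<alpha> (k+3) * \<alpha> (k+3)) - \<alpha> (k+1) * (\<alpha> (k+1) * \<alpha> (k+4) - \<alpha> (k+3) * \<alpha> (k+2))
  + \<alpha> (k+2) * (\<alpha> (k+1) * \<alpha> (k+3) - \<alpha> (k+2) * \<alpha> (k+2))"
  by (simp add: hankel_def minor_3) (simp add: eval_nat_numeral)

text \<open>
  Dodgson condensation for a Hankel determinant of order 3, whose centre is \<open>\<alpha> (k + 2)\<close>.
\<close>

lemma dodgson_hankel_3:
  "log_op \<alpha> (k+1) * log_op \<alpha> (k+3) - (log_op \<alpha> (k+2))\<^sup>2 = \<alpha> (k+2) * hankel 3 \<alpha> k"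
  unfolding log_op_def hankel_3_eq power2_eq_square
  by (simp add: eval_nat_numeral algebra_simps)

lemma dodgson_hankel_4_aux:
  fixes a b c d e f g :: "'a::comm_ring_1"
  defines "H \<equiv> \<lambda>a b c d e. a * (c * e - d * d) - b * (b * e - d * c) + c * (b * d - c * c)"
  shows "H a b c d e * H c d e f g - (H b c d e f)\<^sup>2 =
    (a * (c * (e * g - f * f) - d * (d * g - f * e) + e * (d * f - e * e))
     - b * (b * (e * g - f * f) - d * (c * g - f * d) + e * (c * f - e * d))
     + c * (b * (d * g - f * e) - c * (c * g - f * d) + e * (c * e - d * d))
     - d * (b * (d * f - e * e) - c * (c * f - e * d) + d * (c * e - d * d))) * (c * e - d\<^sup>2)"
  unfolding H_def by (simp add: power2_eq_square algebra_simps)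

text \<open>
  Dodgson condensation for order 4: the corner minors of order 3 are Hankel determinants with
  shifted start, and the central minor of order 2 is a value of the log-convexity operator.
\<close>

lemma dodgson_hankel_4:
  "hankel 3 \<alpha> k * hankel 3 \<alpha> (k+2) - (hankel 3 \<alpha> (k+1))\<^sup>2 = hankel 4 \<alpha> k * log_op \<alpha> (k+3)"
proof -
  have "hankel 4 \<alpha> k =
     \<alpha> k * (\<alpha> (k+2) * (\<alpha> (k+4) * \<alpha> (k+6) - \<alpha> (k+5) * \<alpha> (k+5))
         - \<alpha> (k+3) * (\<alpha> (k+3) * \<alpha> (k+6) - \<alpha> (k+5) * \<alpha> (k+4))
         + \<alpha> (k+4) * (\<alpha> (k+3) * \<alpha> (k+5) - \<alpha> (k+4) * \<alpha> (k+4)))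
   - \<alpha> (k+1) * (\<alpha> (k+1) * (\<alpha> (k+4) * \<alpha> (k+6) - \<alpha> (k+5) * \<alpha> (k+5))
         - \<alpha> (k+3) * (\<alpha> (k+2) * \<alpha> (k+6) - \<alpha> (k+5) * \<alpha> (k+3))
         + \<alpha> (k+4) * (\<alpha> (k+2) * \<alpha> (k+5) - \<alpha> (k+4) * \<alpha> (k+3)))
   + \<alpha> (k+2) * (\<alpha> (k+1) * (\<alpha> (k+3) * \<alpha> (k+6) - \<alpha> (k+5) * \<alpha> (k+4))
         - \<alpha> (k+2) * (\<alpha> (k+2) * \<alpha> (k+6) - \<alpha> (k+5) * \<alpha> (k+3))
         + \<alpha> (k+4) * (\<alpha> (k+2) * \<alpha> (k+4) - \<alpha> (k+3) * \<alpha> (k+3)))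
   - \<alpha> (k+3) * (\<alpha> (k+1) * (\<alpha> (k+3) * \<alpha> (k+5) - \<alpha> (k+4) * \<alpha> (k+4))
         - \<alpha> (k+2) * (\<alpha> (k+2) * \<alpha> (k+5) - \<alpha> (k+4) * \<alpha> (k+3))
         + \<alpha> (k+3) * (\<alpha> (k+2) * \<alpha> (k+4) - \<alpha> (k+3) * \<alpha> (k+3)))"
    by (simp add: hankel_def minor_4 minor_3) (simp add: eval_nat_numeral)
  moreover have "log_op \<alpha> (k+3) = \<alpha> (k+2) * \<alpha> (k+4) - (\<alpha> (k+3))\<^sup>2"
    by (simp add: log_op_def add.commute)
  ultimately show ?thesis
    using dodgson_hankel_4_aux[of "\<alpha> k" "\<alpha> (k+2)" "\<alpha> (k+4)" "\<alpha> (k+3)" "\<alpha> (k+1)" "\<alpha> (k+6)" "\<alpha> (k+5)"]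
    unfolding hankel_3_eq by (simp add: eval_nat_numeral)
qed

lemma coeffwise_SM_hankel:
  assumes "coeffwise_SM \<alpha>"
  shows "nonneg_coeffs (hankel r \<alpha> k)"
proof -
  have "hankel r \<alpha> k = minor r (\<lambda>i j. \<alpha> (i + j)) (\<lambda>i. k + i) id"
    unfolding hankel_def by (rule minor_cong) (simp add: add_ac)
  with assms show ?thesis
    unfolding coeffwise_SM_def
    by (auto intro!: totally_positiveD simp: strict_mono_on_lessThan_iff)
qed

text \<open>
  Let \<open>L\<close> be the log-convexity operator and let \<open>H\<^sub>r\<close> denote Hankel determinants of order \<open>r\<close>.  Applying
  condensation twice gives \<open>L \<alpha> = H\<^sub>2\<close>, \<open>L\<^sup>2 \<alpha> = \<alpha> H\<^sub>3\<close> and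
  \<open>L\<^sup>3 \<alpha> = L \<alpha> (H\<^sub>3 H\<^sub>3' + \<alpha>\<^sup>2 H\<^sub>4)\<close> with suitable starting indices, all of them without subtraction.
\<close>

theorem coeffwise_SM_imp_log_convex_3:
  fixes \<alpha> :: "nat \<Rightarrow> 'a::nonneg_algebra"
  assumes SM: "coeffwise_SM \<alpha>"
  shows "log_convex 3 \<alpha>"
proof -
  have \<alpha>: "nonneg_coeffs (\<alpha> n)" for n
    using coeffwise_SM_hankel[OF SM, of 1 n] by (simp add: hankel_def minor_1)
  have L1_eq: "log_op \<alpha> (Suc k) = hankel 2 \<alpha> k" for k
    by (simp add: log_op_def hankel_def minor_2 power2_eq_square)
  have L1: "nonneg_coeffs (log_op \<alpha> i)" if "1 \<le> i" for i
    using that L1_eq[of "i - 1"] coeffwise_SM_hankel[OF SM, of 2 "i - 1"] by simp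
  have L2_eq: "log_op (log_op \<alpha>) (k + 2) = \<alpha> (k + 2) * hankel 3 \<alpha> k" for k
    using dodgson_hankel_3[of \<alpha> k] by (simp add: log_op_def[of "log_op \<alpha>"] eval_nat_numeral)
  have L3_eq: "log_op (log_op (log_op \<alpha>)) (k + 3) = log_op \<alpha> (k + 3) *
      (hankel 3 \<alpha> k * hankel 3 \<alpha> (k + 2) + (\<alpha> (k + 3))\<^sup>2 * hankel 4 \<alpha> k)" for k
  proof -
    have "log_op (log_op (log_op \<alpha>)) (k + 3) =
       (\<alpha> (k+2) * hankel 3 \<alpha> k) * (\<alpha> (k+4) * hankel 3 \<alpha> (k+2)) - (\<alpha> (k+3) * hankel 3 \<alpha> (k+1))\<^sup>2"
      using L2_eq[of k] L2_eq[of "k+1"] L2_eq[of "k+2"] 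
      by (simp add: log_op_def[of "log_op (log_op \<alpha>)"] eval_nat_numeral)
    also have "\<dots> = log_op \<alpha> (k+3) * (hankel 3 \<alpha> k * hankel 3 \<alpha> (k+2)) +
       (\<alpha> (k+3))\<^sup>2 * (hankel 3 \<alpha> k * hankel 3 \<alpha> (k+2) - (hankel 3 \<alpha> (k+1))\<^sup>2)"
      by (simp add: log_op_def power2_eq_square algebra_simps)
    finally show ?thesis unfolding dodgson_hankel_4 by (simp add: algebra_simps)
  qed
  have "nonneg_coeffs ((log_op ^^ m) \<alpha> i)" if m: "m \<in> {1..3}" and i: "m \<le> i" for m i
  proof -
    consider "m = 1" | "m = 2" | "m = 3" using m by force
    then show ?thesis
    proof cases
      case 1
      then show ?thesis using L1 i by simp
    next
      case 2
      have "log_op ^^ 2 = (\<lambda>\<alpha> :: nat \<Rightarrow> 'a. log_op (log_op \<alpha>))"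
        by (simp add: numeral_2_eq_2 fun_eq_iff)
      moreover have "i = i - 2 + 2" using i 2 by simp
      ultimately have "(log_op ^^ m) \<alpha> i = log_op (log_op \<alpha>) (i - 2 + 2)"
        using 2 by metis
      then show ?thesis
        unfolding L2_eq using \<alpha> coeffwise_SM_hankel[OF SM] by (auto intro!: nonneg_mult)
    next
      case 3
      have "log_op ^^ 3 = (\<lambda>\<alpha> :: nat \<Rightarrow> 'a. log_op (log_op (log_op \<alpha>)))"
        by (simp add: numeral_3_eq_3 fun_eq_iff)
      moreover have "i = i - 3 + 3" using i 3 by simp
      ultimately have "(log_op ^^ m) \<alpha> i = log_op (log_op (log_op \<alpha>)) (i - 3 + 3)"
        using 3 by metis
      then show ?thesis
        unfolding L3_eq using \<alpha> L1 i 3 coeffwise_SM_hankel[OF SM]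
        by (auto intro!: nonneg_mult nonneg_add nonneg_power)
    qed
  qed
  then show ?thesis by (auto simp: log_convex_def)
qed

section \<open>Jacobi's identity and signed inverses\<close>

text \<open>
  Exchanging two neighbouring values preserves the order of any other pair of values.
\<close>

lemma transpose_adjacent_less:
  "x < y \<Longrightarrow> \<not> (x = a \<and> y = Suc a) \<Longrightarrow> Transposition.transpose a (Suc a) x < Transposition.transpose a (Suc a) y"
  by (auto simp: Transposition.transpose_def)

text \<open>
  The sign of a shuffle, that is, of a permutation increasing on the first \<open>r\<close> positions and on the
  others.  Unless it is the identity, lowering the first value that is too large by one is a
  transposition of neighbouring values; it yields another shuffle, flips the sign and decreases the
  sum of the first \<open>r\<close> values by one.
\<close>

lemma sign_shuffle:
  assumes "p permutes {0..<n}" "r \<le> n" "strict_mono_on {..<r} p" "strict_mono_on {r..<n} p"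
  shows "sign p = (-1) ^ ((\<Sum>i<r. p i) + (\<Sum>i<r. i))"
  using assms
proof (induction "\<Sum>i<r. p i" arbitrary: p rule: less_induct)
  case less
  have inj: "p i = p j \<longleftrightarrow> i = j" for i j using less.prems(1) by (simp add: permutes_inj inj_eq)
  have mono1: "p i < p j" if "i < j" "j < r" for i j
    using less.prems(3) that by (auto simp: strict_mono_on_def)
  have mono2: "p i < p j" if "i < j" "r \<le> i" "j < n" for i j
    using less.prems(4) that by (auto simp: strict_mono_on_def)
  show ?case
  proof (cases "\<forall>i<r. p i = i")
    case True
    have big: "r \<le> p j" if "r \<le> j" for j
    proof (rule ccontr)
      assume "\<not> r \<le> p j"
      then have "p (p j) = p j" using True by simp
      then show False using inj \<open>\<not> r \<le> p j\<close> that by auto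
    qed
    have "i \<le> p i" if "i < n" for i
      using that
    proof (induction i)
      case (Suc i)
      show ?case
      proof (cases "Suc i \<le> r")
        case True
        then show ?thesis using \<open>\<forall>i<r. p i = i\<close> big[of "Suc i"] by (cases "Suc i < r") auto
      next
        case False
        then have "p i < p (Suc i)" using Suc.prems by (intro mono2) auto
        then show ?thesis using Suc by auto
      qed
    qed simp
    then have "p = id" using permutes_natset_ge[OF less.prems(1)] by auto
    then show ?thesis by (simp add: sign_id flip: mult_2)
  next
    case False
    define i where "i = (LEAST i. i < r \<and> p i \<noteq> i)"
    have i: "i < r" "p i \<noteq> i" using LeastI_ex[of "\<lambda>i. i < r \<and> p i \<noteq> i"] False by (auto simp: i_def)
    have below: "p k = k" if "k < i" for k
      using not_less_Least[of k "\<lambda>i. i < r \<and> p i \<noteq> i"] that i by (auto simp: i_def)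
    have "i < p i"
    proof (rule ccontr)
      assume "\<not> i < p i"
      then have "p i < i" using i by auto
      then have "p (p i) = p i" by (rule below)
      then show False using inj i by auto
    qed
    define a where "a = p i - 1"
    have a: "p i = Suc a" "i \<le> a" using \<open>i < p i\<close> by (auto simp: a_def)
    have no_a: "p k \<noteq> a" if "k < r" for k
    proof -
      consider "k < i" | "k = i" | "i < k" by linarith
      then show ?thesis
        using below[of k] a mono1[of i k] that by cases auto
    qed
    have no_Suc_a: "p k \<noteq> Suc a" if "r \<le> k" for k
      using inj[of k i] a(1) i(1) that by auto
    have "p i < n" using permutes_in_image[OF less.prems(1), of i] i less.prems(2) by auto
    define p' where "p' = Transposition.transpose a (Suc a) \<circ> p"
    have p': "p' permutes {0..<n}"
      unfolding p'_def using a \<open>p i < n\<close>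
      by (intro permutes_compose[OF less.prems(1)] permutes_swap_id) auto
    have p'_eq: "p' k = p k" if "k < r" "k \<noteq> i" for k
      using no_a[OF that(1)] inj[of k i] that a by (auto simp: p'_def Transposition.transpose_def)
    have "(\<Sum>k<r. p k) = p i + (\<Sum>k\<in>{..<r} - {i}. p k)"
      using i by (intro sum.remove) auto
    also have "(\<Sum>k\<in>{..<r} - {i}. p k) = (\<Sum>k\<in>{..<r} - {i}. p' k)"
      by (intro sum.cong) (auto simp: p'_eq)
    also have "p i = Suc (p' i)" using a by (simp add: p'_def)
    also have "Suc (p' i) + (\<Sum>k\<in>{..<r} - {i}. p' k) = Suc (\<Sum>k<r. p' k)"
      using i by (subst sum.remove[of "{..<r}" i p']) auto
    finally have sum: "(\<Sum>k<r. p k) = Suc (\<Sum>k<r. p' k)" .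
    have "sign p' = (-1) ^ ((\<Sum>i<r. p' i) + (\<Sum>i<r. i))"
    proof (rule less.hyps[OF _ p' less.prems(2)])
      show "(\<Sum>i<r. p' i) < (\<Sum>i<r. p i)" by (simp add: sum)
      show "strict_mono_on {..<r} p'"
        unfolding strict_mono_on_def p'_def comp_def
        using mono1 no_a by (auto intro!: transpose_adjacent_less)
      show "strict_mono_on {r..<n} p'"
        unfolding strict_mono_on_def p'_def comp_def
        using mono2 no_Suc_a by (auto intro!: transpose_adjacent_less)
    qed
    moreover have "permutation p" using permutation_permutes less.prems(1) by blast
    then have "sign p' = - sign p"
      unfolding p'_def by (simp add: sign_compose permutation_swap_id sign_swap_id)
    ultimately show ?thesis by (simp add: sum)
  qed
qed

text \<open>
  A choice of rows becomes a shuffle when the remaining rows are enumerated after it.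
\<close>

lemma strict_mono_extend_to_shuffle:
  fixes rs :: "nat \<Rightarrow> nat"
  assumes mono: "strict_mono_on {..<r} rs" and bound: "\<And>i. i < r \<Longrightarrow> rs i < n"
  obtains p where "p permutes {0..<n}" "\<And>i. i < r \<Longrightarrow> p i = rs i"
    "strict_mono_on {..<r} p" "strict_mono_on {r..<n} p" "r \<le> n"
proof -
  define C where "C = {0..<n} - rs ` {..<r}"
  define p where "p i = (if i < r then rs i else if i < n then enumerate C (i - r) else i)" for i
  have inj: "inj_on rs {..<r}" using mono by (rule strict_mono_on_imp_inj_on)
  have sub: "rs ` {..<r} \<subseteq> {0..<n}" using bound by auto
  have rn: "r \<le> n" using card_mono[OF _ sub] by (simp add: card_image[OF inj])
  have C: "finite C" "card C = n - r"
    unfolding C_def using sub by (auto simp: card_Diff_subset card_image[OF inj])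
  have "bij_betw rs {..<r} (rs ` {..<r})" using inj by (simp add: bij_betw_def)
  then have b1: "bij_betw p {..<r} (rs ` {..<r})"
    by (rule bij_betw_cong[THEN iffD1, rotated]) (simp add: p_def)
  have "bij_betw (\<lambda>i. i - r) {r..<n} {..<n - r}"
    by (rule bij_betw_byWitness[where f' = "\<lambda>i. i + r"]) auto
  then have "bij_betw (enumerate C \<circ> (\<lambda>i. i - r)) {r..<n} C"
    using finite_bij_enumerate[OF C(1)] C(2) by (auto intro: bij_betw_trans)
  then have b2: "bij_betw p {r..<n} C"
    by (rule bij_betw_cong[THEN iffD1, rotated]) (auto simp: p_def)
  have "bij_betw p ({..<r} \<union> {r..<n}) (rs ` {..<r} \<union> C)"
    by (rule bij_betw_combine[OF b1 b2]) (auto simp: C_def)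
  moreover have "{..<r} \<union> {r..<n} = {0..<n}" "rs ` {..<r} \<union> C = {0..<n}"
    using rn sub by (auto simp: C_def)
  ultimately have "p permutes {0..<n}"
    using rn by (intro bij_imp_permutes) (auto simp: p_def)
  moreover have "strict_mono_on {r..<n} p"
    using C by (auto simp: strict_mono_on_def p_def intro!: finite_enumerate_mono)
  moreover have "strict_mono_on {..<r} p"
    using mono by (auto simp: strict_mono_on_def p_def)
  ultimately show ?thesis using that[of p] rn by (simp add: p_def)
qed

lemma minor_mult_square:
  "minor n (\<lambda>i j. \<Sum>k<n. A i k * B k j) (\<lambda>x. x) (\<lambda>x. x) = minor n A (\<lambda>x. x) (\<lambda>x. x) * minor n B (\<lambda>x. x) (\<lambda>x. x)"
proof -
  have "Matrix.mat n n (\<lambda>(i, j). \<Sum>k<n. A i k * B k j) =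
     Matrix.mat n n (\<lambda>(i, j). A i j) * Matrix.mat n n (\<lambda>(i, j). B i j)"
    by (rule eq_matI) (auto simp: scalar_prod_def atLeast0LessThan)
  then show ?thesis
    unfolding minor_def by (simp add: det_mult[where n = n])
qed

lemma minor_identity:
  assumes "\<And>i j. i < r \<Longrightarrow> j < r \<Longrightarrow> A (rs i) (cs j) = of_bool (i = j)"
  shows "minor r A rs cs = 1"
proof -
  have "Matrix.mat r r (\<lambda>(i, j). A (rs i) (cs j)) = 1\<^sub>m r"
    by (rule eq_matI) (auto simp: assms)
  then show ?thesis by (simp add: minor_def)
qed

text \<open>
  Let \<open>E\<close> have the chosen columns of \<open>B\<close> followed by the unit vectors of the rows that were not chosen.
  Up to the sign of \<open>p\<close> its determinant is the minor of \<open>B\<close>.  In \<open>A E\<close> the first columns become unit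
  vectors and the others columns of \<open>A\<close>, so up to the sign of \<open>q\<close> its determinant is the complementary
  minor of \<open>A\<close>.
\<close>

theorem Jacobi_complementary_minor:
  fixes A B :: "nat \<Rightarrow> nat \<Rightarrow> 'a::idom"
  assumes inv: "\<And>i k. i < n \<Longrightarrow> k < n \<Longrightarrow> (\<Sum>j<n. A i j * B j k) = of_bool (i = k)"
    and p: "p permutes {0..<n}" and q: "q permutes {0..<n}" and r: "r \<le> n"
  shows "minor (n - r) A (\<lambda>i. q (r + i)) (\<lambda>j. p (r + j)) =
    signof p * signof q * minor n A (\<lambda>x. x) (\<lambda>x. x) * minor r B p q"
proof -
  have p_eq: "p i = p j \<longleftrightarrow> i = j" and q_eq: "q i = q j \<longleftrightarrow> i = j" for i j
    using p q by (simp_all add: permutes_inj inj_eq)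
  have pn: "p i < n" and qn: "q i < n" if "i < n" for i
    using permutes_in_image[OF p, of i] permutes_in_image[OF q, of i] that by auto
  define E where "E i j = (if j < r then B i (q j) else of_bool (i = p j))" for i j
  define F where "F i j = (\<Sum>k<n. A i k * E k j)" for i j
  have F: "F i j = (if j < r then of_bool (i = q j) else A i (p j))" if "i < n" "j < n" for i j
  proof (cases "j < r")
    case False
    have "F i j = (\<Sum>k\<in>{p j}. A i k)"
      unfolding F_def E_def using False pn[OF that(2)]
      by (intro sum.mono_neutral_cong_right) auto
    then show ?thesis using False by simp
  qed (use inv[OF that(1) qn[OF that(2)]] in \<open>simp add: F_def E_def\<close>)
  have "signof p * minor n E (\<lambda>x. x) (\<lambda>x. x) = minor n E p (\<lambda>x. x)"
    using minor_permute_rows[OF p, of E "\<lambda>x. x" "\<lambda>x. x"] by simp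
  also have "\<dots> = minor r E p (\<lambda>x. x) * minor (n - r) E (\<lambda>i. p (r + i)) (\<lambda>j. r + j)"
    by (rule minor_block_lower[OF r]) (auto simp: E_def p_eq)
  also have "minor (n - r) E (\<lambda>i. p (r + i)) (\<lambda>j. r + j) = 1"
    by (rule minor_identity) (auto simp: E_def p_eq)
  also have "minor r E p (\<lambda>x. x) = minor r B p q"
    by (rule minor_cong) (simp add: E_def)
  finally have detE: "signof p * minor n E (\<lambda>x. x) (\<lambda>x. x) = minor r B p q"
    by (simp only: mult_1_right)
  have "minor (n - r) A (\<lambda>i. q (r + i)) (\<lambda>j. p (r + j)) =
     minor (n - r) F (\<lambda>i. q (r + i)) (\<lambda>j. r + j)"
    by (rule minor_cong) (simp add: F qn)
  also have "\<dots> = minor r F q (\<lambda>x. x) * minor (n - r) F (\<lambda>i. q (r + i)) (\<lambda>j. r + j)"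
    using r by (subst minor_identity[of r F q "\<lambda>x. x"]) (auto simp: F qn q_eq)
  also have "\<dots> = minor n F q (\<lambda>x. x)"
    by (rule minor_block_upper[OF r, symmetric]) (use r in \<open>auto simp: F qn q_eq\<close>)
  also have "\<dots> = signof q * (minor n A (\<lambda>x. x) (\<lambda>x. x) * minor n E (\<lambda>x. x) (\<lambda>x. x))"
    using minor_permute_rows[OF q, of F "\<lambda>x. x" "\<lambda>x. x"] minor_mult_square[of n A E]
    by (simp add: F_def[abs_def])
  also have "minor n E (\<lambda>x. x) (\<lambda>x. x) = signof p * minor r B p q"
    unfolding detE[symmetric] by (simp add: sign_def)
  finally show ?thesis by (simp add: mult_ac)
qed

text \<open>
  The signs of the two shuffles in Jacobi's identity multiply to \<open>(-1)\<close> to the sum of all chosen row and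
  column indices, which is the sign that the checkerboard pattern gives to the minor.
\<close>

theorem totally_positive_signed_inverse:
  fixes A B :: "nat \<Rightarrow> nat \<Rightarrow> real"
  assumes TP: "totally_positive A"
    and lower: "\<And>i j. i < j \<Longrightarrow> A i j = 0"
    and diag: "\<And>i. 0 < A i i"
    and inv: "\<And>i k. (\<Sum>j\<le>i. A i j * B j k) = of_bool (i = k)"
  shows "totally_positive (\<lambda>i j. (-1) ^ (i + j) * B i j)"
proof (rule totally_positiveI)
  fix r and rs cs :: "nat \<Rightarrow> nat"
  assume mono: "strict_mono_on {..<r} rs" "strict_mono_on {..<r} cs"
  define n where "n = Suc ((\<Sum>i<r. rs i) + (\<Sum>i<r. cs i))"
  have "rs i < n" "cs i < n" if "i < r" for i
    unfolding n_def less_Suc_eq_le using that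
    by (auto intro: trans_le_add1 trans_le_add2 member_le_sum)
  note bound = this
  obtain p where p: "p permutes {0..<n}" "\<And>i. i < r \<Longrightarrow> p i = rs i"
      "strict_mono_on {..<r} p" "strict_mono_on {r..<n} p" and r: "r \<le> n"
    using strict_mono_extend_to_shuffle[OF mono(1) bound(1)] by blast
  obtain q where q: "q permutes {0..<n}" "\<And>i. i < r \<Longrightarrow> q i = cs i"
      "strict_mono_on {..<r} q" "strict_mono_on {r..<n} q"
    using strict_mono_extend_to_shuffle[OF mono(2) bound(2)] by blast
  have det: "0 < minor k A (\<lambda>x. x) (\<lambda>x. x)" for k
  proof (induction k)
    case (Suc k)
    have "minor (Suc k) A (\<lambda>x. x) (\<lambda>x. x) = minor k A (\<lambda>x. x) (\<lambda>x. x) * minor 1 A (\<lambda>i. k + i) (\<lambda>j. k + j)"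
      using minor_block_lower[of k "Suc k" A "\<lambda>x. x" "\<lambda>x. x"] lower by auto
    then show ?case using Suc diag by (simp add: minor_1)
  qed simp
  have inv': "(\<Sum>j<n. A i j * B j k) = of_bool (i = k)" if "i < n" for i k
  proof -
    have "(\<Sum>j<n. A i j * B j k) = (\<Sum>j\<le>i. A i j * B j k)"
      using that lower by (intro sum.mono_neutral_right) auto
    then show ?thesis using inv by simp
  qed
  have signs: "real_of_int (sign p) * real_of_int (sign q) = (-1) ^ ((\<Sum>i<r. rs i) + (\<Sum>i<r. cs i))"
  proof -
    have "(\<Sum>i<r. p i) = (\<Sum>i<r. rs i)" "(\<Sum>i<r. q i) = (\<Sum>i<r. cs i)"
      using p(2) q(2) by auto
    then show ?thesis
      using sign_shuffle[OF p(1) r p(3,4)] sign_shuffle[OF q(1) r q(3,4)]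
      by (simp add: power_add mult_ac flip: power_mult_distrib)
  qed
  have "0 \<le> minor (n - r) A (\<lambda>i. q (r + i)) (\<lambda>j. p (r + j))"
    unfolding nonneg_coeffs_real_def[symmetric]
    using p(4) q(4) by (intro totally_positiveD[OF TP])
      (auto simp: strict_mono_on_def less_diff_conv add.commute[of r])
  also have "\<dots> = minor n A (\<lambda>x. x) (\<lambda>x. x) * ((-1) ^ ((\<Sum>i<r. rs i) + (\<Sum>i<r. cs i)) * minor r B p q)"
    unfolding signs[symmetric] using Jacobi_complementary_minor[OF inv' p(1) q(1) r] by (simp add: mult_ac)
  finally have "0 \<le> (-1) ^ ((\<Sum>i<r. rs i) + (\<Sum>i<r. cs i)) * minor r B p q"
    using det[of n] by (simp add: zero_le_mult_iff)
  also have "minor r B p q = minor r B rs cs"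
    by (rule minor_cong) (simp add: p q)
  also have "(-1) ^ ((\<Sum>i<r. rs i) + (\<Sum>i<r. cs i)) * minor r B rs cs =
      minor r (\<lambda>i j. (-1) ^ i * B i j * (-1) ^ j) rs cs"
    by (simp add: minor_scale power_add power_sum)
  also have "\<dots> = minor r (\<lambda>i j. (-1) ^ (i + j) * B i j) rs cs"
    by (rule minor_cong) (simp add: power_add mult_ac)
  finally show "nonneg_coeffs (minor r (\<lambda>i j. (-1) ^ (i + j) * B i j) rs cs)"
    by (simp add: nonneg_coeffs_real_def)
qed

section \<open>Positive semidefiniteness from principal minors\<close>

text \<open>
  Elimination with the pivot \<open>A 0 0\<close>: the matrix \<open>L\<close> below is unipotent, and \<open>M\<close> is the matrix after
  elimination, with zeros below the pivot.
\<close>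

lemma minor_schur_complement:
  fixes A :: "nat \<Rightarrow> nat \<Rightarrow> 'a::field"
  assumes "A 0 0 \<noteq> 0"
  shows "minor (Suc r) A (case_nat 0 (\<lambda>i. Suc (rs i))) (case_nat 0 (\<lambda>j. Suc (cs j))) =
    A 0 0 * minor r (\<lambda>i j. A (Suc i) (Suc j) - A (Suc i) 0 * A 0 (Suc j) / A 0 0) rs cs"
proof -
  define t u where "t = case_nat 0 (\<lambda>i. Suc (rs i))" and "u = case_nat 0 (\<lambda>j. Suc (cs j))"
  define L where "L i k = (of_bool (i = k) + of_bool (k = 0 \<and> 0 < i) * (A (t i) 0 / A 0 0))" for i k :: nat
  define M where "M k j = A (t k) (u j) - of_bool (0 < k) * (A (t k) 0 / A 0 0) * A 0 (u j)" for k j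
  have t0: "t 0 = 0" "u 0 = 0" by (simp_all add: t_def u_def)
  have LM: "A (t i) (u j) = (\<Sum>k<Suc r. L i k * M k j)" if "i < Suc r" for i j
  proof (cases "i = 0")
    case True
    have "(\<Sum>k<Suc r. L i k * M k j) = (\<Sum>k\<in>{0}. L i k * M k j)"
      using True by (intro sum.mono_neutral_right) (auto simp: L_def)
    then show ?thesis using True by (simp add: L_def M_def)
  next
    case False
    have "(\<Sum>k<Suc r. L i k * M k j) = (\<Sum>k\<in>{0, i}. L i k * M k j)"
      using False that by (intro sum.mono_neutral_right) (auto simp: L_def)
    then show ?thesis using False by (simp add: L_def M_def t0)
  qed
  have "minor (Suc r) A t u = minor (Suc r) (\<lambda>i j. \<Sum>k<Suc r. L i k * M k j) (\<lambda>x. x) (\<lambda>x. x)"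
    by (rule minor_cong) (simp add: LM)
  also have "\<dots> = minor (Suc r) L (\<lambda>x. x) (\<lambda>x. x) * minor (Suc r) M (\<lambda>x. x) (\<lambda>x. x)"
    by (rule minor_mult_square)
  also have "minor (Suc r) L (\<lambda>x. x) (\<lambda>x. x) = 1"
  proof -
    have "minor (Suc r) L (\<lambda>x. x) (\<lambda>x. x) = minor 1 L (\<lambda>x. x) (\<lambda>x. x) * minor r L (\<lambda>i. 1 + i) (\<lambda>j. 1 + j)"
      using minor_block_lower[of 1 "Suc r" L "\<lambda>x. x" "\<lambda>x. x"] by (simp add: L_def)
    then show ?thesis
      by (simp add: minor_1 L_def minor_identity)
  qed
  also have "minor (Suc r) M (\<lambda>x. x) (\<lambda>x. x) = minor 1 M (\<lambda>x. x) (\<lambda>x. x) * minor r M (\<lambda>i. 1 + i) (\<lambda>j. 1 + j)"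
    using minor_block_upper[of 1 "Suc r" M "\<lambda>x. x" "\<lambda>x. x"] assms by (simp add: M_def t0)
  also have "minor 1 M (\<lambda>x. x) (\<lambda>x. x) = A 0 0" by (simp add: minor_1 M_def t0)
  also have "minor r M (\<lambda>i. 1 + i) (\<lambda>j. 1 + j) =
     minor r (\<lambda>i j. A (Suc i) (Suc j) - A (Suc i) 0 * A 0 (Suc j) / A 0 0) rs cs"
    by (rule minor_cong) (simp add: M_def t_def u_def)
  finally show ?thesis by (simp add: t_def u_def)
qed

text \<open>
  Induction on the size.  If the pivot \<open>A 0 0\<close> is positive, completing the square leaves the quadratic
  form of the Schur complement, whose principal minors are quotients of those of \<open>A\<close>.  If it is zero,
  the minors of order 2 show that its whole row vanishes.
\<close>

lemma psd_of_principal_minors: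
  fixes A :: "nat \<Rightarrow> nat \<Rightarrow> real"
  assumes "\<And>i j. A i j = A j i"
    and "\<And>r ss. strict_mono_on {..<r} ss \<Longrightarrow> 0 \<le> minor r A ss ss"
  shows "0 \<le> (\<Sum>i<n. \<Sum>j<n. c i * c j * A i j)"
  using assms
proof (induction n arbitrary: A c)
  case (Suc n)
  note sym = Suc.prems(1) and princ = Suc.prems(2)
  have split: "(\<Sum>i<Suc n. \<Sum>j<Suc n. c i * c j * A i j) = c 0 * c 0 * A 0 0 +
      2 * c 0 * (\<Sum>j<n. c (Suc j) * A 0 (Suc j)) + (\<Sum>i<n. \<Sum>j<n. c (Suc i) * c (Suc j) * A (Suc i) (Suc j))"
    unfolding sum.lessThan_Suc_shift
    by (simp add: sum.distrib sum_distrib_left sym[of "Suc _" 0] mult_ac)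
  have A00: "0 \<le> A 0 0" using princ[of 1 id] by (simp add: minor_1 strict_mono_on_lessThan_iff)
  show ?case
  proof (cases "A 0 0 = 0")
    case True
    have zero: "A 0 (Suc j) = 0" for j
    proof -
      have "0 \<le> minor 2 A (case_nat 0 (\<lambda>_. Suc j)) (case_nat 0 (\<lambda>_. Suc j))"
        by (rule princ) (auto simp: strict_mono_on_def split: nat.splits)
      then show ?thesis
        using True sym[of "Suc j" 0] by (auto simp: minor_2 mult_le_0_iff)
    qed
    have "0 \<le> (\<Sum>i<n. \<Sum>j<n. c (Suc i) * c (Suc j) * A (Suc i) (Suc j))"
    proof (rule Suc.IH[of "\<lambda>i j. A (Suc i) (Suc j)" "\<lambda>i. c (Suc i)"])
      show "0 \<le> minor r (\<lambda>i j. A (Suc i) (Suc j)) ss ss" if "strict_mono_on {..<r} ss" for r ss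
        using princ[of r "\<lambda>i. Suc (ss i)"] that by (simp add: minor_def strict_mono_on_def)
    qed (rule sym)
    then show ?thesis unfolding split by (simp add: True zero)
  next
    case False
    define S where "S i j = A (Suc i) (Suc j) - A (Suc i) 0 * A 0 (Suc j) / A 0 0" for i j
    have "0 \<le> (\<Sum>i<n. \<Sum>j<n. c (Suc i) * c (Suc j) * S i j)"
    proof (rule Suc.IH[of S "\<lambda>i. c (Suc i)"])
      show "S i j = S j i" for i j
        unfolding S_def using sym by (simp add: mult.commute)
      show "0 \<le> minor r S ss ss" if "strict_mono_on {..<r} ss" for r ss
      proof -
        have "0 \<le> minor (Suc r) A (case_nat 0 (\<lambda>i. Suc (ss i))) (case_nat 0 (\<lambda>i. Suc (ss i)))"
          using that by (intro princ) (auto simp: strict_mono_on_def split: nat.splits)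
        then show ?thesis
          using minor_schur_complement[where A = A and r = r and rs = ss and cs = ss, OF False] A00 False
          by (simp add: S_def[abs_def] zero_le_mult_iff)
      qed
    qed
    also have "(\<Sum>i<n. \<Sum>j<n. c (Suc i) * c (Suc j) * S i j) =
       (\<Sum>i<n. \<Sum>j<n. c (Suc i) * c (Suc j) * A (Suc i) (Suc j)) -
       (\<Sum>j<n. c (Suc j) * A 0 (Suc j)) ^ 2 / A 0 0"
      by (simp add: S_def right_diff_distrib sum_subtractf power2_eq_square sum_product
          sum_divide_distrib sym[of "Suc _" 0] mult_ac)
    finally have "(\<Sum>j<n. c (Suc j) * A 0 (Suc j)) ^ 2 / A 0 0 \<le>
       (\<Sum>i<n. \<Sum>j<n. c (Suc i) * c (Suc j) * A (Suc i) (Suc j))" by simp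
    moreover have "0 \<le> (c 0 * A 0 0 + (\<Sum>j<n. c (Suc j) * A 0 (Suc j))) ^ 2 / A 0 0"
      using A00 by simp
    moreover have "(c 0 * A 0 0 + X) ^ 2 / A 0 0 = c 0 * c 0 * A 0 0 + 2 * c 0 * X + X ^ 2 / A 0 0" for X
      using False by (simp add: field_simps power2_eq_square)
    ultimately show ?thesis unfolding split by simp
  qed
qed simp

lemma coeffwise_SM_imp_psd:
  fixes a :: "nat \<Rightarrow> real"
  assumes "coeffwise_SM a"
  shows "0 \<le> (\<Sum>i<n. \<Sum>j<n. c i * c j * a (i + j))"
    and "0 \<le> (\<Sum>i<n. \<Sum>j<n. c i * c j * a (Suc (i + j)))"
proof -
  show "0 \<le> (\<Sum>i<n. \<Sum>j<n. c i * c j * a (i + j))"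
    using totally_positiveD[OF assms[unfolded coeffwise_SM_def]]
    by (intro psd_of_principal_minors) (auto simp: add.commute nonneg_coeffs_real_def)
  have "totally_positive (\<lambda>i j. a (Suc (i + j)))"
    using totally_positive_submatrix[OF assms[unfolded coeffwise_SM_def], of Suc id]
    by (simp add: strict_mono_def)
  then show "0 \<le> (\<Sum>i<n. \<Sum>j<n. c i * c j * a (Suc (i + j)))"
    using totally_positiveD[of "\<lambda>i j. a (Suc (i + j))"]
    by (intro psd_of_principal_minors) (auto simp: add.commute nonneg_coeffs_real_def)
qed

section \<open>Gauss quadrature\<close>

lemma linear_factors_dvd:
  fixes p :: "'a::idom poly"
  assumes "finite A" "\<And>x. x \<in> A \<Longrightarrow> poly p x = 0"
  shows "(\<Prod>x\<in>A. [:-x, 1:]) dvd p"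
  using assms
proof (induction A arbitrary: p rule: finite_induct)
  case (insert x A)
  obtain s where s: "p = [:-x, 1:] * s"
    using insert.prems[of x] by (auto simp: poly_eq_0_iff_dvd)
  have "poly s y = 0" if "y \<in> A" for y
    using insert.prems[of y] insert.hyps that by (auto simp: s)
  then have "(\<Prod>x\<in>A. [:-x, 1:]) dvd s" by (rule insert.IH)
  then show ?case
    unfolding s using insert.hyps by (simp add: mult_dvd_mono del: mult_pCons_left)
qed simp

text \<open>
  A complex root \<open>z\<close> that is not real contributes the quadratic factor \<open>(x - z)(x - cnj z)\<close>; the
  remainder of the division by it is a real linear polynomial vanishing at \<open>z\<close>, hence zero.
\<close>

lemma real_poly_linear_or_quadratic_factor:
  fixes r :: "real poly"
  assumes "degree r \<noteq> 0"
  shows "(\<exists>x. poly r x = 0) \<or> (\<exists>a b. b \<noteq> 0 \<and> [:a\<^sup>2 + b\<^sup>2, - 2 * a, 1:] dvd r)"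
proof -
  let ?c = "map_poly complex_of_real"
  have c_add: "?c (p + q) = ?c p + ?c q" for p q by (rule poly_eqI) (simp add: coeff_map_poly)
  have c_mult: "?c (p * q) = ?c p * ?c q" for p q
    by (rule poly_eqI) (simp add: coeff_map_poly coeff_mult)
  have c_eval: "poly (?c p) (complex_of_real x) = complex_of_real (poly p x)" for p x
    by (induction p) (simp_all add: map_poly_pCons)
  have "degree (?c r) \<noteq> 0" using assms by (simp add: degree_map_poly)
  then obtain z where z: "poly (?c r) z = 0"
    using fundamental_theorem_of_algebra[of "?c r"] by (auto simp: constant_degree)
  show ?thesis
  proof (cases "Im z = 0")
    case True
    then have "z = complex_of_real (Re z)" by (simp add: complex_eq_iff)
    then have "complex_of_real (poly r (Re z)) = 0"
      using z c_eval by metis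
    then show ?thesis by auto
  next
    case False
    define Q where "Q = [:(Re z)\<^sup>2 + (Im z)\<^sup>2, - 2 * Re z, 1:]"
    have Qz: "poly (?c Q) z = 0"
      by (simp add: Q_def map_poly_pCons complex_eq_iff power2_eq_square algebra_simps)
    define u v where "u = coeff (r mod Q) 0" and "v = coeff (r mod Q) 1"
    have "degree (r mod Q) < 2"
      using degree_mod_less[of Q r] by (auto simp: Q_def)
    then have uv: "r mod Q = [:u, v:]"
      by (intro poly_eqI) (auto simp: u_def v_def coeff_pCons coeff_eq_0 split: nat.split)
    have "?c r = ?c (r div Q) * ?c Q + ?c (r mod Q)"
      by (metis div_mult_mod_eq c_add c_mult)
    then have "poly (?c (r mod Q)) z = 0" using z Qz by simp
    then have "u + v * Re z = 0" "v * Im z = 0"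
      using False by (auto simp: uv map_poly_pCons complex_eq_iff mult.commute)
    then have "r mod Q = 0" using False by (simp add: uv)
    then have "Q dvd r" by auto
    then show ?thesis using False unfolding Q_def by blast
  qed
qed

text \<open>
  A functional on polynomials that is strictly positive on squares and on squares times \<open>x\<close>, up to the
  degree that an \<open>n\<close>-point quadrature can see.
\<close>

locale positive_functional =
  fixes L :: "real poly \<Rightarrow> real" and n :: nat
  assumes L_add: "L (p + q) = L p + L q"
    and L_smult: "L (Polynomial.smult c p) = c * L p"
    and L_pos: "p \<noteq> 0 \<Longrightarrow> degree p < n \<Longrightarrow> 0 < L (p * p)"
    and L_pos_X: "p \<noteq> 0 \<Longrightarrow> degree p < n \<Longrightarrow> 0 < L ([:0, 1:] * p * p)"
begin

lemma L_zero: "L 0 = 0"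
  using L_smult[of 0 0] by simp

lemma L_diff: "L (p - q) = L p - L q"
  using L_add[of "p - q" q] by simp

lemma L_sum: "L (sum f A) = (\<Sum>x\<in>A. L (f x))"
  by (induction A rule: infinite_finite_induct) (auto simp: L_zero L_add)

text \<open>
  Gram-Schmidt.  Orthogonality is stated for all \<open>q\<close> with vanishing coefficients from \<open>m\<close> on, which
  includes \<open>q = 0\<close> for \<open>m = 0\<close>.
\<close>

lemma orthogonal_poly:
  "m \<le> n \<Longrightarrow> \<exists>p. degree p = m \<and> lead_coeff p = 1 \<and> (\<forall>q. (\<forall>i\<ge>m. coeff q i = 0) \<longrightarrow> L (p * q) = 0)"
proof (induction m rule: less_induct)
  case (less m)
  define P where "P k = (SOME p. degree p = k \<and> lead_coeff p = 1 \<and>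
      (\<forall>q. (\<forall>i\<ge>k. coeff q i = 0) \<longrightarrow> L (p * q) = 0))" for k
  have P: "degree (P k) = k" "lead_coeff (P k) = 1"
      "\<And>q. (\<forall>i\<ge>k. coeff q i = 0) \<Longrightarrow> L (P k * q) = 0" if "k < m" for k
    using someI_ex[OF less.IH[of k]] that less.prems unfolding P_def[symmetric] by auto
  have orth: "L (P j * P k) = 0" if "j < m" "k < m" "j \<noteq> k" for j k
  proof (cases "k < j")
    case True
    then show ?thesis using that P(1)[of k] by (intro P(3)) (auto intro: coeff_eq_0)
  next
    case False
    then have "L (P k * P j) = 0" using that P(1)[of j] by (intro P(3)) (auto intro: coeff_eq_0)
    then show ?thesis by (simp add: mult.commute)
  qed
  have norm: "0 < L (P k * P k)" if "k < m" for k
    using P(1,2)[OF that] that less.prems by (intro L_pos) auto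
  define c where "c j = L (monom 1 m * P j) / L (P j * P j)" for j
  define p where "p = monom 1 m - (\<Sum>j<m. Polynomial.smult (c j) (P j))"
  have coeff_p: "coeff p i = coeff (monom 1 m) i" if "m \<le> i" for i
    using that P(1) by (auto simp: p_def coeff_sum intro!: sum.neutral coeff_eq_0)
  have deg: "degree p = m"
  proof (rule antisym)
    show "degree p \<le> m" by (rule degree_le) (simp add: coeff_p)
    show "m \<le> degree p" by (rule le_degree) (simp add: coeff_p)
  qed
  have p_P: "L (p * P k) = 0" if k: "k < m" for k
  proof -
    have "L (p * P k) = L (monom 1 m * P k) - (\<Sum>j<m. c j * L (P j * P k))"
      by (simp add: p_def left_diff_distrib sum_distrib_right L_diff L_sum L_smult)
    also have "(\<Sum>j<m. c j * L (P j * P k)) = (\<Sum>j\<in>{k}. c j * L (P j * P k))"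
      using k by (intro sum.mono_neutral_right) (auto simp: orth)
    finally show ?thesis using norm[OF k] by (simp add: c_def)
  qed
  have p_orth: "d \<le> m \<Longrightarrow> \<forall>i\<ge>d. coeff q i = 0 \<Longrightarrow> L (p * q) = 0" for d q
  proof (induction d arbitrary: q)
    case 0
    then have "q = 0" by (intro poly_eqI) auto
    then show ?case by (simp add: L_zero)
  next
    case (Suc d)
    have "L (p * (q - Polynomial.smult (coeff q d) (P d))) = 0"
    proof (rule Suc.IH)
      show "\<forall>i\<ge>d. coeff (q - Polynomial.smult (coeff q d) (P d)) i = 0"
      proof (intro allI impI)
        fix i assume "d \<le> i"
        then show "coeff (q - Polynomial.smult (coeff q d) (P d)) i = 0"
          using Suc.prems P(1,2)[of d] by (cases "i = d") (auto simp: coeff_eq_0)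
      qed
    qed (use Suc.prems in auto)
    then show ?case using p_P[of d] Suc.prems by (simp add: right_diff_distrib L_diff L_smult)
  qed
  show ?case
    using deg coeff_p[of m] p_orth[of m] by (intro exI[of _ p]) auto
qed

text \<open>
  The nodes are the roots of the orthogonal polynomial \<open>p\<close> of degree \<open>n\<close>.  If \<open>p = d s\<close> with a factor \<open>d\<close>
  of positive degree, then \<open>L (d s\<^sup>2) = L (p s) = 0\<close> by orthogonality; but \<open>L (d s\<^sup>2)\<close> would be positive
  for \<open>d = x - a\<close> with \<open>a \<le> 0\<close>, for \<open>d = (x - a)\<^sup>2\<close> and for \<open>d = (x - a)\<^sup>2 + b\<^sup>2\<close> with \<open>b \<noteq> 0\<close>.  So \<open>p\<close> has
  \<open>n\<close> distinct positive roots.  Division by \<open>p\<close> and Lagrange interpolation of the remainder give a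
  formula that is exact below degree \<open>2 n\<close>, and its weights are the values of \<open>L\<close> at the squares of
  the Lagrange polynomials.
\<close>

theorem Gauss_quadrature:
  assumes n: "0 < n"
  obtains R w where "finite R" "\<And>x. x \<in> R \<Longrightarrow> 0 < x" "\<And>x. x \<in> R \<Longrightarrow> 0 \<le> w x"
    "\<And>h. degree h < 2 * n \<Longrightarrow> L h = (\<Sum>x\<in>R. w x * poly h x)"
proof -
  obtain p where deg: "degree p = n" and lead: "lead_coeff p = 1"
    and orth: "\<And>q. \<forall>i\<ge>n. coeff q i = 0 \<Longrightarrow> L (p * q) = 0"
    using orthogonal_poly[of n] by auto
  have p0: "p \<noteq> 0" using deg n by auto
  have orth': "L (p * q) = 0" if "degree q < n" for q
    using that by (intro orth) (auto intro: coeff_eq_0)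
  have no_factor: False
    if "p = d * s" "d \<noteq> 0" "0 < degree d" "L (d * s * s) > 0" for d s
  proof -
    have "degree s < n" using that p0 by (auto simp: deg[symmetric] degree_mult_eq)
    then have "L (p * s) = 0" by (rule orth')
    then show False using that by (simp add: mult_ac)
  qed
  have root_pos: "0 < x" if x: "poly p x = 0" for x
  proof (rule ccontr)
    assume "\<not> 0 < x"
    obtain s where s: "p = [:-x, 1:] * s" using x by (auto simp: poly_eq_0_iff_dvd)
    have s0: "s \<noteq> 0" using p0 s by auto
    have ds: "degree s < n"
      using s0 unfolding deg[symmetric] s by (simp add: degree_mult_eq del: mult_pCons_left)
    have "[:-x, 1:] * s * s = [:0, 1:] * s * s - Polynomial.smult x (s * s)"
      by (simp add: algebra_simps)
    then have "L ([:-x, 1:] * s * s) = L ([:0, 1:] * s * s) - x * L (s * s)"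
      by (simp only: L_diff L_smult)
    moreover have "x * L (s * s) \<le> 0"
      using \<open>\<not> 0 < x\<close> L_pos[OF s0 ds] by (simp add: mult_nonpos_nonneg)
    ultimately have "0 < L ([:-x, 1:] * s * s)" using L_pos_X[OF s0 ds] by linarith
    then show False using no_factor[OF s] by simp
  qed
  have square_free: "\<not> [:-x, 1:] * [:-x, 1:] dvd p" for x
  proof
    assume "[:-x, 1:] * [:-x, 1:] dvd p"
    then obtain s where s: "p = ([:-x, 1:] * [:-x, 1:]) * s" by (rule dvdE)
    have s0: "s \<noteq> 0" using p0 s by auto
    have "degree ([:-x, 1:] * s) < n"
      using s0 unfolding deg[symmetric] s by (simp add: degree_mult_eq del: mult_pCons_left)
    then have "0 < L (([:-x, 1:] * s) * ([:-x, 1:] * s))" 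
      using s0 by (intro L_pos) (auto simp del: mult_pCons_left)
    also have "([:-x, 1:] * s) * ([:-x, 1:] * s) = ([:-x, 1:] * [:-x, 1:]) * s * s"
      by (simp only: mult_ac)
    finally show False
      by (intro no_factor[OF s]) (simp_all add: degree_mult_eq del: mult_pCons_left)
  qed
  have no_quadratic: "\<not> [:a\<^sup>2 + b\<^sup>2, - 2 * a, 1:] dvd p" if b: "b \<noteq> 0" for a b
  proof
    assume "[:a\<^sup>2 + b\<^sup>2, - 2 * a, 1:] dvd p"
    then obtain s where s: "p = [:a\<^sup>2 + b\<^sup>2, - 2 * a, 1:] * s" by (rule dvdE)
    have s0: "s \<noteq> 0" using p0 s by auto
    have ds: "degree s + 2 = n"
      using s0 unfolding deg[symmetric] s by (simp add: degree_mult_eq del: mult_pCons_left)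
    have das: "degree ([:-a, 1:] * s) < n" using ds s0 by (simp add: degree_mult_eq del: mult_pCons_left)
    have "(A * A + B) * s * s = (A * s) * (A * s) + B * (s * s)" for A B
      by (simp add: algebra_simps)
    moreover have "[:a\<^sup>2 + b\<^sup>2, - 2 * a, 1:] = [:-a, 1:] * [:-a, 1:] + [:b\<^sup>2:]"
      by (simp add: power2_eq_square)
    moreover have "[:b\<^sup>2:] * (s * s) = Polynomial.smult (b\<^sup>2) (s * s)" by simp
    ultimately have "[:a\<^sup>2 + b\<^sup>2, - 2 * a, 1:] * s * s =
        ([:-a, 1:] * s) * ([:-a, 1:] * s) + Polynomial.smult (b\<^sup>2) (s * s)"
      by metis
    then have "L ([:a\<^sup>2 + b\<^sup>2, - 2 * a, 1:] * s * s) =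
        L (([:-a, 1:] * s) * ([:-a, 1:] * s)) + b\<^sup>2 * L (s * s)"
      by (simp only: L_add L_smult)
    moreover have "0 < L (([:-a, 1:] * s) * ([:-a, 1:] * s))" 
      using s0 das by (intro L_pos) (auto simp del: mult_pCons_left)
    moreover have "0 < b\<^sup>2 * L (s * s)" using L_pos[OF s0] ds b by simp
    ultimately have "0 < L ([:a\<^sup>2 + b\<^sup>2, - 2 * a, 1:] * s * s)" by linarith
    then show False by (intro no_factor[OF s]) simp_all
  qed
  define R where "R = {x. poly p x = 0}"
  have fin: "finite R" unfolding R_def using p0 by (rule poly_roots_finite)
  have "(\<Prod>x\<in>R. [:-x, 1:]) dvd p" using fin by (rule linear_factors_dvd) (simp add: R_def)
  then obtain r where r: "p = (\<Prod>x\<in>R. [:-x, 1:]) * r" by (rule dvdE)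
  have "degree r = 0"
  proof (rule ccontr)
    assume "degree r \<noteq> 0"
    then consider x where "poly r x = 0" | a b where "b \<noteq> 0" "[:a\<^sup>2 + b\<^sup>2, - 2 * a, 1:] dvd r"
      using real_poly_linear_or_quadratic_factor by blast
    then show False
    proof cases
      case 1
      then have "poly p x = 0" by (subst r) simp
      then have "x \<in> R" by (simp add: R_def)
      then have "[:-x, 1:] dvd (\<Prod>x\<in>R. [:-x, 1:])" using fin by (rule dvd_prodI[rotated])
      moreover have "[:-x, 1:] dvd r" using 1 by (simp add: poly_eq_0_iff_dvd)
      ultimately show False using square_free[of x] by (subst (asm) r) (simp only: mult_dvd_mono not_True_eq_False)
    next
      case 2
      then have "[:a\<^sup>2 + b\<^sup>2, - 2 * a, 1:] dvd p" by (subst r) (rule dvd_mult)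
      then show False using no_quadratic 2 by blast
    qed
  qed
  moreover have "r \<noteq> 0" "(\<Prod>x\<in>R. [:-x, 1:]) \<noteq> 0" using p0 r by auto
  moreover have "degree (\<Prod>x\<in>R. [:-x, 1::real:]) = card R"
    by (subst degree_prod_eq_sum_degree) auto
  ultimately have card: "card R = n"
    unfolding deg[symmetric] by (subst r) (simp add: degree_mult_eq)
  define l where "l x = (\<Prod>y\<in>R - {x}. Polynomial.smult (1 / (x - y)) [:-y, 1:])" for x
  have deg_l: "degree (l x) < n" if "x \<in> R" for x
  proof -
    have "degree (l x) \<le> (\<Sum>y\<in>R - {x}. degree (Polynomial.smult (1 / (x - y)) [:-y, 1:]))"
      unfolding l_def using fin by (intro degree_prod_sum_le[unfolded comp_def]) auto
    also have "\<dots> \<le> (\<Sum>y\<in>R - {x}. 1)" by (intro sum_mono) auto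
    also have "\<dots> < n" using that fin card n by simp
    finally show ?thesis .
  qed
  have l_eq: "poly (l x) y = of_bool (x = y)" if "x \<in> R" "y \<in> R" for x y
  proof (cases "x = y")
    case True
    then show ?thesis
      unfolding l_def poly_prod by (auto intro!: prod.neutral simp flip: diff_divide_distrib)
  next
    case False
    then show ?thesis
      unfolding l_def poly_prod using that fin by (auto intro!: prod_zero bexI[of _ y])
  qed
  have interp: "h = (\<Sum>x\<in>R. Polynomial.smult (poly h x) (l x))" if "degree h < n" for h
  proof (rule poly_eqI_degree[where A = R])
    fix y assume y: "y \<in> R"
    have "(\<Sum>x\<in>R. poly h x * poly (l x) y) = (\<Sum>x\<in>{y}. poly h x * poly (l x) y)"
      using fin y by (intro sum.mono_neutral_right) (auto simp: l_eq)
    then show "poly h y = poly (\<Sum>x\<in>R. Polynomial.smult (poly h x) (l x)) y"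
      using y by (simp add: poly_sum l_eq)
  next
    show "degree h < card R" using that card by simp
    have "degree (\<Sum>x\<in>R. Polynomial.smult (poly h x) (l x)) \<le> n - 1"
    proof (rule degree_sum_le[OF fin])
      fix x assume "x \<in> R"
      then have "degree (l x) \<le> n - 1" using deg_l[of x] by simp
      then show "degree (Polynomial.smult (poly h x) (l x)) \<le> n - 1" by (rule order_trans[OF degree_smult_le])
    qed
    then show "degree (\<Sum>x\<in>R. Polynomial.smult (poly h x) (l x)) < card R" using card n by simp
  qed
  have exact: "L h = (\<Sum>x\<in>R. L (l x) * poly h x)" if h: "degree h < 2 * n" for h
  proof -
    define s t where "s = h div p" and "t = h mod p"
    have hst: "h = p * s + t" by (simp add: s_def t_def)
    have "t = 0 \<or> degree t < n" unfolding t_def using degree_mod_less[of p h] p0 deg by auto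
    then have dt: "degree t < n" using n by auto
    have ds: "degree s < n"
    proof (cases "s = 0")
      case False
      have "degree (p * s) = degree (h - t)" by (simp add: hst)
      also have "\<dots> < 2 * n" using h dt by (intro degree_diff_less) auto
      finally show ?thesis using False p0 deg by (simp add: degree_mult_eq)
    qed (use n in auto)
    have "L h = L t" by (simp add: hst L_add orth'[OF ds])
    also have "\<dots> = (\<Sum>x\<in>R. poly t x * L (l x))"
      by (subst interp[OF dt]) (simp add: L_sum L_smult)
    also have "\<dots> = (\<Sum>x\<in>R. L (l x) * poly h x)"
      by (intro sum.cong) (auto simp: hst R_def)
    finally show ?thesis .
  qed
  have weight: "0 \<le> L (l x)" if x: "x \<in> R" for x
  proof -
    have l0: "l x \<noteq> 0" using l_eq[OF x x] by auto
    have "degree (l x * l x) < 2 * n"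
      using deg_l[OF x] l0 by (simp add: degree_mult_eq)
    then have "L (l x * l x) = (\<Sum>y\<in>R. L (l y) * poly (l x * l x) y)" by (rule exact)
    also have "\<dots> = (\<Sum>y\<in>{x}. L (l y) * poly (l x * l x) y)"
      using fin x by (intro sum.mono_neutral_right) (auto simp: l_eq)
    also have "\<dots> = L (l x)" using x by (simp add: l_eq)
    finally show ?thesis using L_pos[OF l0 deg_l[OF x]] by simp
  qed
  show ?thesis
    by (rule that[of R "\<lambda>x. L (l x)"]) (use fin root_pos weight exact in \<open>auto simp: R_def\<close>)
qed

end

section \<open>Limits of moments\<close>

lemma finite_support_distribution:
  fixes w :: "real \<Rightarrow> real"
  assumes fin: "finite R" and w: "\<And>x. x \<in> R \<Longrightarrow> 0 \<le> w x" and one: "(\<Sum>x\<in>R. w x) = 1"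
    and R: "\<And>x. x \<in> R \<Longrightarrow> 0 < x"
  shows "\<exists>M. real_distribution M \<and> (AE x in M. 0 \<le> x) \<and>
    (\<forall>f :: real \<Rightarrow> real. f \<in> borel_measurable borel \<longrightarrow>
       integrable M f \<and> (LINT x|M. f x) = (\<Sum>x\<in>R. w x * f x))"
proof -
  define v where "v x = (if x \<in> R then w x else 0)" for x
  have v0: "0 \<le> v x" for x using w by (simp add: v_def)
  have "(\<integral>\<^sup>+ x. ennreal (v x) \<partial>count_space UNIV) = (\<integral>\<^sup>+ x. ennreal (v x) \<partial>count_space R)"
    by (subst nn_integral_count_space_indicator)
       (auto intro!: nn_integral_cong simp: v_def split: split_indicator)
  also have "\<dots> = ennreal (\<Sum>x\<in>R. v x)"
    using fin v0 by (subst nn_integral_count_space_finite) (auto simp: sum_ennreal)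
  also have "(\<Sum>x\<in>R. v x) = 1" using one by (simp add: v_def)
  finally have v1: "(\<integral>\<^sup>+ x. ennreal (v x) \<partial>count_space UNIV) = 1" by simp
  define p where "p = embed_pmf v"
  have pmf_p: "pmf p x = v x" for x unfolding p_def using v0 v1 by (rule pmf_embed_pmf)
  have supp: "set_pmf p \<subseteq> R" by (auto simp: set_pmf_eq pmf_p v_def)
  then have fin': "finite (set_pmf p)" using fin by (rule finite_subset)
  define M where "M = distr (measure_pmf p) borel (\<lambda>x. x)"
  show ?thesis
  proof (intro exI[of _ M] conjI allI impI)
    show "real_distribution M"
      unfolding M_def by (rule prob_space.real_distribution_distr[OF prob_space_measure_pmf]) simp
    show "AE x in M. 0 \<le> x"
      unfolding M_def using supp R by (subst AE_distr_iff) (auto simp: AE_measure_pmf_iff less_imp_le)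
    show "integrable M f" if "f \<in> borel_measurable borel" for f :: "real \<Rightarrow> real"
      unfolding M_def using that fin'
      by (subst integrable_distr_eq) (auto intro: integrable_measure_pmf_finite)
    show "(LINT x|M. f x) = (\<Sum>x\<in>R. w x * f x)" if "f \<in> borel_measurable borel" for f :: "real \<Rightarrow> real"
    proof -
      have "(LINT x|M. f x) = (LINT x|measure_pmf p. f x)"
        unfolding M_def using that by (subst integral_distr) auto
      also have "\<dots> = (\<Sum>x\<in>R. f x * pmf p x)"
        using fin supp by (intro integral_measure_pmf_real) auto
      finally show ?thesis by (simp add: pmf_p v_def mult.commute)
    qed
  qed
qed

lemma truncated_power_bounds:
  fixes x R :: real
  assumes "0 \<le> x" "0 < R"
  shows "(max 0 (min x R)) ^ k \<le> x ^ k" "x ^ k - x ^ Suc k / R \<le> (max 0 (min x R)) ^ k"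
proof -
  show "(max 0 (min x R)) ^ k \<le> x ^ k" using assms by (intro power_mono) auto
  show "x ^ k - x ^ Suc k / R \<le> (max 0 (min x R)) ^ k"
  proof (cases "x \<le> R")
    case True
    then show ?thesis using assms by (simp add: max_def min_def)
  next
    case False
    then have "x ^ k * 1 \<le> x ^ k * (x / R)"
      using assms by (intro mult_left_mono) (auto simp: field_simps)
    then have "x ^ k - x ^ Suc k / R \<le> 0" by (simp add: field_simps)
    also have "0 \<le> (max 0 (min x R)) ^ k" by simp
    finally show ?thesis .
  qed
qed

text \<open>
  Bounded first moments make the sequence tight, so that Helly's theorem gives a weakly convergent
  subsequence.  Weak convergence only controls bounded functions; a power \<open>x\<^sup>k\<close> truncated at \<open>R\<close> misses
  at most \<open>x\<^sup>k\<^sup>+\<^sup>1 / R\<close>, and the moments of order \<open>k + 1\<close> are bounded.  Letting \<open>R\<close> grow gives the moments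
  of the limit by monotone convergence.
\<close>

theorem moment_limit:
  fixes \<mu> :: "nat \<Rightarrow> real measure" and c :: "nat \<Rightarrow> real"
  assumes dist: "\<And>n. real_distribution (\<mu> n)"
    and pos: "\<And>n. AE x in \<mu> n. 0 \<le> x"
    and int: "\<And>n k. integrable (\<mu> n) (\<lambda>x. x ^ k)"
    and lim: "\<And>k. (\<lambda>n. LINT x|\<mu> n. x ^ k) \<longlonglongrightarrow> c k"
  obtains M where "real_distribution M" "AE x in M. 0 \<le> x"
    "\<And>k. integrable M (\<lambda>x. x ^ k)" "\<And>k. (LINT x|M. x ^ k) = c k"
proof -
  have "Bseq (\<lambda>n. LINT x|\<mu> n. x ^ 1)" using lim[of 1] by (intro convergent_imp_Bseq) (auto simp: convergent_def)
  then obtain B where B: "0 < B" "\<And>n. norm (LINT x|\<mu> n. x ^ 1) \<le> B" by (auto simp: Bseq_def)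
  have "tight \<mu>"
    unfolding tight_def
  proof (intro conjI allI impI)
    fix \<epsilon> :: real assume \<epsilon>: "0 < \<epsilon>"
    define R where "R = 2 * B / \<epsilon>"
    have R: "0 < R" using B \<epsilon> by (simp add: R_def)
    have "1 - \<epsilon> < measure (\<mu> n) {-1<..R}" for n
    proof -
      interpret real_distribution "\<mu> n" by (rule dist)
      have "measure (\<mu> n) {x \<in> space (\<mu> n). R \<le> x} \<le> (LINT x|\<mu> n. x) / R"
        using int[of n 1] pos[of n] R by (intro integral_Markov_inequality_measure[where A = "{}"]) auto
      also have "\<dots> \<le> B / R" using B(2)[of n] R by (intro divide_right_mono) auto
      also have "\<dots> < \<epsilon>" using B \<epsilon> by (simp add: R_def field_simps)
      finally have *: "prob {x. R \<le> x} < \<epsilon>" by simp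
      have "1 - prob {-1<..R} = prob (space (\<mu> n) - {-1<..R})" by (subst prob_compl) auto
      also have "\<dots> \<le> prob {x. R \<le> x}"
        using pos[of n] by (intro finite_measure_mono_AE) auto
      finally show ?thesis using * by simp
    qed
    moreover have "-1 < R" using R by simp
    ultimately show "\<exists>a b. a < b \<and> (\<forall>n. 1 - \<epsilon> < measure (\<mu> n) {a<..b})" by blast
  qed (rule dist)
  then obtain r M where r: "strict_mono r" and M: "real_distribution M" and weak: "weak_conv_m (\<mu> \<circ> id \<circ> r) M"
    using tight_imp_convergent_subsubsequence[of \<mu> id] by (auto simp: strict_mono_id)
  interpret M: real_distribution M by (rule M)
  define \<nu> where "\<nu> n = \<mu> (r n)" for n
  have \<nu>: "\<mu> \<circ> id \<circ> r = \<nu>" by (simp add: \<nu>_def fun_eq_iff)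
  have dist\<nu>: "real_distribution (\<nu> n)" for n by (simp add: \<nu>_def dist)
  have lim\<nu>: "(\<lambda>n. LINT x|\<nu> n. x ^ k) \<longlonglongrightarrow> c k" for k
    unfolding \<nu>_def using LIMSEQ_subseq_LIMSEQ[OF lim r] by (simp add: o_def)
  have conv: "(\<lambda>n. LINT x|\<nu> n. \<phi> x) \<longlonglongrightarrow> (LINT x|M. \<phi> x)"
    if "continuous_on UNIV \<phi>" "\<And>x. norm (\<phi> x) \<le> K" for \<phi> :: "real \<Rightarrow> real" and K
    using weak_conv_imp_integral_bdd_continuous_conv[OF dist\<nu> M weak[unfolded \<nu>], of \<phi> K] that
    by (auto simp: continuous_on_eq_continuous_at)
  have posM: "AE x in M. 0 \<le> x"
  proof -
    \<comment> \<open>a bounded continuous function that detects mass on the negative half-line\<close>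
    let ?\<psi> = "\<lambda>x::real. min 1 (max 0 (- x))"
    have "(\<lambda>n. LINT x|\<nu> n. ?\<psi> x) \<longlonglongrightarrow> (LINT x|M. ?\<psi> x)"
      by (rule conv[of _ 1]) (auto intro!: continuous_intros)
    moreover have "(LINT x|\<nu> n. ?\<psi> x) = 0" for n
    proof -
      have "AE x in \<nu> n. ?\<psi> x = 0" using pos[of "r n"] unfolding \<nu>_def by eventually_elim auto
      then show ?thesis by (rule integral_eq_zero_AE)
    qed
    ultimately have "(LINT x|M. ?\<psi> x) = 0" by (simp add: LIMSEQ_const_iff)
    moreover have "integrable M ?\<psi>" by (rule M.integrable_const_bound[where B = 1]) auto
    ultimately have "AE x in M. ?\<psi> x = 0"
      by (subst (asm) integral_nonneg_eq_0_iff_AE) auto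
    then show ?thesis by eventually_elim (auto simp: min_def max_def split: if_splits)
  qed
  define \<phi> where "\<phi> k R x = (max 0 (min x R)) ^ k" for k and R x :: real
  have \<phi>_cont: "continuous_on UNIV (\<phi> k R)" for k R
    unfolding \<phi>_def by (intro continuous_intros)
  have \<phi>_bound: "norm (\<phi> k R x) \<le> R ^ k" if "0 < R" for k R x
    unfolding \<phi>_def using that by (auto simp: norm_power intro!: power_mono)
  have J: "c k - c (Suc k) / R \<le> (LINT x|M. \<phi> k R x) \<and> (LINT x|M. \<phi> k R x) \<le> c k" if R: "0 < R" for k R
  proof -
    have lim_\<phi>: "(\<lambda>n. LINT x|\<nu> n. \<phi> k R x) \<longlonglongrightarrow> (LINT x|M. \<phi> k R x)"
      by (rule conv[OF \<phi>_cont \<phi>_bound[OF R]])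
    have bounds: "(LINT x|\<nu> n. x ^ k) - (LINT x|\<nu> n. x ^ Suc k) / R \<le> (LINT x|\<nu> n. \<phi> k R x) \<and>
        (LINT x|\<nu> n. \<phi> k R x) \<le> (LINT x|\<nu> n. x ^ k)" for n
    proof -
      interpret real_distribution "\<nu> n" by (rule dist\<nu>)
      have ik: "integrable (\<nu> n) (\<lambda>x. x ^ k)" for k using int by (simp add: \<nu>_def)
      have i\<phi>: "integrable (\<nu> n) (\<phi> k R)"
        using \<phi>_bound[OF R] borel_measurable_continuous_onI[OF \<phi>_cont]
        by (intro integrable_const_bound[where B = "R ^ k"]) auto
      have p: "AE x in \<nu> n. 0 \<le> x" unfolding \<nu>_def by (rule pos)
      have "(LINT x|\<nu> n. x ^ k) - (LINT x|\<nu> n. x ^ Suc k) / R = (LINT x|\<nu> n. x ^ k - x ^ Suc k / R)"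
        using ik[of k] ik[of "Suc k"] by (subst Bochner_Integration.integral_diff) auto
      also have "\<dots> \<le> (LINT x|\<nu> n. \<phi> k R x)"
      proof (rule integral_mono_AE)
        show "integrable (\<nu> n) (\<lambda>x. x ^ k - x ^ Suc k / R)" using ik[of k] ik[of "Suc k"] by auto
        show "AE x in \<nu> n. x ^ k - x ^ Suc k / R \<le> \<phi> k R x"
          using p by eventually_elim (unfold \<phi>_def, rule truncated_power_bounds(2)[OF _ R])
      qed (rule i\<phi>)
      finally have "(LINT x|\<nu> n. x ^ k) - (LINT x|\<nu> n. x ^ Suc k) / R \<le> (LINT x|\<nu> n. \<phi> k R x)" .
      moreover have "(LINT x|\<nu> n. \<phi> k R x) \<le> (LINT x|\<nu> n. x ^ k)"
      proof (rule integral_mono_AE)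
        show "AE x in \<nu> n. \<phi> k R x \<le> x ^ k"
          using p by eventually_elim (unfold \<phi>_def, rule truncated_power_bounds(1)[OF _ R])
      qed (rule i\<phi> ik)+
      ultimately show ?thesis ..
    qed
    have "(\<lambda>n. (LINT x|\<nu> n. x ^ k) - (LINT x|\<nu> n. x ^ Suc k) / R) \<longlonglongrightarrow> c k - c (Suc k) / R"
      using R by (intro tendsto_intros lim\<nu>) auto
    from LIMSEQ_le[OF this lim_\<phi>] have "c k - c (Suc k) / R \<le> (LINT x|M. \<phi> k R x)"
      using bounds by blast
    moreover have "(LINT x|M. \<phi> k R x) \<le> c k"
      using LIMSEQ_le[OF lim_\<phi> lim\<nu>] bounds by blast
    ultimately show ?thesis by simp
  qed
  have has_moment: "has_bochner_integral M (\<lambda>x. x ^ k) (c k)" for k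
  proof (rule has_bochner_integral_monotone_convergence)
    show "integrable M (\<phi> k (real (Suc i)))" for i
      using \<phi>_bound[of "real (Suc i)" k] borel_measurable_continuous_onI[OF \<phi>_cont]
      by (intro M.integrable_const_bound[where B = "real (Suc i) ^ k"]) auto
    show "AE x in M. mono (\<lambda>i. \<phi> k (real (Suc i)) x)"
      by (intro AE_I2 monoI) (auto simp: \<phi>_def intro!: power_mono)
    show "AE x in M. (\<lambda>i. \<phi> k (real (Suc i)) x) \<longlonglongrightarrow> x ^ k"
      using posM
    proof eventually_elim
      case (elim x)
      have "eventually (\<lambda>i. \<phi> k (real (Suc i)) x = x ^ k) sequentially"
        using eventually_ge_at_top[of "nat \<lceil>x\<rceil>"]
      proof eventually_elim
        case (elim i)
        then have "x \<le> real (Suc i)" by linarith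
        then show ?case using \<open>0 \<le> x\<close> by (simp add: \<phi>_def max_def min_def)
      qed
      then show ?case by (rule tendsto_eventually)
    qed
    show "(\<lambda>i. LINT x|M. \<phi> k (real (Suc i)) x) \<longlonglongrightarrow> c k"
    proof (rule tendsto_sandwich)
      show "(\<lambda>i. c k - c (Suc k) / real (Suc i)) \<longlonglongrightarrow> c k"
        by real_asymp
    qed (use J in auto)
    show "(\<lambda>x. x ^ k) \<in> borel_measurable M" by simp
  qed
  show ?thesis
    using that[OF M posM] has_moment by (auto simp: has_bochner_integral_iff)
qed

section \<open>The Stieltjes moment problem\<close>

definition moment_functional :: "(nat \<Rightarrow> real) \<Rightarrow> real poly \<Rightarrow> real" where
  "moment_functional a p = (\<Sum>i\<le>degree p. coeff p i * a i)"

lemma moment_functional_eq: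
  assumes "degree p \<le> N"
  shows "moment_functional a p = (\<Sum>i\<le>N. coeff p i * a i)"
  unfolding moment_functional_def using assms
  by (intro sum.mono_neutral_left) (auto simp: coeff_eq_0)

lemma moment_functional_add: "moment_functional a (p + q) = moment_functional a p + moment_functional a q"
proof -
  let ?N = "max (degree p) (degree q)"
  have "degree (p + q) \<le> ?N" by (rule degree_add_le_max)
  then show ?thesis
    by (simp add: moment_functional_eq[of _ ?N] sum.distrib algebra_simps)
qed

lemma moment_functional_smult: "moment_functional a (Polynomial.smult c p) = c * moment_functional a p"
  by (simp add: moment_functional_eq[of _ "degree p"] degree_smult_le sum_distrib_left mult_ac)

lemma moment_functional_monom: "moment_functional a (monom 1 k) = a k"
proof -
  have "moment_functional a (monom 1 k) = (\<Sum>i\<in>{k}. coeff (monom 1 k) i * a i)"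
    unfolding moment_functional_def by (intro sum.mono_neutral_right) (auto simp: degree_monom_eq)
  then show ?thesis by simp
qed

lemma moment_functional_product:
  "moment_functional a (p * q) = (\<Sum>i\<le>degree p. \<Sum>j\<le>degree q. coeff p i * coeff q j * a (i + j))"
proof -
  have sum: "moment_functional a (\<Sum>x\<in>A. f x) = (\<Sum>x\<in>A. moment_functional a (f x))" for A :: "nat set" and f
    by (induction A rule: infinite_finite_induct)
       (auto simp: moment_functional_add, simp_all add: moment_functional_def)
  have "p * q = (\<Sum>i\<le>degree p. \<Sum>j\<le>degree q. Polynomial.smult (coeff p i * coeff q j) (monom 1 (i + j)))"
    by (subst (1 2) poly_as_sum_of_monoms[symmetric])
       (simp add: sum_product mult_monom smult_monom)
  then show ?thesis by (simp add: sum moment_functional_smult moment_functional_monom)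
qed

lemma moment_functional_X: "moment_functional a ([:0, 1:] * p) = moment_functional (\<lambda>n. a (Suc n)) p"
proof -
  have "moment_functional a (pCons 0 p) = (\<Sum>i\<le>Suc (degree p). coeff (pCons 0 p) i * a i)"
    by (rule moment_functional_eq) (rule degree_pCons_le)
  also have "\<dots> = moment_functional (\<lambda>n. a (Suc n)) p"
    unfolding moment_functional_def sum.atMost_Suc_shift by simp
  finally show ?thesis by simp
qed

text \<open>
  The existence part of the Stieltjes moment problem.  The functional of \<open>a\<close> may be degenerate; adding
  the small multiple \<open>\<epsilon> n\<close> of the sum of the point evaluations at \<open>n + 1\<close> distinct positive points
  makes it strictly positive up to degree \<open>n\<close>.  Its quadrature measure has the moments of \<open>a\<close> up to an
  error that tends to zero.
\<close>

theorem Stieltjes_moment_of_psd: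
  fixes a :: "nat \<Rightarrow> real"
  assumes psd: "\<And>n c. 0 \<le> (\<Sum>i<n. \<Sum>j<n. c i * c j * a (i + j))"
    and psd_shift: "\<And>n c. 0 \<le> (\<Sum>i<n. \<Sum>j<n. c i * c j * a (Suc (i + j)))"
  shows "Stieltjes_moment a"
proof (cases "a 0 = 0")
  case True
  have "a k = 0" for k
  proof (rule ccontr)
    assume k: "a k \<noteq> 0"
    \<comment> \<open>With \<open>a 0 = 0\<close> the quadratic form is affine in the first coordinate; at this \<open>t\<close> its value is \<open>-1\<close>.\<close>
    define t where "t = - (a (k + k) + 1) / (2 * a k)"
    have "k \<noteq> 0" using k True by metis
    let ?c = "\<lambda>i. if i = 0 then t else if i = k then 1 else 0"
    have inner: "(\<Sum>j<Suc k. ?c i * ?c j * a (i + j)) = ?c i * (t * a i + a (i + k))" for i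
    proof -
      have "(\<Sum>j<Suc k. ?c i * ?c j * a (i + j)) = (\<Sum>j\<in>{0, k}. ?c i * ?c j * a (i + j))"
        by (intro sum.mono_neutral_right) auto
      then show ?thesis using \<open>k \<noteq> 0\<close> by (simp add: algebra_simps)
    qed
    have "(\<Sum>i<Suc k. ?c i * (t * a i + a (i + k))) = (\<Sum>i\<in>{0, k}. ?c i * (t * a i + a (i + k)))"
      by (intro sum.mono_neutral_right) auto
    then have "0 \<le> t * (t * a 0 + a k) + (t * a k + a (k + k))"
      using psd[where n = "Suc k" and c = ?c] \<open>k \<noteq> 0\<close> unfolding inner by simp
    then have "0 \<le> 2 * t * a k + a (k + k)" using True by (simp add: algebra_simps)
    then show False using k by (simp add: t_def field_simps)
  qed
  then show ?thesis
    unfolding Stieltjes_moment_def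
    by (intro exI[of _ "null_measure (restrict_space borel {0..})"]) (auto simp: integral_null_measure intro!: measurable_restrict_space1)
next
  case False
  have "0 \<le> a 0" using psd[where n = 1 and c = "\<lambda>_. 1"] by simp
  with False have a0: "0 < a 0" by simp
  define pt where "pt m = 1 / real (Suc m)" for m
  \<comment> \<open>All points lie in \<open>(0, 1]\<close>, so each moment changes by at most \<open>\<epsilon> n * (n + 1) = 1 / (n + 1)\<close>.\<close>
  define \<epsilon> where "\<epsilon> n = 1 / (real (Suc n))\<^sup>2" for n
  define L where "L n p = moment_functional a p + \<epsilon> n * (\<Sum>m\<le>n. poly p (pt m))" for n p
  have \<epsilon>: "0 < \<epsilon> n" for n by (simp add: \<epsilon>_def)
  have pt: "0 < pt m" for m by (simp add: pt_def)
  have "inj pt" by (auto simp: inj_def pt_def)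
  have positive: "positive_functional (L n) (Suc n)" for n
  proof
    show "L n (p + q) = L n p + L n q" for p q
      by (simp add: L_def moment_functional_add sum.distrib algebra_simps)
    show "L n (Polynomial.smult c p) = c * L n p" for c p
      by (simp add: L_def moment_functional_smult algebra_simps flip: sum_distrib_left)
    fix p :: "real poly" assume p: "p \<noteq> 0" "degree p < Suc n"
    have "\<exists>m\<le>n. poly p (pt m) \<noteq> 0"
    proof (rule ccontr)
      assume "\<not> (\<exists>m\<le>n. poly p (pt m) \<noteq> 0)"
      then have "pt ` {..n} \<subseteq> {x. poly p x = 0}" by auto
      then have "card (pt ` {..n}) \<le> card {x. poly p x = 0}"
        using p by (intro card_mono poly_roots_finite)
      also have "\<dots> \<le> degree p" using p by (intro card_poly_roots_bound)
      finally show False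
        using p \<open>inj pt\<close> by (simp add: card_image inj_on_subset)
    qed
    then obtain m where m: "m \<le> n" "poly p (pt m) \<noteq> 0" by blast
    have "0 < (\<Sum>m\<le>n. poly (p * p) (pt m))"
      using m by (intro sum_pos2[of _ m]) (auto simp: zero_less_mult_iff linorder_neq_iff)
    moreover have "0 \<le> moment_functional a (p * p)"
      using psd[where n = "Suc (degree p)" and c = "coeff p"] by (simp add: moment_functional_product lessThan_Suc_atMost)
    ultimately show "0 < L n (p * p)" using \<epsilon>[of n] by (simp add: L_def add_nonneg_pos)
    have "0 < (\<Sum>m\<le>n. poly ([:0, 1:] * p * p) (pt m))"
      using m pt by (intro sum_pos2[of _ m])
        (auto simp: zero_less_mult_iff linorder_neq_iff mult.assoc less_imp_le)
    moreover have "0 \<le> moment_functional a ([:0, 1:] * p * p)"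
      using psd_shift[where n = "Suc (degree p)" and c = "coeff p"]
      unfolding mult.assoc[of "[:0, 1:]"] moment_functional_X
      unfolding moment_functional_product
      by (simp add: lessThan_Suc_atMost)
    ultimately show "0 < L n ([:0, 1:] * p * p)" using \<epsilon>[of n]
      unfolding L_def by (intro add_nonneg_pos mult_pos_pos)
  qed
  have L_monom: "L n (monom 1 k) = a k + \<epsilon> n * (\<Sum>m\<le>n. pt m ^ k)" for n k
    by (simp add: L_def moment_functional_monom poly_monom)
  have L_1: "0 < L n 1" for n
    using positive_functional.L_pos[OF positive, of 1 n] by simp
  have "\<exists>M. real_distribution M \<and> (AE x in M. 0 \<le> x) \<and> (\<forall>k. integrable M (\<lambda>x. x ^ k)) \<and>
      (\<forall>k\<le>n. (LINT x|M. x ^ k) = L n (monom 1 k) / L n 1)" for n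
  proof -
    interpret positive_functional "L n" "Suc n" by (rule positive)
    obtain R w where Rw: "finite R" "\<And>x. x \<in> R \<Longrightarrow> 0 < x" "\<And>x. x \<in> R \<Longrightarrow> 0 \<le> w x"
      "\<And>h. degree h < 2 * Suc n \<Longrightarrow> L n h = (\<Sum>x\<in>R. w x * poly h x)"
      using Gauss_quadrature[OF zero_less_Suc] by blast
    have "L n 1 = (\<Sum>x\<in>R. w x)" using Rw(4)[of 1] by simp
    then have one: "(\<Sum>x\<in>R. w x / L n 1) = 1" using L_1[of n] by (simp flip: sum_divide_distrib)
    have w0: "0 \<le> w x / L n 1" if "x \<in> R" for x using Rw(3)[OF that] L_1[of n] by simp
    have w0: "0 \<le> w x / L n 1" if "x \<in> R" for x using Rw(3)[OF that] L_1[of n] by simp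
    obtain M where M: "real_distribution M" "AE x in M. 0 \<le> x"
      and int_M: "\<forall>f :: real \<Rightarrow> real. f \<in> borel_measurable borel \<longrightarrow>
        integrable M f \<and> (LINT x|M. f x) = (\<Sum>x\<in>R. w x / L n 1 * f x)"
      using finite_support_distribution[of R "\<lambda>x. w x / L n 1", OF Rw(1) w0 one Rw(2)] by blast
    have "(LINT x|M. x ^ k) = L n (monom 1 k) / L n 1" if "k \<le> n" for k
      using that Rw(4)[of "monom 1 k"] int_M[rule_format, of "\<lambda>x. x ^ k"]
      by (simp add: degree_monom_eq poly_monom sum_divide_distrib)
    moreover have "integrable M (\<lambda>x. x ^ k)" for k using int_M by simp
    ultimately show ?thesis using M(1,2) by blast
  qed
  then obtain \<mu> where \<mu>: "\<And>n. real_distribution (\<mu> n)" "\<And>n. AE x in \<mu> n. 0 \<le> x"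
      "\<And>n k. integrable (\<mu> n) (\<lambda>x. x ^ k)"
      "\<And>n k. k \<le> n \<Longrightarrow> (LINT x|\<mu> n. x ^ k) = L n (monom 1 k) / L n 1"
    by metis
  have L_lim: "(\<lambda>n. L n (monom 1 k)) \<longlonglongrightarrow> a k" for k
  proof -
    have "(\<lambda>n. \<epsilon> n * (\<Sum>m\<le>n. pt m ^ k)) \<longlonglongrightarrow> 0"
    proof (rule tendsto_sandwich)
      have "(\<Sum>m\<le>n. pt m ^ k) \<le> real (Suc n)" for n
      proof -
        have "(\<Sum>m\<le>n. pt m ^ k) \<le> (\<Sum>m\<le>n. 1)"
          by (intro sum_mono power_le_one) (auto simp: pt_def)
        then show ?thesis by simp
      qed
      then have "\<epsilon> n * (\<Sum>m\<le>n. pt m ^ k) \<le> \<epsilon> n * real (Suc n)" for n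
        using \<epsilon>[of n] by (intro mult_left_mono) auto
      then show "\<forall>\<^sub>F n in sequentially. \<epsilon> n * (\<Sum>m\<le>n. pt m ^ k) \<le> \<epsilon> n * real (Suc n)" by simp
      show "\<forall>\<^sub>F n in sequentially. 0 \<le> \<epsilon> n * (\<Sum>m\<le>n. pt m ^ k)"
        using \<epsilon> pt by (auto intro!: always_eventually mult_nonneg_nonneg sum_nonneg simp: less_imp_le)
      show "(\<lambda>n. \<epsilon> n * real (Suc n)) \<longlonglongrightarrow> 0" unfolding \<epsilon>_def by real_asymp
    qed simp
    then have "(\<lambda>n. a k + \<epsilon> n * (\<Sum>m\<le>n. pt m ^ k)) \<longlonglongrightarrow> a k + 0" by (intro tendsto_intros)
    then show ?thesis by (simp add: L_monom)
  qed
  have "(\<lambda>n. L n (monom 1 k) / L n 1) \<longlonglongrightarrow> a k / a 0" for k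
    using a0 L_lim[of 0] by (intro tendsto_divide L_lim) (auto simp: monom_0 one_pCons)
  moreover have "\<forall>\<^sub>F n in sequentially. L n (monom 1 k) / L n 1 = (LINT x|\<mu> n. x ^ k)" for k
    using eventually_ge_at_top[of k] by eventually_elim (simp add: \<mu>(4))
  ultimately have lim: "(\<lambda>n. LINT x|\<mu> n. x ^ k) \<longlonglongrightarrow> a k / a 0" for k
    by (rule Lim_transform_eventually)
  obtain M where M: "real_distribution M" "AE x in M. 0 \<le> x"
    "\<And>k. integrable M (\<lambda>x. x ^ k)" "\<And>k. (LINT x|M. x ^ k) = a k / a 0"
    by (rule moment_limit[OF \<mu>(1,2,3) lim]) blast
  interpret real_distribution M by (rule M(1))
  define N where "N = density (restrict_space M {0..}) (\<lambda>_. ennreal (a 0))"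
  have sets: "sets N = sets (restrict_space borel {0..})"
    unfolding N_def sets_density by (rule sets_restrict_space_cong) simp
  have "integrable N (\<lambda>x. x ^ k) \<and> (LINT x|N. x ^ k) = a k" for k
  proof -
    have eq: "AE x in M. indicat_real {0..} x *\<^sub>R x ^ k = x ^ k"
      using M(2) by eventually_elim auto
    have 1: "integrable (restrict_space M {0..}) (\<lambda>x. x ^ k)"
      by (subst integrable_restrict_space, simp, subst integrable_cong_AE[OF _ _ eq])
         (use M(3) in auto)
    have 2: "(LINT x|restrict_space M {0..}. x ^ k) = a k / a 0"
      by (subst integral_restrict_space, simp, subst integral_cong_AE[OF _ _ eq])
         (use M(4) in auto)
    have 3: "(\<lambda>x. x ^ k) \<in> borel_measurable (restrict_space M {0..})"
      by (intro measurable_restrict_space1) simp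
    have "integrable N (\<lambda>x. x ^ k)"
      unfolding N_def by (rule integrable_density[THEN iffD2, OF 3]) (use 1 a0 in auto)
    moreover have "(LINT x|N. x ^ k) = (LINT x|restrict_space M {0..}. a 0 *\<^sub>R x ^ k)"
      unfolding N_def by (rule integral_density[OF 3]) (use a0 in auto)
    ultimately show ?thesis using 2 a0 by simp
  qed
  with sets show ?thesis unfolding Stieltjes_moment_def by (intro exI[of _ N]) simp
qed

section \<open>Exponential Riordan arrays\<close>

text \<open>
  The exponential Riordan array of a pair of series: its column \<open>k\<close> has the exponential generating
  function \<open>G H\<^sup>k / k!\<close>.
\<close>

definition exp_riordan ::
    "'a::{comm_ring_1, real_algebra_1} fps \<Rightarrow> 'a fps \<Rightarrow> nat \<Rightarrow> nat \<Rightarrow> 'a" where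
  "exp_riordan G H n k = of_real (fact n / fact k) * fps_nth (G * H ^ k) n"

lemma fps_mult_power_nth_zero:
  fixes H :: "'a::comm_ring_1 fps"
  assumes "fps_nth H 0 = 0" "n < k"
  shows "fps_nth (G * H ^ k) n = 0"
  unfolding fps_mult_nth using assms startsby_zero_power_prefix[of H k]
  by (intro sum.neutral) auto

text \<open>
  \<open>Y\<close> is the composite of \<open>\<Sum>\<^sub>j y\<^sub>j t\<^sup>j\<close> with \<open>H\<close>, given through its coefficients.
\<close>

lemma fps_mult_compose_nth:
  fixes H X :: "'a::comm_ring_1 fps"
  assumes H: "fps_nth H 0 = 0" and Y: "\<And>n. fps_nth Y n = (\<Sum>j\<le>n. y j * fps_nth (H ^ j) n)"
  shows "fps_nth (X * Y) n = (\<Sum>j\<le>n. y j * fps_nth (X * H ^ j) n)"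
proof -
  have Y': "fps_nth Y i = (\<Sum>j\<le>n. y j * fps_nth (H ^ j) i)" if "i \<le> n" for i
    unfolding Y using that startsby_zero_power_prefix[OF H]
    by (intro sum.mono_neutral_left) auto
  have "fps_nth (X * Y) n = (\<Sum>i=0..n. \<Sum>j\<le>n. y j * (fps_nth X i * fps_nth (H ^ j) (n - i)))"
    unfolding fps_mult_nth by (intro sum.cong) (auto simp: Y' sum_distrib_left mult_ac)
  also have "\<dots> = (\<Sum>j\<le>n. y j * fps_nth (X * H ^ j) n)"
    by (subst sum.swap) (simp add: fps_mult_nth sum_distrib_left)
  finally show ?thesis .
qed

lemma of_real_div_fact_Suc:
  "of_real (x / fact k) = (of_nat (Suc k) * of_real (x / fact (Suc k)) :: 'a::real_algebra_1)"
proof -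
  have "x / fact k = real (Suc k) * (x / fact (Suc k))" by (simp add: divide_simps)
  then have "of_real (x / fact k) = (of_real (real (Suc k) * (x / fact (Suc k))) :: 'a)" by simp
  then show ?thesis by (simp only: of_real_mult of_real_of_nat_eq)
qed

text \<open>
  The two differential equations give
  \<open>(G H\<^sup>k)' = (\<Gamma> + \<Lambda> + k c) Q G H\<^sup>k + c \<Lambda> Q G H\<^sup>k\<^sup>+\<^sup>1 + k Q G H\<^sup>k\<^sup>-\<^sup>1\<close>; up to factorial
  weights, these coefficients are column \<open>k\<close> of the tridiagonal matrix.  Expanding \<open>Q = P(c H)\<close> turns
  \<open>Q G H\<^sup>m\<close> into a combination of the series \<open>G H\<^sup>j\<close>, whose coefficients are column \<open>m\<close> of the weighted
  Toeplitz matrix.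
\<close>

lemma exp_riordan_production:
  fixes G H Q :: "'a::{comm_ring_1, real_algebra_1} fps" and P :: "real fps"
  assumes H0: "fps_nth H 0 = 0"
    and dH: "fps_deriv H = (1 + fps_const c * H) * Q"
    and dG: "fps_deriv G = (fps_const \<Gamma> + fps_const \<Lambda> * (1 + fps_const c * H)) * Q * G"
    and Q: "\<And>n. fps_nth Q n = (\<Sum>j\<le>n. of_real (fps_nth P j) * c ^ j * fps_nth (H ^ j) n)"
  shows "exp_riordan G H (Suc n) k =
    (\<Sum>j\<le>n. exp_riordan G H n j * (\<Sum>l\<le>j. exp_toeplitz P c j l * tridiag \<Gamma> \<Lambda> c l k))"
proof -
  define d where "d m = fps_nth (G * H ^ m * Q) n" for m
  \<comment> \<open>the entries of row \<open>n\<close> of the array times the Toeplitz matrix\<close>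
  define e where "e m = of_real (fact n / fact m) * d m" for m
  have d: "d m = (\<Sum>j\<le>n. of_real (fps_nth P j) * c ^ j * fps_nth (G * H ^ (m + j)) n)" for m
    unfolding d_def using fps_mult_compose_nth[OF H0 Q, of "G * H ^ m" n]
    by (simp add: power_add mult.assoc)
  have e: "e m = (\<Sum>i\<le>n. exp_riordan G H n i * exp_toeplitz P c i m)" for m
  proof -
    let ?h = "\<lambda>i. exp_riordan G H n i * exp_toeplitz P c i m"
    have "(\<Sum>i\<le>n. ?h i) = (\<Sum>i\<le>m + n. ?h i)"
      using fps_mult_power_nth_zero[OF H0, of n _ G]
      by (intro sum.mono_neutral_left) (auto simp: exp_riordan_def)
    also have "\<dots> = (\<Sum>i\<in>(\<lambda>j. m + j) ` {..n}. ?h i)"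
    proof (rule sum.mono_neutral_right)
      show "\<forall>i\<in>{..m + n} - (\<lambda>j. m + j) ` {..n}. ?h i = 0"
      proof
        fix i assume i: "i \<in> {..m + n} - (\<lambda>j. m + j) ` {..n}"
        have "i < m"
        proof (rule ccontr)
          assume "\<not> i < m"
          then have "i = m + (i - m)" "i - m \<in> {..n}" using i by auto
          then show False using i by blast
        qed
        then show "?h i = 0" by (simp add: exp_toeplitz_def)
      qed
    qed auto
    also have "\<dots> = (\<Sum>j\<le>n. ?h (m + j))" by (subst sum.reindex) (auto simp: inj_on_def)
    also have "\<dots> = (\<Sum>j\<le>n. of_real (fact n / fact m) *
        (of_real (fps_nth P j) * c ^ j * fps_nth (G * H ^ (m + j)) n))"
    proof (rule sum.cong[OF refl])
      fix j
      have "of_real (fact n / fact (m + j)) * of_real (fact (m + j) / fact m * fps_nth P j)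
          = (of_real (fact n / fact m * fps_nth P j) :: 'a)"
        unfolding of_real_mult[symmetric] by (rule arg_cong[where f = of_real]) simp
      moreover have "?h (m + j) = of_real (fact n / fact (m + j)) *
          of_real (fact (m + j) / fact m * fps_nth P j) * (c ^ j * fps_nth (G * H ^ (m + j)) n)"
        by (simp only: exp_riordan_def exp_toeplitz_def le_add1 if_True add_diff_cancel_left' mult_ac)
      ultimately show "?h (m + j) = of_real (fact n / fact m) *
        (of_real (fps_nth P j) * c ^ j * fps_nth (G * H ^ (m + j)) n)"
        by (simp only: of_real_mult mult_ac)
    qed
    finally show ?thesis by (simp add: e_def d sum_distrib_left)
  qed
  have e_big: "e m = 0" if "n < m" for m
    unfolding e by (intro sum.neutral) (use that in \<open>auto simp: exp_toeplitz_def\<close>)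
  have deriv: "fps_deriv (G * H ^ k) = fps_const (\<Gamma> + \<Lambda> + of_nat k * c) * (G * H ^ k * Q)
      + fps_const (\<Lambda> * c) * (G * H ^ Suc k * Q) + of_nat k * (G * H ^ (k - 1) * Q)"
  proof (cases k)
    case 0
    then show ?thesis by (simp add: dG algebra_simps flip: fps_const_add fps_const_mult)
  next
    case (Suc m)
    have "fps_deriv (H ^ Suc m) = of_nat (Suc m) * fps_deriv H * H ^ m"
      by (simp add: fps_deriv_power' del: power_Suc of_nat_Suc)
    then have "fps_deriv (G * H ^ k) = G * (of_nat k * ((1 + fps_const c * H) * Q) * H ^ m)
        + (fps_const \<Gamma> + fps_const \<Lambda> * (1 + fps_const c * H)) * Q * G * H ^ k"
      unfolding Suc fps_deriv_mult dG dH by simp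
    then show ?thesis
      by (simp add: Suc algebra_simps fps_of_nat[symmetric] flip: fps_const_add fps_const_mult)
  qed
  have coeff: "of_nat (Suc n) * fps_nth (G * H ^ k) (Suc n) =
      (\<Gamma> + \<Lambda> + of_nat k * c) * d k + \<Lambda> * c * d (Suc k) + of_nat k * d (k - 1)"
  proof -
    have "of_nat (Suc n) * fps_nth (G * H ^ k) (Suc n) = fps_nth (fps_deriv (G * H ^ k)) n"
      by (simp only: fps_deriv_nth Suc_eq_plus1)
    also have "\<dots> = (\<Gamma> + \<Lambda> + of_nat k * c) * d k + \<Lambda> * c * d (Suc k) + of_nat k * d (k - 1)"
      unfolding deriv d_def by (simp add: fps_of_nat[symmetric])
    finally show ?thesis .
  qed
  have "fact (Suc n) / fact k = fact n / fact k * real (Suc n)" by simp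
  then have "of_real (fact (Suc n) / fact k) = (of_real (fact n / fact k) * of_nat (Suc n) :: 'a)"
    by (simp only: of_real_mult of_real_of_nat_eq)
  then have "exp_riordan G H (Suc n) k = of_real (fact n / fact k) *
      (of_nat (Suc n) * fps_nth (G * H ^ k) (Suc n))"
    by (simp add: exp_riordan_def mult.assoc)
  also have "\<dots> = (\<Gamma> + \<Lambda> + of_nat k * c) * (of_real (fact n / fact k) * d k) +
      c * \<Lambda> * (of_real (fact n / fact k) * d (Suc k)) + of_real (fact n / fact k) * (of_nat k * d (k - 1))"
    unfolding coeff by (simp add: algebra_simps)
  also have "of_real (fact n / fact k) * d k = e k" by (simp add: e_def)
  also have "of_real (fact n / fact k) * d (Suc k) = of_nat (Suc k) * e (Suc k)"
    unfolding e_def of_real_div_fact_Suc[of "fact n" k] by (simp only: mult.assoc)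
  also have "of_real (fact n / fact k) * (of_nat k * d (k - 1)) = (case k of 0 \<Rightarrow> 0 | Suc k' \<Rightarrow> e k')"
  proof (cases k)
    case (Suc m)
    then show ?thesis
      unfolding e_def by (simp add: of_real_div_fact_Suc[of "fact n" m] mult_ac del: of_nat_Suc fact_Suc)
  qed simp
  also have "(\<Gamma> + \<Lambda> + of_nat k * c) * e k + c * \<Lambda> * (of_nat (Suc k) * e (Suc k)) +
      (case k of 0 \<Rightarrow> 0 | Suc k' \<Rightarrow> e k') = (\<Sum>l\<le>n + Suc k. e l * tridiag \<Gamma> \<Lambda> c l k)"
  proof (cases k)
    case 0
    have "(\<Sum>l\<le>n + Suc k. e l * tridiag \<Gamma> \<Lambda> c l k) = (\<Sum>l\<in>{0, Suc 0}. e l * tridiag \<Gamma> \<Lambda> c l k)"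
      using 0 by (intro sum.mono_neutral_right) (auto simp: tridiag_def)
    then show ?thesis using 0 by (simp add: tridiag_def mult_ac)
  next
    case (Suc m)
    have "(\<Sum>l\<le>n + Suc k. e l * tridiag \<Gamma> \<Lambda> c l k) =
        (\<Sum>l\<in>{m, Suc m, Suc (Suc m)}. e l * tridiag \<Gamma> \<Lambda> c l k)"
      using Suc by (intro sum.mono_neutral_right) (auto simp: tridiag_def)
    then show ?thesis using Suc by (simp add: tridiag_def mult_ac add_ac)
  qed
  also have "\<dots> = (\<Sum>l\<le>n. e l * tridiag \<Gamma> \<Lambda> c l k)"
    by (rule sum.mono_neutral_right) (auto simp: e_big)
  also have "\<dots> = (\<Sum>j\<le>n. exp_riordan G H n j * (\<Sum>l\<le>n. exp_toeplitz P c j l * tridiag \<Gamma> \<Lambda> c l k))"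
    unfolding e sum_distrib_right sum_distrib_left by (subst sum.swap) (simp add: mult.assoc)
  also have "\<dots> = (\<Sum>j\<le>n. exp_riordan G H n j * (\<Sum>l\<le>j. exp_toeplitz P c j l * tridiag \<Gamma> \<Lambda> c l k))"
    by (intro sum.cong refl arg_cong2[where f = "(*)"] sum.mono_neutral_right)
       (auto simp: exp_toeplitz_def)
  finally show ?thesis .
qed


theorem exp_riordan_totally_positive:
  fixes G H Q :: "'a::nonneg_algebra fps" and P :: "real fps"
  assumes "PF_function P" and nn: "nonneg_coeffs \<Gamma>" "nonneg_coeffs \<Lambda>" "nonneg_coeffs c"
    and H0: "fps_nth H 0 = 0" and G0: "fps_nth G 0 = 1"
    and dH: "fps_deriv H = (1 + fps_const c * H) * Q"
    and dG: "fps_deriv G = (fps_const \<Gamma> + fps_const \<Lambda> * (1 + fps_const c * H)) * Q * G"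
    and Q: "\<And>n. fps_nth Q n = (\<Sum>j\<le>n. of_real (fps_nth P j) * c ^ j * fps_nth (H ^ j) n)"
  shows "totally_positive (exp_riordan G H)"
    and "coeffwise_SM (\<lambda>n. exp_riordan G H n 0)"
proof -
  have lower: "exp_toeplitz P c i j = 0" "exp_riordan G H i j = 0" if "i < j" for i j
    using that fps_mult_power_nth_zero[OF H0 that] by (simp_all add: exp_toeplitz_def exp_riordan_def)
  have init: "exp_riordan G H 0 0 = 1" by (simp add: exp_riordan_def G0)
  note TP = totally_positive_exp_toeplitz[OF assms(1) nn(3)] totally_positive_tridiag[OF nn]
  note rec = exp_riordan_production[OF H0 dH dG Q]
  show "totally_positive (exp_riordan G H)" "coeffwise_SM (\<lambda>n. exp_riordan G H n 0)"
    by (rule production_factorization_TP[OF TP lower init rec]; assumption)+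
qed

section \<open>Maps of formal power series\<close>

lemma fps_nth_map [simp]: "fps_nth (fps_map \<phi> X) n = \<phi> (fps_nth X n)"
  by (simp add: fps_map_def)

lemma fps_map_hom:
  fixes \<phi> :: "'a::comm_ring_1 \<Rightarrow> 'b::comm_ring_1"
  assumes add: "\<And>a b. \<phi> (a + b) = \<phi> a + \<phi> b" and mult: "\<And>a b. \<phi> (a * b) = \<phi> a * \<phi> b"
    and one: "\<phi> 1 = 1"
  shows "fps_map \<phi> (X + Y) = fps_map \<phi> X + fps_map \<phi> Y"
    and "fps_map \<phi> (X * Y) = fps_map \<phi> X * fps_map \<phi> Y"
    and "fps_map \<phi> 1 = 1"
    and "fps_map \<phi> (fps_const c) = fps_const (\<phi> c)"
    and "fps_map \<phi> (fps_deriv X) = fps_deriv (fps_map \<phi> X)"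
    and "fps_map \<phi> (X ^ k) = fps_map \<phi> X ^ k"
proof -
  have zero: "\<phi> 0 = 0" using add[of 0 0] by simp
  have sum: "\<phi> (sum h A) = (\<Sum>i\<in>A. \<phi> (h i))" for h :: "nat \<Rightarrow> 'a" and A
    by (induction A rule: infinite_finite_induct) (auto simp: zero add)
  have nat: "\<phi> (of_nat n) = of_nat n" for n by (induction n) (auto simp: zero add one)
  show "fps_map \<phi> (X + Y) = fps_map \<phi> X + fps_map \<phi> Y" by (rule fps_ext) (simp add: add)
  show m: "fps_map \<phi> (X * Y) = fps_map \<phi> X * fps_map \<phi> Y" for X Y
    by (rule fps_ext) (simp add: fps_mult_nth sum mult)
  show o: "fps_map \<phi> 1 = 1" by (rule fps_ext) (simp add: one zero)
  show "fps_map \<phi> (fps_const c) = fps_const (\<phi> c)" by (rule fps_ext) (simp add: zero)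
  show "fps_map \<phi> (fps_deriv X) = fps_deriv (fps_map \<phi> X)"
    by (rule fps_ext) (simp add: mult nat add one)
  show "fps_map \<phi> (X ^ k) = fps_map \<phi> X ^ k" by (induction k) (auto simp: m o)
qed

lemma of_real_hom: "of_real (a + b) = (of_real a + of_real b :: 'a::real_algebra_1)"
  "of_real (a * b) = (of_real a * of_real b :: 'a::real_algebra_1)" "of_real 1 = (1 :: 'a::real_algebra_1)"
  by simp_all

lemmas fps_map_of_real = fps_map_hom[of of_real, OF of_real_hom]

lemma const_poly_hom: "[:a + b:] = [:a:] + [:b:]" "[:a * b:] = [:a:] * [:b:]" "[:1:] = 1"
  for a b :: "'a::comm_ring_1"
  by (simp_all add: one_pCons)

lemmas fps_map_const_poly = fps_map_hom[of "\<lambda>c. [:c:]", OF const_poly_hom]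

lemma of_real_poly: "(of_real r :: 'a::{comm_ring_1, real_algebra_1} poly) = [:of_real r:]"
  by (rule poly_eqI)
     (simp add: of_real_def scaleR_poly_def coeff_map_poly coeff_pCons coeff_1 split: nat.splits)

definition fps_dilate :: "'a::comm_ring_1 \<Rightarrow> 'a fps \<Rightarrow> 'a fps" where
  "fps_dilate y X = Abs_fps (\<lambda>n. y ^ n * fps_nth X n)"

lemma fps_dilate_nth [simp]: "fps_nth (fps_dilate y X) n = y ^ n * fps_nth X n"
  by (simp add: fps_dilate_def)

lemma fps_dilate_add: "fps_dilate y (X + Y) = fps_dilate y X + fps_dilate y Y"
  by (rule fps_ext) (simp add: algebra_simps)

lemma fps_dilate_const: "fps_dilate y (fps_const c) = fps_const c"
  by (rule fps_ext) simp

lemma fps_dilate_1: "fps_dilate y 1 = 1"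
  by (rule fps_ext) simp

lemma fps_dilate_mult: "fps_dilate y (X * Y) = fps_dilate y X * fps_dilate y Y"
proof (rule fps_ext)
  fix n
  have "y ^ n * (fps_nth X i * fps_nth Y (n - i)) = (y ^ i * fps_nth X i) * (y ^ (n - i) * fps_nth Y (n - i))"
    if "i \<in> {0..n}" for i
  proof -
    have "y ^ n = y ^ i * y ^ (n - i)" using that by (simp flip: power_add)
    then show ?thesis by (simp add: mult_ac)
  qed
  then show "fps_nth (fps_dilate y (X * Y)) n = fps_nth (fps_dilate y X * fps_dilate y Y) n"
    by (simp add: fps_mult_nth sum_distrib_left)
qed

lemma fps_dilate_power: "fps_dilate y (X ^ k) = fps_dilate y X ^ k"
  by (induction k) (auto simp: fps_dilate_1 fps_dilate_mult)

lemma fps_deriv_dilate: "fps_deriv (fps_dilate y X) = fps_const y * fps_dilate y (fps_deriv X)"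
  by (rule fps_ext) (simp add: algebra_simps)

lemma fps_deriv_exp_of:
  fixes A :: "'a::{idom, real_algebra_1} fps"
  assumes "fps_nth A 0 = 0"
  shows "fps_deriv (fps_exp_of A) = fps_deriv A * fps_exp_of A"
proof -
  have "fps_deriv (fps_map of_real (fps_exp 1)) = (fps_map of_real (fps_exp 1) :: 'a fps)"
    by (simp flip: fps_map_of_real(5))
  then show ?thesis
    unfolding fps_exp_of_def fps_compose_deriv[OF assms] by (simp add: mult.commute)
qed

lemma fps_exp_of_nth:
  "fps_nth (fps_exp_of (fps_const x * H)) n = (\<Sum>j\<le>n. of_real (1 / fact j) * x ^ j * fps_nth (H ^ j) n)"
  by (simp add: fps_exp_of_def fps_compose_nth atLeast0AtMost power_mult_distrib fps_const_power mult.assoc)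

lemma fps_exp_of_nth_0 [simp]: "fps_nth (fps_exp_of A) 0 = 1"
  by (simp add: fps_exp_of_def)

section \<open>Homogenized row polynomials\<close>

text \<open>
  The sum is \<open>n!\<close> times the coefficient of \<open>t\<^sup>n\<close> in \<open>G(t) = g(y t) exp (x H(t))\<close>, where
  \<open>H(t) = F(y t) / y\<close>, and thus the zeroth column of the array of \<open>G\<close> and \<open>H\<close>.  By the chain rule this
  pair satisfies the equations for the parameters \<open>y \<gamma>\<close>, \<open>y lam + x\<close> and \<open>y\<close>.
\<close>

theorem homogenized_coeffwise_SM:
  fixes g F Q :: "'a::nonneg_algebra fps" and f P :: "real fps"
  assumes PF: "PF_function P" and f0: "fps_nth f 0 = 0"
    and df: "fps_deriv f = (1 + f) * fps_compose P f"
    and F_def: "F = fps_map of_real f" and Q_def: "Q = fps_map of_real (fps_compose P f)"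
    and g0: "fps_nth g 0 = 1"
    and dg: "fps_deriv g = (fps_const \<gamma> + fps_const lam * (1 + F)) * Q * g"
    and nn: "nonneg_coeffs \<gamma>" "nonneg_coeffs lam" "nonneg_coeffs x" "nonneg_coeffs y"
  shows "coeffwise_SM (\<lambda>n. \<Sum>k\<le>n. exp_riordan g F n k * x ^ k * y ^ (n - k))"
proof -
  have F0: "fps_nth F 0 = 0" by (simp add: F_def f0)
  \<comment> \<open>Since \<open>y\<close> need not be invertible, \<open>F(y t) / y\<close> is written as \<open>t F1(y t)\<close> with \<open>F = t F1\<close>.\<close>
  define F1 where "F1 = fps_shift 1 F"
  have F: "F = F1 * fps_X"
    by (rule fps_ext) (auto simp: F1_def F0)
  define H where "H = fps_dilate y F1 * fps_X"
  have H0: "fps_nth H 0 = 0" by (simp add: H_def)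
  have yH: "fps_const y * H = fps_dilate y F"
    by (rule fps_ext) (auto simp: H_def F1_def F0 power_eq_if)
  define Qy where "Qy = fps_dilate y Q"
  have dF: "fps_deriv F = (1 + F) * Q"
    unfolding F_def Q_def by (simp add: df fps_map_of_real(1-3) flip: fps_map_of_real(5))
  have "fps_deriv H = fps_dilate y (fps_deriv F)"
    by (rule fps_ext) (simp add: H_def F1_def algebra_simps)
  then have dH: "fps_deriv H = (1 + fps_const y * H) * Qy"
    by (simp add: dF Qy_def yH fps_dilate_mult fps_dilate_add fps_dilate_1)
  define E where "E = fps_exp_of (fps_const x * H)"
  have dE: "fps_deriv E = fps_const x * fps_deriv H * E"
    unfolding E_def by (subst fps_deriv_exp_of) (simp_all add: H0)
  define G where "G = fps_dilate y g * E"
  have G0: "fps_nth G 0 = 1" by (simp add: G_def E_def g0)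
  have "fps_dilate y (fps_deriv g) =
      (fps_const \<gamma> + fps_const lam * (1 + fps_const y * H)) * Qy * fps_dilate y g"
    by (simp add: dg yH Qy_def fps_dilate_mult fps_dilate_add fps_dilate_1 fps_dilate_const)
  then have dG: "fps_deriv G =
      (fps_const (y * \<gamma>) + fps_const (y * lam + x) * (1 + fps_const y * H)) * Qy * G"
    by (simp add: G_def fps_deriv_dilate dE dH algebra_simps flip: fps_const_add fps_const_mult)
  have Qy: "fps_nth Qy n = (\<Sum>j\<le>n. of_real (fps_nth P j) * y ^ j * fps_nth (H ^ j) n)" for n
  proof -
    have "y ^ j * fps_nth (H ^ j) n = y ^ n * of_real (fps_nth (f ^ j) n)" for j
    proof -
      have "y ^ j * fps_nth (H ^ j) n = fps_nth ((fps_const y * H) ^ j) n"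
        by (simp add: power_mult_distrib fps_const_power)
      also have "\<dots> = y ^ n * fps_nth (F ^ j) n" unfolding yH by (simp flip: fps_dilate_power)
      finally show ?thesis by (simp add: F_def flip: fps_map_of_real(6))
    qed
    then have "of_real (fps_nth P j) * y ^ j * fps_nth (H ^ j) n =
        y ^ n * (of_real (fps_nth P j) * of_real (fps_nth (f ^ j) n))" for j
      by (metis mult.assoc mult.left_commute)
    moreover have "fps_nth Qy n = (\<Sum>j\<le>n. y ^ n * (of_real (fps_nth P j) * of_real (fps_nth (f ^ j) n)))"
      by (simp add: Qy_def Q_def fps_compose_nth atLeast0AtMost sum_distrib_left)
    ultimately show ?thesis by (simp only:)
  qed
  have "coeffwise_SM (\<lambda>n. exp_riordan G H n 0)"
    using nn by (intro exp_riordan_totally_positive(2)[OF PF _ _ _ H0 G0 dH dG Qy] nonneg_mult nonneg_add)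
  moreover have "exp_riordan G H n 0 = (\<Sum>k\<le>n. exp_riordan g F n k * x ^ k * y ^ (n - k))" for n
  proof -
    have Gk: "fps_nth (fps_dilate y g * H ^ k) n = y ^ (n - k) * fps_nth (g * F ^ k) n" if "k \<le> n" for k
    proof -
      have "fps_dilate y g * H ^ k = fps_dilate y (g * F1 ^ k) * fps_X ^ k"
        by (simp add: H_def power_mult_distrib fps_dilate_mult fps_dilate_power mult.assoc)
      moreover have "g * F ^ k = (g * F1 ^ k) * fps_X ^ k"
        by (simp add: F power_mult_distrib mult.assoc)
      ultimately show ?thesis
        using that by (simp only: fps_X_power_mult_right_nth) simp
    qed
    have "fps_nth G n = (\<Sum>k\<le>n. (of_real (1 / fact k) * x ^ k) * fps_nth (fps_dilate y g * H ^ k) n)"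
      unfolding G_def by (rule fps_mult_compose_nth[OF H0]) (simp add: E_def fps_exp_of_nth)
    then have "exp_riordan G H n 0 =
        (\<Sum>k\<le>n. of_real (fact n) * ((of_real (1 / fact k) * x ^ k) * (y ^ (n - k) * fps_nth (g * F ^ k) n)))"
      by (simp add: exp_riordan_def sum_distrib_left Gk)
    also have "\<dots> = (\<Sum>k\<le>n. exp_riordan g F n k * x ^ k * y ^ (n - k))"
    proof (rule sum.cong[OF refl])
      fix k
      have "of_real (fact n / fact k) = (of_real (fact n) * of_real (1 / fact k) :: 'a)"
        by (simp only: of_real_mult[symmetric] times_divide_eq_right mult_1_right)
      then show "of_real (fact n) * ((of_real (1 / fact k) * x ^ k) * (y ^ (n - k) * fps_nth (g * F ^ k) n)) =
          exp_riordan g F n k * x ^ k * y ^ (n - k)"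
        by (simp only: exp_riordan_def mult_ac)
    qed
    finally show ?thesis .
  qed
  ultimately show ?thesis by simp
qed

lemma exp_riordan_of_PF_flow_totally_positive:
  fixes g F Q :: "'a::nonneg_algebra fps" and f P :: "real fps"
  assumes PF: "PF_function P" and f0: "fps_nth f 0 = 0"
    and df: "fps_deriv f = (1 + f) * fps_compose P f"
    and F_def: "F = fps_map of_real f" and Q_def: "Q = fps_map of_real (fps_compose P f)"
    and g0: "fps_nth g 0 = 1"
    and dg: "fps_deriv g = (fps_const \<gamma> + fps_const lam * (1 + F)) * Q * g"
    and nn: "nonneg_coeffs \<gamma>" "nonneg_coeffs lam"
  shows "totally_positive (exp_riordan g F)"
proof (rule exp_riordan_totally_positive(1)[OF PF nn nonneg_one _ g0])
  show "fps_nth F 0 = 0" by (simp add: F_def f0)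
  show "fps_deriv F = (1 + fps_const 1 * F) * Q"
    unfolding F_def Q_def by (simp add: df fps_map_of_real(1-3) flip: fps_map_of_real(5))
  show "fps_deriv g = (fps_const \<gamma> + fps_const lam * (1 + fps_const 1 * F)) * Q * g"
    by (simp add: dg)
  show "fps_nth Q n = (\<Sum>j\<le>n. of_real (fps_nth P j) * 1 ^ j * fps_nth (F ^ j) n)" for n
    by (simp add: Q_def F_def fps_compose_nth atLeast0AtMost flip: fps_map_of_real(6))
qed

section \<open>The polynomials S and their reversals\<close>

lemma S_poly_eq:
  fixes h u :: "'a::{comm_ring_1, real_algebra_1} fps"
  assumes h0: "fps_nth h 0 = 0"
  shows "S_poly h u n = (\<Sum>k\<le>n. monom (exp_riordan u h n k) k)"
proof -
  let ?C = "fps_map (\<lambda>c. [:c:])"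
  have C0: "fps_nth (?C h) 0 = 0" using h0 by simp
  have "fps_nth (?C u * fps_exp_of (fps_const [:0, 1:] * ?C h)) n =
      (\<Sum>k\<le>n. (of_real (1 / fact k) * [:0, 1:] ^ k) * fps_nth (?C u * ?C h ^ k) n)"
    by (rule fps_mult_compose_nth[OF C0]) (simp add: fps_exp_of_nth)
  also have "\<dots> = (\<Sum>k\<le>n. (of_real (1 / fact k) * [:0, 1:] ^ k) * [:fps_nth (u * h ^ k) n:])"
    by (simp flip: fps_map_const_poly(2,6))
  finally have "S_poly h u n =
      (\<Sum>k\<le>n. of_real (fact n) * ((of_real (1 / fact k) * [:0, 1:] ^ k) * [:fps_nth (u * h ^ k) n:]))"
    by (simp add: S_poly_def sum_distrib_left)
  also have "\<dots> = (\<Sum>k\<le>n. monom (exp_riordan u h n k) k)"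
  proof (rule sum.cong[OF refl])
    fix k
    have "of_real (fact n / fact k) = (of_real (fact n) * of_real (1 / fact k) :: 'a)"
      by (simp only: of_real_mult[symmetric] times_divide_eq_right mult_1_right)
    then show "of_real (fact n) * ((of_real (1 / fact k) * [:0, 1:] ^ k) * [:fps_nth (u * h ^ k) n:]) =
        monom (exp_riordan u h n k) k"
      unfolding of_real_poly by (simp add: exp_riordan_def monom_altdef mult_ac)
  qed
  finally show ?thesis .
qed

lemma S_coeff_eq:
  fixes h u :: "'a::{comm_ring_1, real_algebra_1} fps"
  assumes h0: "fps_nth h 0 = 0"
  shows "S_coeff h u = exp_riordan u h"
proof (intro ext)
  fix n k
  show "S_coeff h u n k = exp_riordan u h n k"
    using fps_mult_power_nth_zero[OF h0, of n k u]
    by (auto simp: S_coeff_def S_poly_eq[OF h0] coeff_sum exp_riordan_def)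
qed

lemma const_poly_exp_riordan:
  fixes u h :: "'a::{comm_ring_1, real_algebra_1} fps"
  shows "[:exp_riordan u h n k:] = exp_riordan (fps_map (\<lambda>c. [:c:]) u) (fps_map (\<lambda>c. [:c:]) h) n k"
proof -
  have "[:exp_riordan u h n k:] = of_real (fact n / fact k) * [:fps_nth (u * h ^ k) n:]"
    unfolding exp_riordan_def of_real_poly by simp
  also have "[:fps_nth (u * h ^ k) n:] = fps_nth (fps_map (\<lambda>c. [:c:]) u * fps_map (\<lambda>c. [:c:]) h ^ k) n"
    by (simp flip: fps_map_const_poly(2,6))
  finally show ?thesis by (simp add: exp_riordan_def)
qed

text \<open>
  Both sequences are homogenized row polynomials over the ring with the additional indeterminate \<open>q\<close>:
  \<open>(x, y) = (q, 1)\<close> for the first and \<open>(x, y) = (1, q)\<close> for the second.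
\<close>

theorem S_poly_S_star_coeffwise_SM:
  fixes g F Q :: "'a::nonneg_algebra fps" and f P :: "real fps"
  assumes PF: "PF_function P" and f0: "fps_nth f 0 = 0"
    and df: "fps_deriv f = (1 + f) * fps_compose P f"
    and F_def: "F = fps_map of_real f" and Q_def: "Q = fps_map of_real (fps_compose P f)"
    and g0: "fps_nth g 0 = 1"
    and dg: "fps_deriv g = (fps_const \<gamma> + fps_const lam * (1 + F)) * Q * g"
    and nn: "nonneg_coeffs \<gamma>" "nonneg_coeffs lam"
  shows "coeffwise_SM (S_poly F g)" "coeffwise_SM (S_star F g)"
proof -
  let ?C = "fps_map (\<lambda>c. [:c:])"
  have F0: "fps_nth F 0 = 0" by (simp add: F_def f0)
  have CF: "?C F = fps_map of_real f" and CQ: "?C Q = fps_map of_real (fps_compose P f)"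
    by (rule fps_ext; simp add: F_def Q_def of_real_poly)+
  have Cg0: "fps_nth (?C g) 0 = 1" by (simp add: g0 one_pCons)
  have Cdg: "fps_deriv (?C g) = (fps_const [:\<gamma>:] + fps_const [:lam:] * (1 + ?C F)) * ?C Q * ?C g"
    by (simp add: dg fps_map_const_poly(1-4) flip: fps_map_const_poly(5))
  note hom = homogenized_coeffwise_SM[OF PF f0 df CF CQ Cg0 Cdg nonneg_const_poly[OF nn(1)] nonneg_const_poly[OF nn(2)]]
  have "S_poly F g = (\<lambda>n. \<Sum>k\<le>n. exp_riordan (?C g) (?C F) n k * [:0, 1:] ^ k * 1 ^ (n - k))"
    by (simp add: fun_eq_iff S_poly_eq[OF F0] monom_altdef flip: const_poly_exp_riordan)
  then show "coeffwise_SM (S_poly F g)"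
    using hom[OF nonneg_indeterminate nonneg_one] by simp
  have "S_star F g = (\<lambda>n. \<Sum>k\<le>n. exp_riordan (?C g) (?C F) n k * 1 ^ k * [:0, 1:] ^ (n - k))"
    by (simp add: fun_eq_iff S_star_def S_coeff_eq[OF F0] monom_altdef flip: const_poly_exp_riordan)
  then show "coeffwise_SM (S_star F g)"
    using hom[OF nonneg_one nonneg_indeterminate] by simp
qed

section \<open>The differential equation of g\<close>

text \<open>
  The binomial series \<open>B\<close> satisfies \<open>(1 + t) B' = \<gamma> B\<close>; composing with \<open>F\<close> and using \<open>F' = (1 + F) Q\<close>
  avoids a division by \<open>1 + F\<close>.
\<close>

lemma one_plus_power_ode:
  fixes F Q :: "'a::{idom, real_algebra_1} fps"
  assumes F0: "fps_nth F 0 = 0" and dF: "fps_deriv F = (1 + F) * Q"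
  shows "fps_deriv (one_plus_power F \<gamma>) = fps_const \<gamma> * Q * one_plus_power F \<gamma>"
proof -
  define B where "B = Abs_fps (binom_of \<gamma>)"
  have rec: "of_nat (Suc n) * binom_of \<gamma> (Suc n) = (\<gamma> - of_nat n) * binom_of \<gamma> n" for n
  proof -
    have "of_nat (Suc n) * binom_of \<gamma> (Suc n) = real (Suc n) *\<^sub>R binom_of \<gamma> (Suc n)"
      by (simp only: scaleR_conv_of_real of_real_of_nat_eq)
    also have "\<dots> = (real (Suc n) * (1 / fact (Suc n))) *\<^sub>R ((\<gamma> - of_nat n) * (\<Prod>i<n. \<gamma> - of_nat i))"
      by (simp only: binom_of_def scaleR_scaleR prod.lessThan_Suc mult.commute)
    also have "real (Suc n) * (1 / fact (Suc n)) = 1 / fact n" by (simp add: divide_simps)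
    finally show ?thesis by (simp add: binom_of_def)
  qed
  have ode: "(1 + fps_X) * fps_deriv B = fps_const \<gamma> * B"
  proof (rule fps_ext)
    fix n
    show "fps_nth ((1 + fps_X) * fps_deriv B) n = fps_nth (fps_const \<gamma> * B) n"
      using rec[of n] by (cases n) (simp_all add: B_def distrib_right algebra_simps)
  qed
  have "(1 + F) * fps_compose (fps_deriv B) F = fps_const \<gamma> * fps_compose B F"
    using arg_cong[OF ode, of "\<lambda>X. fps_compose X F"]
    by (simp add: fps_compose_mult_distrib[OF F0] fps_compose_add_distrib fps_X_fps_compose_startby0[OF F0])
  moreover have "one_plus_power F \<gamma> = fps_compose B F" by (simp add: one_plus_power_def B_def)
  ultimately show ?thesis
    by (simp add: fps_compose_deriv[OF F0] dF mult_ac)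
qed

lemma one_plus_power_nth_0: "fps_nth (one_plus_power F \<gamma>) 0 = 1"
  by (simp add: one_plus_power_def binom_of_def)

lemma g_series_nth_0: "fps_nth (g_series F \<gamma> lam) 0 = 1"
  by (simp add: g_series_def one_plus_power_nth_0)

lemma g_series_ode:
  fixes F Q :: "'a::{idom, real_algebra_1} fps"
  assumes F0: "fps_nth F 0 = 0" and dF: "fps_deriv F = (1 + F) * Q"
  shows "fps_deriv (g_series F \<gamma> lam) = (fps_const \<gamma> + fps_const lam * (1 + F)) * Q * g_series F \<gamma> lam"
proof -
  have "fps_deriv (fps_exp_of (fps_const lam * F)) =
      fps_const lam * ((1 + F) * Q) * fps_exp_of (fps_const lam * F)"
    by (subst fps_deriv_exp_of) (simp_all add: F0 dF)
  then show ?thesis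
    by (simp add: g_series_def one_plus_power_ode[OF F0 dF] algebra_simps)
qed

section \<open>Inverse arrays and convolutions\<close>

lemma flow_of_compositional_inverse:
  fixes f :: "real fps"
  assumes f0: "fps_nth f 0 = 0" and f1: "fps_nth f 1 \<noteq> 0"
  defines "P \<equiv> 1 / ((1 + fps_X) * fps_deriv (fps_inv f))"
  shows "fps_deriv f = (1 + f) * fps_compose P f"
proof -
  let ?D = "fps_deriv (fps_inv f)"
  have inv: "fps_compose (fps_inv f) f = fps_X" using f0 f1 by (rule fps_inv)
  have D: "fps_compose ?D f * fps_deriv f = 1"
    using arg_cong[OF inv, of fps_deriv] by (simp add: fps_compose_deriv[OF f0])
  have "fps_nth ?D 0 * fps_nth f 1 = 1"
    using arg_cong[OF D, of "\<lambda>X. fps_nth X 0"] by simp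
  then have nz: "fps_nth ((1 + fps_X) * ?D) 0 \<noteq> 0" by auto
  have "(1 + fps_X) * ?D * P = 1"
    unfolding P_def using nz by (simp add: fps_divide_unit inverse_mult_eq_1')
  from arg_cong[OF this, of "\<lambda>X. fps_compose X f"]
  have "(1 + f) * fps_compose ?D f * fps_compose P f = 1"
    by (simp add: fps_compose_mult_distrib[OF f0] fps_compose_add_distrib
        fps_X_fps_compose_startby0[OF f0])
  then have "fps_deriv f = fps_deriv f * ((1 + f) * fps_compose ?D f * fps_compose P f)" by simp
  also have "\<dots> = (fps_compose ?D f * fps_deriv f) * ((1 + f) * fps_compose P f)"
    by (simp add: mult_ac)
  finally show ?thesis by (simp add: D)
qed

lemma coeffwise_SM_shift:
  assumes "coeffwise_SM \<alpha>"
  shows "coeffwise_SM (\<lambda>n. \<alpha> (Suc n))"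
  using totally_positive_submatrix[OF assms[unfolded coeffwise_SM_def], of Suc id]
  unfolding coeffwise_SM_def by (simp add: strict_mono_def)

corollary coeffwise_SM_imp_Stieltjes_moment:
  "coeffwise_SM a \<Longrightarrow> Stieltjes_moment a"
  by (intro Stieltjes_moment_of_psd coeffwise_SM_imp_psd)

text \<open>
  The inverse in the exponential Riordan group: summation over \<open>j\<close> composes the columns of the second
  array with \<open>f\<close> and multiplies them by \<open>g\<close>, which turns \<open>fps_inv f\<close> into \<open>t\<close> and cancels the factor.
\<close>

lemma exp_riordan_inverse:
  fixes f g :: "real fps"
  assumes f0: "fps_nth f 0 = 0" and f1: "fps_nth f 1 \<noteq> 0" and g0: "fps_nth g 0 = 1"
  shows "(\<Sum>j\<le>i. exp_riordan g f i j *
      exp_riordan (1 / fps_compose g (fps_inv f)) (fps_inv f) j k) = of_bool (i = k)"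
proof -
  let ?b = "fps_inv f"
  let ?u = "1 / fps_compose g ?b"
  have inv: "fps_compose ?b f = fps_X" using f0 f1 by (rule fps_inv)
  have b0: "fps_nth ?b 0 = 0" by (simp add: fps_inv_def)
  have u: "fps_compose g ?b * ?u = 1"
    using g0 by (simp add: fps_divide_unit inverse_mult_eq_1')
  have "fps_compose (fps_compose g ?b) f = g"
    by (simp add: fps_compose_assoc[OF f0 b0, symmetric] inv)
  moreover have "fps_compose (fps_compose g ?b * ?u) f = 1" unfolding u by simp
  ultimately have gu: "g * fps_compose ?u f = 1" by (simp only: fps_compose_mult_distrib[OF f0])
  have "fps_nth (g * fps_compose (?u * ?b ^ k) f) i =
      (\<Sum>j\<le>i. fps_nth (?u * ?b ^ k) j * fps_nth (g * f ^ j) i)"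
    by (rule fps_mult_compose_nth[OF f0]) (simp add: fps_compose_nth atLeast0AtMost)
  moreover have "g * fps_compose (?u * ?b ^ k) f = (g * fps_compose ?u f) * fps_X ^ k"
    by (simp add: fps_compose_mult_distrib[OF f0] inv mult.assoc flip: fps_compose_power[OF f0])
  ultimately have "(\<Sum>j\<le>i. fps_nth (?u * ?b ^ k) j * fps_nth (g * f ^ j) i) = fps_nth (fps_X ^ k) i"
    by (simp only: gu mult_1_left)
  also have "\<dots> = of_bool (i = k)" by simp
  finally have eq: "(\<Sum>j\<le>i. fps_nth (?u * ?b ^ k) j * fps_nth (g * f ^ j) i) = of_bool (i = k)" .
  have "(\<Sum>j\<le>i. exp_riordan g f i j * exp_riordan ?u ?b j k) =
      fact i / fact k * (\<Sum>j\<le>i. fps_nth (?u * ?b ^ k) j * fps_nth (g * f ^ j) i)"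
    unfolding exp_riordan_def sum_distrib_left by (intro sum.cong) auto
  then show ?thesis unfolding eq by auto
qed

lemma fps_map_id [simp]: "fps_map id f = f"
  by (rule fps_ext) simp

lemma minus_one_powi_diff: "(-1 :: real) powi (int n - int k) = (-1) ^ (n + k)"
  by (cases "even n"; cases "even k") (simp_all add: power_int_diff)

text \<open>
  With \<open>a\<close> and \<open>b\<close> the moments of \<open>M\<close> and \<open>N\<close>, the convolution is the iterated integral of the homogenized
  row polynomials \<open>W n x y\<close>.  For fixed \<open>x, y \<ge> 0\<close> these form a sequence with positive semidefinite
  Hankel matrices, and integration preserves this.
\<close>

theorem preserves_SM_exp_riordan:
  fixes f g P :: "real fps"
  assumes PF: "PF_function P" and f0: "fps_nth f 0 = 0"
    and df: "fps_deriv f = (1 + f) * fps_compose P f" and g0: "fps_nth g 0 = 1"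
    and dg: "fps_deriv g = (fps_const \<gamma> + fps_const lam * (1 + f)) * fps_compose P f * g"
    and nn: "0 \<le> \<gamma>" "0 \<le> lam"
  shows "preserves_SM (exp_riordan g f)"
  unfolding preserves_SM_def
proof (intro allI impI)
  let ?S = "exp_riordan g f"
  fix a b assume "Stieltjes_moment a" "Stieltjes_moment b"
  then obtain M N :: "real measure" where
    M: "sets M = sets (restrict_space borel {0..})" "\<And>k. integrable M (\<lambda>x. x ^ k)" "\<And>k. a k = (LINT x|M. x ^ k)" and
    N: "sets N = sets (restrict_space borel {0..})" "\<And>k. integrable N (\<lambda>y. y ^ k)" "\<And>k. b k = (LINT y|N. y ^ k)"
    unfolding Stieltjes_moment_def by blast
  have "space M = {0..}" "space N = {0..}"
    using sets_eq_imp_space_eq[OF M(1)] sets_eq_imp_space_eq[OF N(1)] by (simp_all add: space_restrict_space)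
  define W where "W n x y = (\<Sum>k\<le>n. ?S n k * x ^ k * y ^ (n - k))" for n and x y :: real
  define V where "V n x = (\<Sum>k\<le>n. ?S n k * x ^ k * b (n - k))" for n and x :: real
  define z where "z n = (\<Sum>k\<le>n. ?S n k * a k * b (n - k))" for n
  have SM: "coeffwise_SM (\<lambda>n. W n x y)" if "0 \<le> x" "0 \<le> y" for x y
    unfolding W_def using PF f0 df g0 dg nn that
    by (intro homogenized_coeffwise_SM[where f = f and P = P and Q = "fps_compose P f" and \<gamma> = \<gamma> and lam = lam])
       (simp_all add: nonneg_coeffs_real_def)
  have int_W: "integrable N (W n x)" and V_eq: "V n x = (LINT y|N. W n x y)" for n x
    unfolding W_def V_def using N(2) by (auto simp: N(3))
  have int_V: "integrable M (V n)" and z_eq: "z n = (LINT x|M. V n x)" for n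
    unfolding V_def z_def using M(2) by (auto simp: M(3))
  have quad: "0 \<le> (\<Sum>i<n. \<Sum>j<n. c i * c j * z (\<sigma> i j))"
    if W: "\<And>x y. 0 \<le> x \<Longrightarrow> 0 \<le> y \<Longrightarrow> 0 \<le> (\<Sum>i<n. \<Sum>j<n. c i * c j * W (\<sigma> i j) x y)"
    for n :: nat and c :: "nat \<Rightarrow> real" and \<sigma> :: "nat \<Rightarrow> nat \<Rightarrow> nat"
  proof -
    have V: "0 \<le> (\<Sum>i<n. \<Sum>j<n. c i * c j * V (\<sigma> i j) x)" if x: "0 \<le> x" for x
    proof -
      have "0 \<le> (LINT y|N. (\<Sum>i<n. \<Sum>j<n. c i * c j * W (\<sigma> i j) x y))"
        using W[OF x] \<open>space N = {0..}\<close> by (intro integral_nonneg_AE AE_I2) auto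
      also have "\<dots> = (\<Sum>i<n. \<Sum>j<n. c i * c j * V (\<sigma> i j) x)"
        using int_W by (simp add: V_eq)
      finally show ?thesis .
    qed
    have "0 \<le> (LINT x|M. (\<Sum>i<n. \<Sum>j<n. c i * c j * V (\<sigma> i j) x))"
      using V \<open>space M = {0..}\<close> by (intro integral_nonneg_AE AE_I2) auto
    also have "\<dots> = (\<Sum>i<n. \<Sum>j<n. c i * c j * z (\<sigma> i j))"
      using int_V by (simp add: z_eq)
    finally show ?thesis .
  qed
  have "Stieltjes_moment z"
  proof (rule Stieltjes_moment_of_psd)
    show "0 \<le> (\<Sum>i<n. \<Sum>j<n. c i * c j * z (i + j))" for n c
      by (rule quad) (rule coeffwise_SM_imp_psd(1)[OF SM])
    show "0 \<le> (\<Sum>i<n. \<Sum>j<n. c i * c j * z (Suc (i + j)))" for n c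
      by (rule quad) (rule coeffwise_SM_imp_psd(2)[OF SM])
  qed
  then show "Stieltjes_moment (\<lambda>n. \<Sum>k\<le>n. ?S n k * a k * b (n - k))"
    by (simp add: z_def[abs_def])
qed

section \<open>The main theorem\<close>

lemma nonneg_indeterminates_2:
  "nonneg_coeffs [:[:0, 1 :: real:]:]" "nonneg_coeffs [:0, 1 :: real poly:]"
  "nonneg_coeffs [:0, 1 :: real:]"
  by (simp_all only: nonneg_const_poly nonneg_indeterminate)

theorem theorem1p7:
  fixes f :: "real fps"
    and f2 :: "real poly poly fps" and f1 :: "real poly fps"
    and \<gamma>2 lam2 :: "real poly poly" and \<gamma>1 :: "real poly"
  assumes f_zero: "fps_nth f 0 = 0"
    and f_one: "fact 1 * fps_nth f 1 \<noteq> 0"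
    and PF: "PF_function (1 / ((1 + fps_X) * fps_deriv (fps_inv f)))"
    \<comment> \<open>\<open>f\<close> viewed over $R[\gamma,\lambda]$ and over $R[\gamma]$, and the indeterminates of these rings\<close>
  defines "f2 \<equiv> fps_map of_real f"
    and "f1 \<equiv> fps_map of_real f"
    and "\<gamma>2 \<equiv> [:[:0, 1:]:]" and "lam2 \<equiv> [:0, 1:]"
    and "\<gamma>1 \<equiv> [:0, 1:]"
  shows
    "(coeffwise_SM (S_poly f2 (g_series f2 \<gamma>2 lam2)) \<and>
      log_convex 3 (S_poly f2 (g_series f2 \<gamma>2 lam2)) \<and>
      coeffwise_SM (S_star f2 (g_series f2 \<gamma>2 lam2)) \<and>
      log_convex 3 (S_star f2 (g_series f2 \<gamma>2 lam2))) \<and>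
     (coeffwise_SM (S_poly f1 (one_plus_power f1 \<gamma>1)) \<and>
      log_convex 3 (S_poly f1 (one_plus_power f1 \<gamma>1))) \<and>
     (Stieltjes_moment (\<lambda>n. fact (n + 1) * fps_nth f (n + 1)) \<and>
      log_convex 3 (\<lambda>n. fact (n + 1) * fps_nth f (n + 1))) \<and>
     totally_positive (S_coeff f2 (g_series f2 \<gamma>2 lam2)) \<and>
     (\<forall>\<gamma> lam :: real. \<gamma> \<ge> 0 \<longrightarrow> lam \<ge> 0 \<longrightarrow>
        totally_positive (\<lambda>n k. (- 1) powi (int n - int k) *
          S_coeff (fps_inv f) (1 / fps_compose (g_series f \<gamma> lam) (fps_inv f)) n k)) \<and>
     (\<forall>\<gamma> lam :: real. \<gamma> \<ge> 0 \<longrightarrow> lam \<ge> 0 \<longrightarrow>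
        preserves_SM (S_coeff f (g_series f \<gamma> lam)))"
proof -
  define P where "P = 1 / ((1 + fps_X) * fps_deriv (fps_inv f))"
  have PF: "PF_function P" using PF by (simp add: P_def)
  have f_1: "fps_nth f 1 \<noteq> 0" using f_one by simp
  have df: "fps_deriv f = (1 + f) * fps_compose P f"
    unfolding P_def using f_zero f_1 by (rule flow_of_compositional_inverse)
  define Q2 :: "real poly poly fps" where "Q2 = fps_map of_real (fps_compose P f)"
  define Q1 :: "real poly fps" where "Q1 = fps_map of_real (fps_compose P f)"
  have F0: "fps_nth f2 0 = 0" "fps_nth f1 0 = 0" by (simp_all add: f2_def f1_def f_zero)
  have dF: "fps_deriv f2 = (1 + f2) * Q2" "fps_deriv f1 = (1 + f1) * Q1"
    unfolding f2_def f1_def Q2_def Q1_def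
    by (simp_all add: df fps_map_of_real(1-3) flip: fps_map_of_real(5))
  have nn: "nonneg_coeffs \<gamma>2" "nonneg_coeffs lam2" "nonneg_coeffs \<gamma>1" "nonneg_coeffs (0 :: real poly)"
    unfolding \<gamma>2_def lam2_def \<gamma>1_def by (rule nonneg_indeterminates_2 nonneg_zero)+
  note ode2 = g_series_ode[OF F0(1) dF(1), of \<gamma>2 lam2]
  note two = PF f_zero df meta_eq_to_obj_eq[OF f2_def] Q2_def g_series_nth_0 ode2 nn(1,2)
  note i = S_poly_S_star_coeffwise_SM[OF two]
  have ode1: "fps_deriv (one_plus_power f1 \<gamma>1) =
      (fps_const \<gamma>1 + fps_const 0 * (1 + f1)) * Q1 * one_plus_power f1 \<gamma>1"
    using one_plus_power_ode[OF F0(2) dF(2), of \<gamma>1] by simp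
  note ii = S_poly_S_star_coeffwise_SM[OF PF f_zero df meta_eq_to_obj_eq[OF f1_def] Q1_def
      one_plus_power_nth_0 ode1 nn(3,4)]
  have iii: "coeffwise_SM (\<lambda>n. fact (n + 1) * fps_nth f (n + 1))"
  proof -
    have "coeffwise_SM (\<lambda>n. \<Sum>k\<le>n. exp_riordan (1 + f) f n k * 0 ^ k * 1 ^ (n - k))"
      by (rule homogenized_coeffwise_SM[OF PF f_zero df, where Q = "fps_compose P f" and \<gamma> = 1 and lam = 0])
         (simp_all add: nonneg_coeffs_real_def f_zero df)
    moreover have "(\<Sum>k\<le>n. exp_riordan (1 + f) f n k * 0 ^ k * 1 ^ (n - k)) = fact n * fps_nth (1 + f) n" for n
    proof -
      have "(\<Sum>k\<le>n. exp_riordan (1 + f) f n k * 0 ^ k * 1 ^ (n - k)) =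
          (\<Sum>k\<in>{0}. exp_riordan (1 + f) f n k * 0 ^ k * 1 ^ (n - k))"
        by (rule sum.mono_neutral_right) auto
      then show ?thesis by (simp add: exp_riordan_def)
    qed
    ultimately have "coeffwise_SM (\<lambda>n. fact n * fps_nth (1 + f) n)" by simp
    from coeffwise_SM_shift[OF this] show ?thesis by simp
  qed
  have iv: "totally_positive (S_coeff f2 (g_series f2 \<gamma>2 lam2))"
    unfolding S_coeff_eq[OF F0(1)] by (rule exp_riordan_of_PF_flow_totally_positive[OF two])
  have ode: "fps_deriv (g_series f \<gamma> lam) =
      (fps_const \<gamma> + fps_const lam * (1 + f)) * fps_compose P f * g_series f \<gamma> lam" for \<gamma> lam :: real
    by (rule g_series_ode[OF f_zero df])
  have v: "totally_positive (\<lambda>n k. (- 1) powi (int n - int k) *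
      S_coeff (fps_inv f) (1 / fps_compose (g_series f \<gamma> lam) (fps_inv f)) n k)"
    if "0 \<le> \<gamma>" "0 \<le> lam" for \<gamma> lam :: real
  proof -
    \<comment> \<open>The diagonal of the array consists of powers of \<open>f\<^sub>1\<close>, which is nonzero and equals \<open>P(0) \<ge> 0\<close>.\<close>
    let ?g = "g_series f \<gamma> lam"
    have inv0: "fps_nth (fps_inv f) 0 = 0" by (simp add: fps_inv_def)
    have P0: "0 < fps_nth f 1"
    proof -
      have "0 \<le> fps_nth P 0"
        using totally_positive_entry[OF PF[unfolded PF_function_def], of 0 0]
        by (simp add: nonneg_coeffs_real_def)
      moreover have "fps_nth f 1 = fps_nth P 0"
        using arg_cong[OF df, of "\<lambda>X. fps_nth X 0"] f_zero by simp
      ultimately show ?thesis using f_1 by simp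
    qed
    have TP: "totally_positive (exp_riordan ?g f)"
      by (rule exp_riordan_of_PF_flow_totally_positive[OF PF f_zero df _ _ g_series_nth_0 ode])
         (use that in \<open>simp_all add: nonneg_coeffs_real_def\<close>)
    have "totally_positive (\<lambda>n k. (- 1) ^ (n + k) *
        exp_riordan (1 / fps_compose ?g (fps_inv f)) (fps_inv f) n k)"
    proof (rule totally_positive_signed_inverse[OF TP])
      show "exp_riordan ?g f i j = 0" if "i < j" for i j
        using fps_mult_power_nth_zero[OF f_zero that] by (simp add: exp_riordan_def)
      show "0 < exp_riordan ?g f i i" for i
      proof -
        have "fps_nth (?g * f ^ i) i = fps_nth f 1 ^ i"
        proof -
          have "fps_nth (?g * f ^ i) i = (\<Sum>j\<in>{0}. fps_nth ?g j * fps_nth (f ^ i) (i - j))"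
            unfolding fps_mult_nth using startsby_zero_power_prefix[OF f_zero, of i]
            by (intro sum.mono_neutral_right) auto
          then show ?thesis by (simp add: g_series_nth_0 startsby_zero_power_nth_same[OF f_zero])
        qed
        then show ?thesis using P0 by (simp add: exp_riordan_def)
      qed
    qed (rule exp_riordan_inverse[OF f_zero f_1 g_series_nth_0])
    then show ?thesis by (simp only: S_coeff_eq[OF inv0] minus_one_powi_diff)
  qed
  have vi: "preserves_SM (S_coeff f (g_series f \<gamma> lam))" if "0 \<le> \<gamma>" "0 \<le> lam" for \<gamma> lam :: real
    unfolding S_coeff_eq[OF f_zero]
    by (rule preserves_SM_exp_riordan[OF PF f_zero df g_series_nth_0 ode that])
  show ?thesis
    by (intro conjI allI impI i ii(1) iii iv v vi
        coeffwise_SM_imp_log_convex_3 coeffwise_SM_imp_Stieltjes_moment)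
qed

end
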